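(* Let $\gamma_a$ be a Gamma random variable with parameter $a$. For all $a,s>0$, the distribution of $\gamma_a^{-s}$ is a generalized Gamma convolution.
   Context: For $a>0$, $\gamma_a$ denotes a random variable with density $\frac{x^{a-1}}{\Gamma(a)}e^{-x}\mathbf{1}_{(0,+\infty)}(x)$. The distribution of a positive random variable $X$ is a generalized Gamma convolution if its Laplace exponent can be written $-\log\mathbb{E}[e^{-\lambda X}]=d\lambda+\int_0^\infty(1-e^{-\lambda x})\frac{k(x)}{x}\,dx$ for all $\lambda\ge 0$, with $d\ge 0$, $\int_0^\infty (1\wedge x)\frac{k(x)}{x}\,dx<\infty$, and $k:(0,+\infty)\to[0,+\infty)$ completely monotone, i.e. $C^\infty$ with $(-1)^n k^{(n)}\ge 0$ for all integers $n\ge 0$. *)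

theory Defs
  imports "HOL-Probability.Probability"
begin

definition gamma_density :: "real \<Rightarrow> real \<Rightarrow> real" where
  "gamma_density a x = x powr (a - 1) / Gamma a * exp (- x) * indicator {0<..} x"

(* Only the values of k on the open half-line matter: it is open, so the iterated
   derivatives at points x > 0 do not depend on k outside it. Differentiability of every
   iterated derivative there is smoothness; the sign condition with n = 0 says k >= 0. *)
definition completely_monotone :: "(real \<Rightarrow> real) \<Rightarrow> bool" where
  "completely_monotone k \<longleftrightarrow>
     (\<forall>n. \<forall>x>0. (deriv ^^ n) k field_differentiable (at x) \<and> 0 \<le> (-1) ^ n * (deriv ^^ n) k x)"

(* A predicate on laws: \<mu> is the distribution of an almost surely positive random variable.
   The Bochner integrals below are genuine (never the default value 0 of a non-integrable
   function): exp (- t x) is bounded on the support of \<mu>, and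
   0 <= 1 - exp (- t x) <= max 1 t * min 1 x for t >= 0 and x > 0. *)
definition generalized_gamma_convolution :: "real measure \<Rightarrow> bool" where
  "generalized_gamma_convolution \<mu> \<longleftrightarrow>
     prob_space \<mu> \<and> sets \<mu> = sets borel \<and> (AE x in \<mu>. 0 < x) \<and>
     (\<exists>d k. 0 \<le> d \<and> completely_monotone k \<and>
        set_integrable lborel {0<..} (\<lambda>x. min 1 x * (k x / x)) \<and>
        (\<forall>t\<ge>0. - ln (\<integral>x. exp (- t * x) \<partial>\<mu>)
                 = d * t + (LBINT x:{0<..}. (1 - exp (- t * x)) * (k x / x))))"

end

theory Submission
  imports Defs "HOL-Complex_Analysis.Complex_Analysis" "HOL-Real_Asymp.Real_Asymp"
begin

text \<open>
  Let $U$ be uniform. The variable $\gamma_a^{-s}$ is the limit in law of $n^{-s} \beta_{a,n+1}^{-s}$, and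
  $\beta_{a,n+1}$ is obtained by successively multiplying independent powers of $U$. Multiplication by the
  Pareto variable $U^{-1/c}$ turns a Laplace transform $\varphi$ into the solution $\Phi$ of
  $z \Phi' = c (\Phi - \varphi)$. Hence $V = \Phi / \varphi$ solves, in the variable $w = \log z$, the linear
  equation $V' = (c - r) V - c$ with $r = \varphi' / \varphi$. At the smallest height $\mathrm{Im}\, w$ at which
  $\mathrm{Im}\, V = \varepsilon > 0$ this equation gives $\partial_x \mathrm{Im}\, V = 0$ and
  $\partial_y \mathrm{Im}\, V < 0$ as soon as $\mathrm{Im}\, r \le 0$, a contradiction. So the property
  ``no zeros, and $\mathrm{Im} (\varphi' / \varphi) \le 0$ in the strip $0 < \mathrm{Im}\, w < \pi$'' passes from
  $\varphi$ to $\Phi$. The recursion starts from $(1 + z/n)^{-n}$ instead of $e^{-z}$, which keeps all functions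
  bounded in closed substrips.

  For such $\varphi$, the function $q = - \varphi' / \varphi$, compressed to $q (\kappa w)$ with $\kappa < 1$,
  extends beyond the cut and Cauchy's theorem represents it by a nonnegative Stieltjes density. By Helly
  selection the representation survives $n \to \infty$, $\kappa \to 1$, and its Laplace transform is the
  completely monotone function $k$.
\<close>

section \<open>A barrier argument in the strip\<close>

text \<open>Why the recursion closes: U^(1/a) times an independent Beta (a + 1, k) variable has law
  Beta (a, k + 1), so the first parameter rises while the second falls, and the power -s turns the
  factor into U^(-s/a), whence c = a / s. The obstacle is control at infinity. A lowest bad point
  exists only if Im V tends to 0 as |Re w| grows, and exp (-z) explodes where Re z < 0. The powers
  (1 + z/m)^(-m) and all their mixtures tend to real constants at the left end and are asymptotic to
  real multiples of exp (- m w) at the right end, so the quotients V have real limits. A second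
  obstacle is the edge Im w = pi, where no boundary values are known; compression by \<kappa> moves
  it to the interior line of height \<kappa> pi. In the final weak limit mass could escape: towards
  t = 0 it would leave a constant in q, towards t = infinity a multiple of z, that is, a drift. The
  behaviour of q at both ends excludes this, so the drift d is 0.\<close>

lemma DERIV_Im_horizontal:
  assumes "(v has_field_derivative D) (at (Complex x y))"
  shows "((\<lambda>t. Im (v (Complex t y))) has_real_derivative Im D) (at x)"
proof -
  have "((\<lambda>t. Complex t y) has_vector_derivative 1) (at x)"
    unfolding has_vector_derivative_complex_iff by (auto intro!: derivative_eq_intros)
  from field_vector_diff_chain_at[OF this, of v D] assms
  have "((\<lambda>t. v (Complex t y)) has_vector_derivative D) (at x)"
    by (simp add: o_def)
  thus ?thesis unfolding has_vector_derivative_complex_iff by simp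
qed

lemma DERIV_Im_vertical:
  assumes "(v has_field_derivative D) (at (Complex x y))"
  shows "((\<lambda>t. Im (v (Complex x t))) has_real_derivative Re D) (at y)"
proof -
  have "((\<lambda>t. Complex x t) has_vector_derivative \<i>) (at y)"
    unfolding has_vector_derivative_complex_iff by (auto intro!: derivative_eq_intros)
  from field_vector_diff_chain_at[OF this, of v D] assms
  have "((\<lambda>t. v (Complex x t)) has_vector_derivative \<i> * D) (at y)"
    by (simp add: o_def)
  thus ?thesis unfolding has_vector_derivative_complex_iff by simp
qed

text \<open>\<open>lim\<close> confines the points with Im v >= e up to the height of
  \<open>w\<close> to a compact rectangle, so a lowest one exists, and \<open>real\<close> keeps it
  off the bottom edge. The equation is then evaluated at this point only.\<close>

lemma riccati_barrier:
  fixes v r :: "complex \<Rightarrow> complex" and c d :: real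
  assumes deriv: "\<And>w. 0 \<le> Im w \<Longrightarrow> Im w < pi \<Longrightarrow>
      (v has_field_derivative ((of_real c - r w) * v w - of_real d)) (at w)"
    and r: "\<And>w. 0 < Im w \<Longrightarrow> Im w < pi \<Longrightarrow> Im (r w) \<le> 0"
    and d: "0 < d"
    and real: "\<And>w. Im w = 0 \<Longrightarrow> Im (v w) \<le> 0"
    and lim: "\<And>\<theta> e. 0 < \<theta> \<Longrightarrow> \<theta> < pi \<Longrightarrow> 0 < e \<Longrightarrow>
      \<exists>B. \<forall>w. 0 \<le> Im w \<and> Im w \<le> \<theta> \<and> B \<le> \<bar>Re w\<bar> \<longrightarrow> Im (v w) < e"
    and w: "0 < Im w" "Im w < pi"
  shows "Im (v w) \<le> 0"
proof (rule ccontr)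
  assume "\<not> Im (v w) \<le> 0"
  define e where "e = Im (v w)"
  have e: "0 < e" using \<open>\<not> Im (v w) \<le> 0\<close> by (simp add: e_def)
  obtain B where B: "\<And>z. 0 \<le> Im z \<Longrightarrow> Im z \<le> Im w \<Longrightarrow> B \<le> \<bar>Re z\<bar> \<Longrightarrow> Im (v z) < e"
    using lim[OF w e] by blast
  define R where "R = cbox (Complex (-B) 0) (Complex B (Im w))"
  have inR: "z \<in> R \<longleftrightarrow> \<bar>Re z\<bar> \<le> B \<and> 0 \<le> Im z \<and> Im z \<le> Im w" for z
    by (auto simp: R_def in_cbox_complex_iff)
  have isc: "isCont v z" if "0 \<le> Im z" "Im z < pi" for z
    using deriv[OF that] by (rule DERIV_isCont)
  define K where "K = {z \<in> R. e \<le> Im (v z)}"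
  have "compact K"
  proof -
    have "continuous_on R (\<lambda>z. Im (v z))"
      using isc w by (intro continuous_intros continuous_at_imp_continuous_on) (auto simp: inR)
    hence "closed K" unfolding K_def
      by (intro continuous_on_closed_Collect_le) (auto simp: R_def intro!: continuous_intros)
    moreover have "bounded K" unfolding K_def R_def by (rule bounded_subset[OF bounded_cbox]) auto
    ultimately show ?thesis by (simp add: compact_eq_bounded_closed)
  qed
  moreover have wK: "w \<in> K"
  proof -
    have "\<bar>Re w\<bar> \<le> B" using B[of w] w by (cases "B \<le> \<bar>Re w\<bar>") (auto simp: e_def)
    thus ?thesis using w by (auto simp: K_def inR e_def)
  qed
  ultimately obtain p where p: "p \<in> K" "\<And>z. z \<in> K \<Longrightarrow> Im p \<le> Im z"
    using continuous_attains_inf[of K Im] continuous_on_Im[OF continuous_on_id, of K] by auto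
  \<comment> \<open>\<open>p\<close> is lowest only within \<open>R\<close>, but outside
    \<open>R\<close> the choice of \<open>B\<close> already gives Im v < e. The bound thus holds at
    every real part, which makes \<open>p\<close> a maximum along its whole horizontal line.\<close>
  have below: "Im (v z) < e" if "0 \<le> Im z" "Im z < Im p" for z
  proof (rule ccontr)
    assume *: "\<not> Im (v z) < e"
    have "Im p \<le> Im w" using p(2)[OF wK] .
    hence zw: "Im z \<le> Im w" using that by simp
    have "\<bar>Re z\<bar> \<le> B" using B[OF that(1) zw] * by (cases "B \<le> \<bar>Re z\<bar>") auto
    hence "z \<in> K" using * zw that by (auto simp: K_def inR)
    from p(2)[OF this] that show False by simp
  qed
  have p_le: "Im p \<le> Im w" "0 \<le> Im p" "e \<le> Im (v p)" using p(1) by (auto simp: K_def inR)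
  have p0: "0 < Im p"
    using real[of p] p_le e by (cases "Im p = 0") auto
  have upper: "Im (v (Complex x (Im p))) \<le> e" for x
  proof -
    have "isCont (\<lambda>t. Im (v (Complex x t))) (Im p)"
      using DERIV_isCont[OF DERIV_Im_vertical[OF deriv]] p0 p_le w by simp
    hence "((\<lambda>t. Im (v (Complex x t))) \<longlongrightarrow> Im (v (Complex x (Im p)))) (at_left (Im p))"
      by (simp add: isCont_def filterlim_at_split)
    moreover have "\<forall>\<^sub>F t in at_left (Im p). Im (v (Complex x t)) \<le> e"
      unfolding eventually_at_left_field using below p0 by (intro exI[of _ 0]) (auto intro!: less_imp_le)
    ultimately show ?thesis by (rule tendsto_upperbound) simp
  qed
  have pe: "Im (v p) = e" using upper[of "Re p"] p_le(3) by simp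
  define D where "D = (of_real c - r p) * v p - of_real d"
  have D: "(v has_field_derivative D) (at (Complex (Re p) (Im p)))"
    using deriv[of p] p_le p0 w by (simp add: D_def)
  have "Im D = 0"
    by (rule DERIV_local_max[OF DERIV_Im_horizontal[OF D], of 1]) (use upper pe in auto)
  moreover have "0 \<le> Re D"
  proof (rule ccontr)
    assume "\<not> 0 \<le> Re D"
    then obtain \<delta> where \<delta>: "\<delta> > 0" "\<And>h. 0 < h \<Longrightarrow> h < \<delta> \<Longrightarrow> Im (v (Complex (Re p) (Im p))) < Im (v (Complex (Re p) (Im p - h)))"
      using DERIV_neg_dec_left[OF DERIV_Im_vertical[OF D]] by auto
    define h where "h = min (\<delta>/2) (Im p / 2)"
    have "0 < h" "h < \<delta>" "h < Im p" using \<delta>(1) p0 by (auto simp: h_def)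
    with \<delta>(2)[of h] below[of "Complex (Re p) (Im p - h)"] pe show False by simp
  qed
  moreover have "Im (r p) \<le> 0" using r p0 p_le w by simp
  ultimately show False
  proof -
    \<comment> \<open>Here c - r p = A + i \<sigma> and v p = x + i e. Vanishing of Im D reads A e =
      - \<sigma> x; multiplication by x gives A x <= 0 whatever the sign of A, so Re D <= - d <
      0.\<close>
    assume imD: "Im D = 0" and reD: "0 \<le> Re D" and ir: "Im (r p) \<le> 0"
    define A where "A = c - Re (r p)"
    define \<sigma> where "\<sigma> = - Im (r p)"
    define x where "x = Re (v p)"
    have 1: "A * e + \<sigma> * x = 0" using imD pe by (simp add: D_def A_def \<sigma>_def x_def)
    have 2: "0 \<le> A * x - \<sigma> * e - d" using reD pe by (simp add: D_def A_def \<sigma>_def x_def)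
    have "e * (A * x) = - (\<sigma> * x\<^sup>2)" using 1 by (simp add: power2_eq_square algebra_simps) algebra
    also have "\<dots> \<le> 0" using ir by (simp add: \<sigma>_def mult_nonpos_nonneg)
    finally have "A * x \<le> 0" using e by (simp add: mult_le_0_iff)
    moreover have "0 \<le> \<sigma> * e" using ir e by (simp add: \<sigma>_def mult_nonpos_nonneg)
    ultimately show False using 2 d by linarith
  qed
qed

text \<open>At a zero the right-hand side of the equation is - d, so Im v has vertical slope - d and
  is positive just below the zero, against \<open>below\<close>.\<close>

lemma riccati_nonzero:
  fixes v r :: "complex \<Rightarrow> complex" and c d :: real
  assumes deriv: "(v has_field_derivative ((of_real c - r w) * v w - of_real d)) (at w)"
    and below: "\<And>z. 0 < Im z \<Longrightarrow> Im z < pi \<Longrightarrow> Im (v z) \<le> 0"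
    and d: "0 < d" and w: "0 < Im w" "Im w < pi"
  shows "v w \<noteq> 0"
proof
  assume 0: "v w = 0"
  have "(v has_field_derivative (- of_real d)) (at (Complex (Re w) (Im w)))"
    using deriv 0 by simp
  from DERIV_neg_dec_left[OF DERIV_Im_vertical[OF this]] d
  obtain \<delta> where \<delta>: "\<delta> > 0" "\<And>h. 0 < h \<Longrightarrow> h < \<delta> \<Longrightarrow> Im (v w) < Im (v (Complex (Re w) (Im w - h)))"
    by auto
  define h where "h = min (\<delta>/2) (Im w / 2)"
  have "0 < h" "h < \<delta>" "h < Im w" using \<delta>(1) w by (auto simp: h_def)
  with \<delta>(2)[of h] below[of "Complex (Re w) (Im w - h)"] 0 w show False by simp
qed

text \<open>Here $w = \log z$ for the Laplace variable $z$, so the strip is the upper half-plane.\<close>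

definition argument_decreasing :: "(complex \<Rightarrow> complex) \<Rightarrow> bool" where
  "argument_decreasing f \<longleftrightarrow> (\<forall>w. 0 < Im w \<longrightarrow> Im w < pi \<longrightarrow> f w \<noteq> 0 \<and> Im (deriv f w / f w) \<le> 0)"

text \<open>For v = \<Phi> / \<phi> the logarithmic derivative of \<Phi> is c - d / v, whose
  imaginary part has the sign of Im v, and a zero of \<Phi> is a zero of v; the two preceding lemmas
  give both halves. The constants c and d may differ because the mixtures used later are not
  normalised.\<close>

lemma argument_decreasing_step:
  fixes \<phi> \<Phi> :: "complex \<Rightarrow> complex" and c d :: real
  assumes phi: "argument_decreasing \<phi>"
    and hol: "\<And>w. \<bar>Im w\<bar> < pi \<Longrightarrow> \<phi> field_differentiable (at w)"
    and real: "\<And>w. Im w = 0 \<Longrightarrow> \<phi> w \<noteq> 0 \<and> Im (\<Phi> w / \<phi> w) = 0"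
    and deriv: "\<And>w. \<bar>Im w\<bar> < pi \<Longrightarrow> (\<Phi> has_field_derivative (of_real c * \<Phi> w - of_real d * \<phi> w)) (at w)"
    and d: "0 < d"
    and lim: "\<And>\<theta> e. 0 < \<theta> \<Longrightarrow> \<theta> < pi \<Longrightarrow> 0 < e \<Longrightarrow>
      \<exists>B. \<forall>w. 0 \<le> Im w \<and> Im w \<le> \<theta> \<and> B \<le> \<bar>Re w\<bar> \<longrightarrow> Im (\<Phi> w / \<phi> w) < e"
  shows "argument_decreasing \<Phi>"
proof -
  define v where "v = (\<lambda>w. \<Phi> w / \<phi> w)"
  define r where "r = (\<lambda>w. deriv \<phi> w / \<phi> w)"
  have nz: "\<phi> w \<noteq> 0" if "0 \<le> Im w" "Im w < pi" for w
    using phi real that unfolding argument_decreasing_def by (cases "Im w = 0") auto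
  have dv: "(v has_field_derivative ((of_real c - r w) * v w - of_real d)) (at w)"
    if "0 \<le> Im w" "Im w < pi" for w
  proof -
    have "(\<phi> has_field_derivative deriv \<phi> w) (at w)"
      using hol[of w] that by (simp add: DERIV_deriv_iff_field_differentiable)
    from DERIV_divide[OF deriv this nz[OF that]] that
    have "(v has_field_derivative ((of_real c * \<Phi> w - of_real d * \<phi> w) * \<phi> w - \<Phi> w * deriv \<phi> w) / (\<phi> w * \<phi> w)) (at w)"
      by (simp add: v_def)
    also have "((of_real c * \<Phi> w - of_real d * \<phi> w) * \<phi> w - \<Phi> w * deriv \<phi> w) / (\<phi> w * \<phi> w)
        = (of_real c - r w) * v w - of_real d"
      using nz[OF that] by (simp add: v_def r_def field_simps)
    finally show ?thesis .
  qed
  have neg: "Im (v w) \<le> 0" if "0 < Im w" "Im w < pi" for w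
    by (rule riccati_barrier[of v c r d]) (use dv phi d lim real that in \<open>auto simp: v_def r_def argument_decreasing_def\<close>)
  have nz': "v w \<noteq> 0" if "0 < Im w" "Im w < pi" for w
    by (rule riccati_nonzero[of v c r w d]) (use dv[of w] neg d that in auto)
  show ?thesis unfolding argument_decreasing_def
  proof (intro allI impI conjI)
    fix w assume w: "0 < Im w" "Im w < pi"
    show Pz: "\<Phi> w \<noteq> 0" using nz'[OF w] by (auto simp: v_def)
    have "deriv \<Phi> w = of_real c * \<Phi> w - of_real d * \<phi> w"
      using deriv[of w] w by (intro DERIV_imp_deriv) auto
    hence "deriv \<Phi> w / \<Phi> w = of_real c - of_real d * inverse (v w)"
      using nz[of w] Pz w by (simp add: v_def field_simps)
    hence "Im (deriv \<Phi> w / \<Phi> w) = d * (Im (v w) / ((Re (v w))\<^sup>2 + (Im (v w))\<^sup>2))"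
      by simp
    also have "\<dots> \<le> 0" using neg[OF w] d by (simp add: mult_le_0_iff divide_le_0_iff)
    finally show "Im (deriv \<Phi> w / \<Phi> w) \<le> 0" .
  qed
qed

section \<open>Powers of resolvents and their Beta mixtures\<close>

text \<open>The mean value inequality on the convex set \<open>S\<close> dominates the difference
  quotients by \<open>g\<close>. The field is left general: the lemma serves complex
  \<open>w\<close> in the strip and real Laplace variables alike.\<close>

lemma has_field_derivative_integral:
  fixes f f' :: "'a::{real_normed_field,banach,second_countable_topology} \<Rightarrow> 'b \<Rightarrow> 'a"
  assumes S: "open S" "convex S" "w \<in> S"
    and int: "\<And>z. z \<in> S \<Longrightarrow> integrable M (f z)"
    and deriv: "\<And>z x. z \<in> S \<Longrightarrow> x \<in> space M \<Longrightarrow> ((\<lambda>z. f z x) has_field_derivative f' z x) (at z)"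
    and bound: "\<And>z x. z \<in> S \<Longrightarrow> x \<in> space M \<Longrightarrow> norm (f' z x) \<le> g x"
    and g: "integrable M g"
    and meas: "f' w \<in> borel_measurable M"
  shows "((\<lambda>z. integral\<^sup>L M (f z)) has_field_derivative integral\<^sup>L M (f' w)) (at w)"
proof -
  have "((\<lambda>z. (integral\<^sup>L M (f z) - integral\<^sup>L M (f w)) / (z - w)) \<longlongrightarrow> integral\<^sup>L M (f' w)) (at w within S)"
    unfolding tendsto_at_iff_sequentially comp_def
  proof (intro allI impI)
    fix u :: "nat \<Rightarrow> 'a" assume u: "\<forall>i. u i \<in> S - {w}" "u \<longlonglongrightarrow> w"
    have "(\<lambda>i. \<integral>x. (f (u i) x - f w x) / (u i - w) \<partial>M) \<longlonglongrightarrow> integral\<^sup>L M (f' w)"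
    proof (rule integral_dominated_convergence[where w=g])
      show "(\<lambda>x. (f (u i) x - f w x) / (u i - w)) \<in> borel_measurable M" for i
        using int[of "u i"] int[of w] u S(3) by auto
      show "AE x in M. (\<lambda>i. (f (u i) x - f w x) / (u i - w)) \<longlonglongrightarrow> f' w x"
      proof (rule AE_I2)
        fix x assume "x \<in> space M"
        from deriv[OF S(3) this] have "((\<lambda>z. (f z x - f w x) / (z - w)) \<longlongrightarrow> f' w x) (at w within S)"
          unfolding has_field_derivative_iff by (rule tendsto_within_subset) simp
        with u show "(\<lambda>i. (f (u i) x - f w x) / (u i - w)) \<longlonglongrightarrow> f' w x"
          unfolding tendsto_at_iff_sequentially comp_def by blast
      qed
      show "AE x in M. norm ((f (u i) x - f w x) / (u i - w)) \<le> g x" for i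
      proof (rule AE_I2)
        fix x assume x: "x \<in> space M"
        have "norm (f (u i) x - f w x) \<le> g x * norm (u i - w)"
          by (rule field_differentiable_bound[OF S(2), where f'="\<lambda>z. f' z x"])
             (use deriv bound x u S(3) in \<open>auto intro: has_field_derivative_at_within\<close>)
        thus "norm ((f (u i) x - f w x) / (u i - w)) \<le> g x"
          using u by (auto simp: norm_divide field_simps)
      qed
    qed (use meas g in auto)
    moreover have "(\<integral>x. (f (u i) x - f w x) / (u i - w) \<partial>M)
        = (integral\<^sup>L M (f (u i)) - integral\<^sup>L M (f w)) / (u i - w)" for i
      using int[of "u i"] int[of w] u S(3) by simp
    moreover have "u i \<noteq> w" for i using u by auto
    ultimately show "(\<lambda>i. (integral\<^sup>L M (f (u i)) - integral\<^sup>L M (f w)) / (u i - w)) \<longlonglongrightarrow> integral\<^sup>L M (f' w)"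
      by simp
  qed
  thus ?thesis unfolding has_field_derivative_iff at_within_open[OF S(3,1)] .
qed

section \<open>Resolvent powers in closed substrips\<close>

text \<open>Rotation by - Im w / 2 gives the summands 1 and exp w / t the arguments - Im w / 2 and
  Im w / 2, so both real parts carry the same factor cos (Im w / 2).\<close>

lemma norm_one_plus_exp_ge:
  fixes w :: complex
  assumes "\<bar>Im w\<bar> \<le> \<theta>" "\<theta> < pi" "0 < t"
  shows "cos (\<theta>/2) * (1 + exp (Re w) / t) \<le> norm (1 + exp w / of_real t)"
proof -
  have "cos (\<theta>/2) \<le> cos (\<bar>Im w\<bar>/2)"
    using assms by (intro cos_monotone_0_pi_le) auto
  hence 1: "cos (\<theta>/2) * (1 + exp (Re w) / t) \<le> cos (Im w/2) * (1 + exp (Re w) / t)"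
    using assms by (intro mult_right_mono) (cases "0 \<le> Im w"; simp add: abs_if)+
  have "cos (Im w) = cos (Im w/2) * cos (Im w/2) - sin (Im w/2) * sin (Im w/2)"
    "sin (Im w) = sin (Im w/2) * cos (Im w/2) + cos (Im w/2) * sin (Im w/2)"
    using cos_add[of "Im w/2" "Im w/2"] sin_add[of "Im w/2" "Im w/2"] by simp_all
  note cs = this
  have "Re (cis (- Im w/2) * (1 + exp w / of_real t)) =
     cos (Im w/2) + exp (Re w) / t * (cos (Im w/2) * cos (Im w) + sin (Im w/2) * sin (Im w))"
    by (simp add: Re_exp Im_exp field_simps)
  also have "cos (Im w/2) * cos (Im w) + sin (Im w/2) * sin (Im w) = cos (Im w - Im w/2)"
    by (subst cos_diff) (simp add: mult.commute)
  also have "Im w - Im w/2 = Im w/2" by simp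
  finally have F: "Re (cis (- Im w/2) * (1 + exp w / of_real t))
      = cos (Im w/2) + exp (Re w) / t * cos (Im w/2)" .
  have "cos (Im w/2) * (1 + exp (Re w) / t) = Re (cis (- Im w/2) * (1 + exp w / of_real t))"
    unfolding F by (simp add: algebra_simps)
  also have "\<dots> \<le> norm (cis (- Im w/2) * (1 + exp w / of_real t))" by (rule complex_Re_le_cmod)
  also have "\<dots> = norm (1 + exp w / of_real t)" by (simp add: norm_mult)
  finally show ?thesis using 1 by linarith
qed

text \<open>At z = exp w this is the Laplace transform of the mean of m independent standard
  exponential variables, which tends to exp (- z). The companion \<open>resolvent_power'\<close> is
  the derivative in w, not in z.\<close>

definition resolvent_power :: "nat \<Rightarrow> complex \<Rightarrow> complex" where
  "resolvent_power m w = inverse ((1 + exp w / of_nat m) ^ m)"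

definition resolvent_power' :: "nat \<Rightarrow> complex \<Rightarrow> complex" where
  "resolvent_power' m w = - exp w * inverse ((1 + exp w / of_nat m) ^ Suc m)"

lemma one_plus_exp_ge:
  assumes "\<bar>Im w\<bar> \<le> \<theta>" "\<theta> < pi" "0 < m"
  shows "cos (\<theta>/2) * (1 + exp (Re w) / real m) \<le> norm (1 + exp w / of_nat m)"
  using norm_one_plus_exp_ge[of w \<theta> "real m"] assms by simp

lemma cos_half_pos: 
  assumes "\<bar>x\<bar> \<le> \<theta>" "\<theta> < pi" shows "0 < cos (\<theta>/2)"
proof -
  have "0 \<le> \<theta>" using assms(1) by linarith
  thus ?thesis using assms(2) by (intro cos_gt_zero_pi) auto
qed

lemma one_plus_exp_nonzero:
  assumes "\<bar>Im w\<bar> < pi" "0 < m"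
  shows "1 + exp w / of_nat m \<noteq> (0::complex)"
proof -
  have "0 < cos (\<bar>Im w\<bar>/2) * (1 + exp (Re w) / real m)"
    using cos_half_pos[of "Im w" "\<bar>Im w\<bar>"] assms by (auto intro!: mult_pos_pos add_pos_nonneg)
  also have "\<dots> \<le> norm (1 + exp w / of_nat m)" using one_plus_exp_ge[of w "\<bar>Im w\<bar>" m] assms by simp
  finally show ?thesis by auto
qed

lemma DERIV_resolvent_power:
  assumes "\<bar>Im w\<bar> < pi" "0 < m"
  shows "(resolvent_power m has_field_derivative resolvent_power' m w) (at w)"
proof -
  obtain j where j: "m = Suc j" using assms(2) by (cases m) auto
  define E where "E = 1 + exp w / of_nat m"
  have nz: "E \<noteq> 0" using one_plus_exp_nonzero[OF assms] by (simp add: E_def)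
  have "((\<lambda>w. inverse ((1 + exp w / of_nat m) ^ m)) has_field_derivative
     - (inverse (E ^ m) * (of_nat m * E ^ j * (exp w / of_nat m)) * inverse (E^m))) (at w)"
    using nz by (auto intro!: derivative_eq_intros simp: E_def j simp del: power_Suc of_nat_Suc) 
  also have "- (inverse (E ^ m) * (of_nat m * E ^ j * (exp w / of_nat m)) * inverse (E^m)) = resolvent_power' m w"
    using nz assms(2) by (simp add: resolvent_power'_def flip: E_def) (simp add: j field_simps del: of_nat_Suc)
  finally show ?thesis unfolding resolvent_power_def[abs_def] .
qed

lemma DERIV_resolvent_power_shift:
  assumes "\<bar>Im w\<bar> < pi" "0 < m"
  shows "((\<lambda>w. resolvent_power m (w - of_real c)) has_field_derivative resolvent_power' m (w - of_real c)) (at w)"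
proof -
  have "(resolvent_power m has_field_derivative resolvent_power' m (w - of_real c)) (at (w - of_real c))"
    using assms by (intro DERIV_resolvent_power) auto
  moreover have "((\<lambda>w. w - of_real c) has_field_derivative 1) (at w)"
    by (auto intro!: derivative_eq_intros)
  ultimately have "((\<lambda>w. resolvent_power m (w - of_real c)) has_field_derivative resolvent_power' m (w - of_real c) * 1) (at w)"
    by (rule DERIV_chain2)
  thus ?thesis by simp
qed

text \<open>The modulus of 1 + exp w / m is at least cos (\<theta>/2) times 1 and also times exp (Re
  w) / m. The last two bounds compensate the decay at the right end by exp (m w). All four serve as
  dominating constants for the mixtures.\<close>

lemma norm_resolvent_power_le:
  assumes "\<bar>Im w\<bar> \<le> \<theta>" "\<theta> < pi" "0 < m"
  shows "norm (resolvent_power m w) \<le> (1 / cos (\<theta>/2)) ^ m"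
    and "norm (resolvent_power' m w) \<le> real m * (1 / cos (\<theta>/2)) ^ Suc m"
    and "norm (exp (of_nat m * w) * resolvent_power m w) \<le> (real m / cos (\<theta>/2)) ^ m"
    and "norm (exp (of_nat m * w) * resolvent_power' m w) \<le> (real m / cos (\<theta>/2)) ^ Suc m"
proof -
  define C where "C = cos (\<theta>/2)"
  define E where "E = norm (1 + exp w / of_nat m)"
  define t where "t = exp (Re w)"
  have C: "0 < C" using cos_half_pos[OF assms(1,2)] by (simp add: C_def)
  have t: "0 < t" by (simp add: t_def)
  have E: "C * (1 + t / m) \<le> E" using one_plus_exp_ge[OF assms] by (simp add: C_def E_def t_def)
  have "C * 1 \<le> C * (1 + t / m)" "C * (t / m) \<le> C * (1 + t / m)" using C t by (intro mult_left_mono; simp)+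
  with E have E1: "C \<le> E" and E2: "C * (t / m) \<le> E" by auto
  have E0: "0 < E" using E1 C by linarith
  have i1: "inverse E \<le> 1 / C" using E1 C by (simp add: divide_inverse le_imp_inverse_le)
  have i2: "t * inverse E \<le> real m / C" using E2 E0 C assms(3) by (simp add: field_simps)
  have k: "norm (resolvent_power m w) = inverse E ^ m" by (simp add: resolvent_power_def norm_inverse norm_power E_def power_inverse)
  have k': "norm (resolvent_power' m w) = t * inverse E ^ Suc m"
    by (simp add: resolvent_power'_def norm_mult norm_inverse norm_power E_def power_inverse t_def)
  have e: "norm (exp (of_nat m * w)) = t ^ m"
    by (simp add: t_def exp_of_nat_mult norm_power)
  show "norm (resolvent_power m w) \<le> (1 / cos (\<theta>/2)) ^ m"
    unfolding k C_def[symmetric] using i1 E0 by (intro power_mono) auto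
  have "norm (resolvent_power' m w) = (t * inverse E) * inverse E ^ m" by (simp add: k')
  also have "\<dots> \<le> (real m / C) * (1/C) ^ m" using i1 i2 E0 t C by (intro mult_mono power_mono) auto
  finally show "norm (resolvent_power' m w) \<le> real m * (1 / cos (\<theta>/2)) ^ Suc m" by (simp add: C_def)
  have "norm (exp (of_nat m * w) * resolvent_power m w) = (t * inverse E) ^ m"
    unfolding norm_mult k e by (simp only: power_mult_distrib)
  also have "\<dots> \<le> (real m / C) ^ m" using i2 E0 t by (intro power_mono) auto
  finally show "norm (exp (of_nat m * w) * resolvent_power m w) \<le> (real m / cos (\<theta>/2)) ^ m" by (simp add: C_def)
  have "norm (exp (of_nat m * w) * resolvent_power' m w) = (t * inverse E) ^ Suc m"
    unfolding norm_mult k' e by (simp only: power_mult_distrib power_Suc mult_ac)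
  also have "\<dots> \<le> (real m / C) ^ Suc m" using i2 E0 t by (intro power_mono) auto
  finally show "norm (exp (of_nat m * w) * resolvent_power' m w) \<le> (real m / cos (\<theta>/2)) ^ Suc m" by (simp add: C_def)
qed

lemma exp_tendsto_0_seq:
  fixes u :: "nat \<Rightarrow> complex"
  assumes "filterlim (\<lambda>n. Re (u n)) at_bot sequentially"
  shows "(\<lambda>n. exp (u n)) \<longlonglongrightarrow> 0"
proof (rule tendsto_norm_zero_cancel)
  show "(\<lambda>n. norm (exp (u n))) \<longlonglongrightarrow> 0"
    using filterlim_compose[OF exp_at_bot assms] by simp
qed

lemma resolvent_power_limits_bot:
  assumes "filterlim (\<lambda>n. Re (u n)) at_bot sequentially"
  shows "(\<lambda>n. resolvent_power m (u n)) \<longlonglongrightarrow> 1" "(\<lambda>n. resolvent_power' m (u n)) \<longlonglongrightarrow> 0"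
proof -
  note e = exp_tendsto_0_seq[OF assms]
  have 1: "(\<lambda>n. 1 + exp (u n) * inverse (of_nat m)) \<longlonglongrightarrow> 1 + 0 * inverse (of_nat m)"
    by (intro tendsto_intros e)
  show "(\<lambda>n. resolvent_power m (u n)) \<longlonglongrightarrow> 1"
    unfolding resolvent_power_def divide_inverse using tendsto_inverse[OF tendsto_power[OF 1, of m]] by simp
  show "(\<lambda>n. resolvent_power' m (u n)) \<longlonglongrightarrow> 0"
    unfolding resolvent_power'_def divide_inverse using tendsto_mult[OF tendsto_minus[OF e] tendsto_inverse[OF tendsto_power[OF 1, of "Suc m"]]] by simp
qed

lemma resolvent_power_limits_top:
  assumes "filterlim (\<lambda>n. Re (u n)) at_top sequentially" "0 < m"
  shows "(\<lambda>n. exp (of_nat m * u n) * resolvent_power m (u n)) \<longlonglongrightarrow> of_nat m ^ m"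
    "(\<lambda>n. exp (of_nat m * u n) * resolvent_power' m (u n)) \<longlonglongrightarrow> - (of_nat m ^ Suc m)"
proof -
  have "(\<lambda>n. exp (- u n)) \<longlonglongrightarrow> 0"
    by (rule exp_tendsto_0_seq) (use assms in \<open>simp add: filterlim_uminus_at_top\<close>)
  hence 1: "(\<lambda>n. exp (- u n) + 1 / of_nat m) \<longlonglongrightarrow> 0 + 1 / of_nat m"
    by (intro tendsto_add tendsto_const)
  have ee: "exp (of_nat m * u n) = exp (u n) ^ m" for n by (simp add: exp_of_nat_mult)
  \<comment> \<open>Cancelling exp (u n) leaves a base that converges to 1 / m.\<close>
  have q: "exp (u n) * inverse (1 + exp (u n) / of_nat m) = inverse (exp (- u n) + 1 / of_nat m)" for n
  proof -
    have "1 + exp (u n) / of_nat m = exp (u n) * (exp (- u n) + 1 / of_nat m)"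
      by (simp add: algebra_simps exp_minus_inverse)
    thus ?thesis by simp
  qed
  have k: "exp (of_nat m * u n) * resolvent_power m (u n) = inverse (exp (- u n) + 1 / of_nat m) ^ m" for n
    unfolding resolvent_power_def ee q[symmetric] by (simp only: power_mult_distrib power_inverse)
  have k': "exp (of_nat m * u n) * resolvent_power' m (u n) = - (inverse (exp (- u n) + 1 / of_nat m) ^ Suc m)" for n
    unfolding resolvent_power'_def ee q[symmetric] by (simp only: power_mult_distrib power_inverse power_Suc inverse_mult_distrib mult_ac mult_minus_left mult_minus_right)
  show "(\<lambda>n. exp (of_nat m * u n) * resolvent_power m (u n)) \<longlonglongrightarrow> of_nat m ^ m"
    unfolding k using tendsto_power[OF tendsto_inverse[OF 1], of m] assms(2) by simp
  show "(\<lambda>n. exp (of_nat m * u n) * resolvent_power' m (u n)) \<longlonglongrightarrow> - (of_nat m ^ Suc m)"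
    unfolding k' using tendsto_minus[OF tendsto_power[OF tendsto_inverse[OF 1], of "Suc m"]] assms(2) by simp
qed

section \<open>Beta weights and mixtures of resolvent powers\<close>

lemma lborel_integral_pos:
  fixes f :: "real \<Rightarrow> real"
  assumes f: "integrable lborel f" and nn: "\<And>x. 0 \<le> f x" and ab: "a < b"
    and pos: "\<And>x. a < x \<Longrightarrow> x < b \<Longrightarrow> 0 < f x"
  shows "0 < (\<integral>x. f x \<partial>lborel)"
proof (rule ccontr)
  assume "\<not> 0 < (\<integral>x. f x \<partial>lborel)"
  hence "(\<integral>x. f x \<partial>lborel) = 0"
    using Bochner_Integration.integral_nonneg[of lborel f] nn by (simp add: order.antisym not_less)
  hence "AE x in lborel. f x = 0"
    using integral_nonneg_eq_0_iff_AE[OF f] nn by simp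
  hence "AE x in lborel. x \<notin> {a<..<b}"
    using pos by (elim eventually_mono) force
  hence "emeasure lborel {a<..<b} = 0"
    by (subst (asm) AE_iff_measurable[of "{a<..<b}"]) auto
  thus False using ab by simp
qed

text \<open>A constant multiple of the density of N times a Beta (a, k + 1) variable. Without the
  normalising constant, N = k tending to infinity leads directly to x^(a - 1) exp (- x), which also
  dominates these weights.\<close>

definition beta_weight :: "real \<Rightarrow> real \<Rightarrow> nat \<Rightarrow> real \<Rightarrow> real" where
  "beta_weight N a k x = indicator {0<..<N} x * (x powr (a - 1) * (1 - x / N) ^ k)"

lemma beta_weight_nonneg: "0 \<le> beta_weight N a k x" 
  by (auto simp: beta_weight_def indicator_def)

lemma beta_weight_pos: "0 < x \<Longrightarrow> x < N \<Longrightarrow> 0 < beta_weight N a k x" 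
  by (auto simp: beta_weight_def indicator_def)

lemma beta_weight_measurable [measurable]: "beta_weight N a k \<in> borel_measurable borel"
  unfolding beta_weight_def[abs_def] by measurable

lemma beta_weight_integrable:
  assumes "0 < a" "0 < N"
  shows "integrable lborel (beta_weight N a k)"
proof -
  have "(\<lambda>x::real. x powr (a - 1)) absolutely_integrable_on {0..N}"
    using assms by (intro nonnegative_absolutely_integrable_1 integrable_on_powr_from_0) auto
  hence "set_integrable lborel {0..N} (\<lambda>x::real. x powr (a - 1))"
    unfolding set_integrable_def by (subst (asm) integrable_completion) auto
  hence i: "integrable lborel (\<lambda>x. indicator {0..N} x * x powr (a - 1))"
    unfolding set_integrable_def by simp
  show ?thesis
  proof (rule Bochner_Integration.integrable_bound[OF i])
    show "AE x in lborel. norm (beta_weight N a k x) \<le> norm (indicator {0..N} x * x powr (a - 1))"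
    proof (rule AE_I2)
      fix x
      have "x powr (a-1) * (1 - x/N)^k \<le> x powr (a - 1) * 1" if "0 < x" "x < N"
        using that by (intro mult_left_mono power_le_one) auto
      thus "norm (beta_weight N a k x) \<le> norm (indicator {0..N} x * x powr (a - 1))"
        by (auto simp: beta_weight_def indicator_def)
    qed
  qed simp
qed

lemma beta_weight_integral_pos:
  assumes "0 < a" "0 < N"
  shows "0 < (\<integral>x. beta_weight N a k x \<partial>lborel)"
  by (rule lborel_integral_pos[OF beta_weight_integrable[OF assms] beta_weight_nonneg assms(2)]) (simp add: beta_weight_pos)

lemma beta_weight_shift: "x powr b * beta_weight N a k x = beta_weight N (a + b) k x"
  by (auto simp: beta_weight_def indicator_def algebra_simps powr_add[symmetric])

lemma isCont_resolvent_power':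
  assumes "\<bar>Im w\<bar> < pi" "0 < m"
  shows "isCont (resolvent_power' m) w"
  unfolding isCont_def resolvent_power'_def
  by (intro tendsto_mult tendsto_minus tendsto_inverse tendsto_power tendsto_add tendsto_divide
      tendsto_const tendsto_exp tendsto_ident_at) (use one_plus_exp_nonzero[OF assms] assms in auto)

lemma resolvent_power_measurable [measurable]: "resolvent_power m \<in> borel_measurable borel"
  unfolding resolvent_power_def[abs_def] by measurable

lemma resolvent_power'_measurable [measurable]: "resolvent_power' m \<in> borel_measurable borel"
  unfolding resolvent_power'_def[abs_def] by measurable

lemma beta_mixture_integrable:
  fixes \<psi> :: "complex \<Rightarrow> complex"
  assumes g: "integrable lborel g" and [measurable]: "\<psi> \<in> borel_measurable borel"
    and B: "\<And>z. Im z = Im w \<Longrightarrow> norm (\<psi> z) \<le> B"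
  shows "integrable lborel (\<lambda>x. of_real (g x) * \<psi> (w - of_real (s * ln x)))"
proof (rule Bochner_Integration.integrable_bound[where f="\<lambda>x. norm (g x) * B"])
  show "integrable lborel (\<lambda>x. norm (g x) * B)" using g by simp
  show "AE x in lborel. norm (of_real (g x) * \<psi> (w - of_real (s * ln x))) \<le> norm (norm (g x) * B)"
  proof (rule AE_I2)
    fix x show "norm (of_real (g x) * \<psi> (w - of_real (s * ln x))) \<le> norm (norm (g x) * B)"
      using mult_left_mono[OF order_trans[OF B[of "w - of_real (s * ln x)"] abs_ge_self], of "\<bar>g x\<bar>"]
      by (simp add: norm_mult abs_mult)
  qed
qed (use borel_measurable_integrable[OF g] in measurable)

lemma beta_mixture_limit:
  fixes \<psi> :: "complex \<Rightarrow> complex" and u :: "nat \<Rightarrow> complex"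
  assumes g: "integrable lborel g" and [measurable]: "\<psi> \<in> borel_measurable borel"
    and B: "\<And>z. \<bar>Im z\<bar> \<le> \<theta> \<Longrightarrow> norm (\<psi> z) \<le> B"
    and u: "\<And>n. \<bar>Im (u n)\<bar> \<le> \<theta>"
    and lim: "\<And>x. (\<lambda>n. \<psi> (u n - of_real (s * ln x))) \<longlonglongrightarrow> L"
  shows "(\<lambda>n. \<integral>x. of_real (g x) * \<psi> (u n - of_real (s * ln x)) \<partial>lborel) \<longlonglongrightarrow> of_real (\<integral>x. g x \<partial>lborel) * L"
proof -
  have "(\<lambda>n. \<integral>x. of_real (g x) * \<psi> (u n - of_real (s * ln x)) \<partial>lborel) \<longlonglongrightarrow> (\<integral>x. of_real (g x) * L \<partial>lborel)"
  proof (rule integral_dominated_convergence[where w="\<lambda>x. norm (g x) * B"])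
    show "AE x in lborel. (\<lambda>n. of_real (g x) * \<psi> (u n - of_real (s * ln x))) \<longlonglongrightarrow> of_real (g x) * L"
      by (intro AE_I2 tendsto_intros lim)
    show "AE x in lborel. norm (of_real (g x) * \<psi> (u n - of_real (s * ln x))) \<le> norm (g x) * B" for n
      using u by (intro AE_I2) (auto simp: norm_mult intro!: mult_left_mono B)
    show "integrable lborel (\<lambda>x. norm (g x) * B)" using g by simp
  qed (use borel_measurable_integrable[OF g] in measurable)
  thus ?thesis using g by simp
qed

lemma shift_limits:
  fixes u :: "nat \<Rightarrow> complex"
  shows "filterlim (\<lambda>n. Re (u n)) at_bot sequentially \<Longrightarrow> filterlim (\<lambda>n. Re (u n - of_real c)) at_bot sequentially"
    and "filterlim (\<lambda>n. Re (u n)) at_top sequentially \<Longrightarrow> filterlim (\<lambda>n. Re (u n - of_real c)) at_top sequentially"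
proof -
  assume "filterlim (\<lambda>n. Re (u n)) at_bot sequentially"
  thus "filterlim (\<lambda>n. Re (u n - of_real c)) at_bot sequentially"
    unfolding filterlim_at_bot by (simp add: algebra_simps)
next
  assume "filterlim (\<lambda>n. Re (u n)) at_top sequentially"
  thus "filterlim (\<lambda>n. Re (u n - of_real c)) at_top sequentially"
    unfolding filterlim_at_top by (simp add: algebra_simps)
qed

text \<open>Up to normalisation, the Laplace transform at z = exp w of X^(-s) G, with X the scaled
  Beta variable and G an independent mean of m exponential variables: multiplying z by x^(-s)
  subtracts s ln x from w.\<close>

definition beta_mixture :: "real \<Rightarrow> nat \<Rightarrow> real \<Rightarrow> real \<Rightarrow> nat \<Rightarrow> complex \<Rightarrow> complex" where
  "beta_mixture N m s a k w = (\<integral>x. of_real (beta_weight N a k x) * resolvent_power m (w - of_real (s * ln x)) \<partial>lborel)"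

definition beta_mixture' :: "real \<Rightarrow> nat \<Rightarrow> real \<Rightarrow> real \<Rightarrow> nat \<Rightarrow> complex \<Rightarrow> complex" where
  "beta_mixture' N m s a k w = (\<integral>x. of_real (beta_weight N a k x) * resolvent_power' m (w - of_real (s * ln x)) \<partial>lborel)"

lemma beta_mixture_resolvent_power_integrable:
  assumes "0 < a" "0 < N" "0 < m" "\<bar>Im w\<bar> < pi"
  shows "integrable lborel (\<lambda>x. of_real (beta_weight N a k x) * resolvent_power m (w - of_real (s * ln x)))"
    "integrable lborel (\<lambda>x. of_real (beta_weight N a k x) * resolvent_power' m (w - of_real (s * ln x)))"
proof -
  show "integrable lborel (\<lambda>x. of_real (beta_weight N a k x) * resolvent_power m (w - of_real (s * ln x)))"
    by (rule beta_mixture_integrable[OF beta_weight_integrable[OF assms(1,2)] resolvent_power_measurable norm_resolvent_power_le(1)[of _ "\<bar>Im w\<bar>" m]])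
      (use assms in auto)
  show "integrable lborel (\<lambda>x. of_real (beta_weight N a k x) * resolvent_power' m (w - of_real (s * ln x)))"
    by (rule beta_mixture_integrable[OF beta_weight_integrable[OF assms(1,2)] resolvent_power'_measurable norm_resolvent_power_le(2)[of _ "\<bar>Im w\<bar>" m]])
      (use assms in auto)
qed

lemma DERIV_beta_mixture:
  assumes "0 < a" "0 < N" "0 < m" "\<bar>Im w\<bar> < pi"
  shows "(beta_mixture N m s a k has_field_derivative beta_mixture' N m s a k w) (at w)"
proof -
  \<comment> \<open>A height strictly between |Im w| and pi: the substrip is a neighbourhood of w on
    which the resolvent bounds are uniform.\<close>
  define \<theta> where "\<theta> = (\<bar>Im w\<bar> + pi) / 2"
  define S where "S = {z. \<bar>Im z\<bar> < \<theta>}"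
  have th: "\<theta> < pi" "\<bar>Im w\<bar> < \<theta>" using assms(4) by (auto simp: \<theta>_def)
  have S': "S = {z. Im z < \<theta>} \<inter> {z. Im z > - \<theta>}" by (auto simp: S_def)
  have S: "open S" "convex S" "w \<in> S"
    using th unfolding S' by (auto intro!: open_Int open_halfspace_Im_lt open_halfspace_Im_gt convex_Int convex_halfspace_Im_lt convex_halfspace_Im_gt)
  let ?B = "real m * (1 / cos (\<theta>/2)) ^ Suc m"
  have "((\<lambda>z. \<integral>x. of_real (beta_weight N a k x) * resolvent_power m (z - of_real (s * ln x)) \<partial>lborel) has_field_derivative
     (\<integral>x. of_real (beta_weight N a k x) * resolvent_power' m (w - of_real (s * ln x)) \<partial>lborel)) (at w)"
  proof (rule has_field_derivative_integral[OF S, where g="\<lambda>x. beta_weight N a k x * ?B"])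
    show "integrable lborel (\<lambda>x. of_real (beta_weight N a k x) * resolvent_power m (z - of_real (s * ln x)))" if "z \<in> S" for z
      using that th assms by (intro beta_mixture_resolvent_power_integrable) (auto simp: S_def)
    show "((\<lambda>z. of_real (beta_weight N a k x) * resolvent_power m (z - of_real (s * ln x))) has_field_derivative
        of_real (beta_weight N a k x) * resolvent_power' m (z - of_real (s * ln x))) (at z)" if "z \<in> S" for z x
      using that th assms by (intro DERIV_cmult DERIV_resolvent_power_shift) (auto simp: S_def)
    show "norm (of_real (beta_weight N a k x) * resolvent_power' m (z - of_real (s * ln x))) \<le> beta_weight N a k x * ?B" if "z \<in> S" for z x
    proof -
      have "norm (resolvent_power' m (z - of_real (s * ln x))) \<le> ?B"
        by (rule norm_resolvent_power_le(2)) (use that th assms(3) in \<open>auto simp: S_def\<close>)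
      from mult_left_mono[OF this beta_weight_nonneg[of N a k x]] show ?thesis
        by (simp only: norm_mult norm_of_real abs_of_nonneg[OF beta_weight_nonneg])
    qed
    show "integrable lborel (\<lambda>x. beta_weight N a k x * ?B)" using beta_weight_integrable[OF assms(1,2), of k] by (simp del: power_Suc)
  qed simp
  thus ?thesis unfolding beta_mixture_def[abs_def] beta_mixture'_def .
qed

text \<open>Integration by parts against $x^a (1 - x/N)^k$; for $k = 0$ the boundary term at $N$ survives.\<close>

lemma beta_mixture'_eq:
  assumes "0 < a" "0 < N" "0 < m" "\<bar>Im w\<bar> < pi"
  shows "of_real s * beta_mixture' N m s a k w = of_real a * beta_mixture N m s a k w
      - of_real (real k / N) * beta_mixture N m s (a + 1) (k - 1) w
      - of_real (0 ^ k * N powr a) * resolvent_power m (w - of_real (s * ln N))"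
proof -
  define K where "K = (\<lambda>x::real. resolvent_power m (w - of_real (s * ln x)))"
  define K' where "K' = (\<lambda>x::real. resolvent_power' m (w - of_real (s * ln x)))"
  \<comment> \<open>The primitive carries x^a, one power more than the weight: differentiating
    \<open>K\<close> produces a factor s / x that restores x^(a - 1), and \<open>G\<close> vanishes
    at 0.\<close>
  define G where "G = (\<lambda>x::real. of_real (x powr a * (1 - x/N)^k) * K x)"
  \<comment> \<open>For k = 0 the truncated difference k - 1 is 0, and its coefficient k / N is 0
    too.\<close>
  define g where "g = (\<lambda>x. of_real a * (of_real (beta_weight N a k x) * K x)
      - of_real (real k / N) * (of_real (beta_weight N (a + 1) (k - 1) x) * K x)
      - of_real s * (of_real (beta_weight N a k x) * K' x))"
  have dK: "(K has_vector_derivative (- of_real (s / x) * K' x)) (at x)" if "0 < x" for x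
  proof -
    have "((\<lambda>x. w - of_real (s * ln x)) has_vector_derivative (- of_real (s / x))) (at x)"
      unfolding has_vector_derivative_complex_iff using that by (auto intro!: derivative_eq_intros)
    from field_vector_diff_chain_at[OF this, of "resolvent_power m"] DERIV_resolvent_power[of "w - of_real (s * ln x)" m] assms
    show ?thesis by (simp add: K_def K'_def o_def)
  qed
  have dG: "(G has_vector_derivative g x) (at x)" if "0 < x" "x < N" for x
  proof -
    have xa: "x powr a = x powr (a - 1) * x" using that by (simp add: powr_diff)
    have "((\<lambda>x. x powr a * (1 - x/N)^k) has_real_derivative
       (a * x powr (a - 1) * (1 - x/N)^k - (real k / N) * (x powr a * (1 - x/N)^(k-1)))) (at x)"
      using that by (auto intro!: derivative_eq_intros simp: powr_diff)
    hence "((\<lambda>x. complex_of_real (x powr a * (1 - x/N)^k)) has_vector_derivative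
       of_real (a * x powr (a - 1) * (1 - x/N)^k - (real k / N) * (x powr a * (1 - x/N)^(k-1)))) (at x)"
      by (intro has_vector_derivative_of_real) (simp add: has_real_derivative_iff_has_vector_derivative)
    from has_vector_derivative_mult[OF this dK[OF that(1)]] 
    have "(G has_vector_derivative (of_real (x powr a * (1 - x/N)^k) * (- of_real (s / x) * K' x)
      + of_real (a * x powr (a - 1) * (1 - x/N)^k - (real k / N) * (x powr a * (1 - x/N)^(k-1))) * K x)) (at x)"
      by (simp add: G_def)
    also have "of_real (x powr a * (1 - x/N)^k) * (- of_real (s / x) * K' x)
      + of_real (a * x powr (a - 1) * (1 - x/N)^k - (real k / N) * (x powr a * (1 - x/N)^(k-1))) * K x = g x"
    proof -
      have "of_real (x powr a * (1 - x/N)^k) * (- of_real (s / x) * K' x) = - of_real s * (of_real (beta_weight N a k x) * K' x)"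
        using that by (simp add: beta_weight_def xa)
      thus ?thesis using that by (simp add: g_def beta_weight_def algebra_simps)
    qed
    finally show ?thesis .
  qed
  have int: "integrable lborel (\<lambda>x. of_real (beta_weight N a k x) * K x)"
    "integrable lborel (\<lambda>x. of_real (beta_weight N (a + 1) (k - 1) x) * K x)"
    "integrable lborel (\<lambda>x. of_real (beta_weight N a k x) * K' x)"
    unfolding K_def K'_def using assms beta_mixture_resolvent_power_integrable[of a N m w k s]
      beta_mixture_resolvent_power_integrable[of "a + 1" N m w "k - 1" s] by auto
  hence gint: "integrable lborel g" unfolding g_def by auto
  have gind: "indicator {0<..<N} x *\<^sub>R g x = g x" for x
    by (auto simp: g_def beta_weight_def indicator_def)
  have Kb: "norm (K x) \<le> (1 / cos (\<bar>Im w\<bar>/2)) ^ m" for x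
    using norm_resolvent_power_le(1)[of "w - of_real (s * ln x)" "\<bar>Im w\<bar>" m] assms by (simp add: K_def)
  have contK: "isCont K x" if "0 < x" for x
    using dK[OF that] has_vector_derivative_continuous by blast
  have "(LBINT x=ereal 0..ereal N. g x) = of_real (0 ^ k * N powr a) * K N - 0"
  proof (rule interval_integral_FTC_integrable[where F=G])
    show "ereal 0 < ereal N" using assms by simp
    show "(G has_vector_derivative g x) (at x)" if "ereal 0 < ereal x" "ereal x < ereal N" for x
      using that dG by simp
    show "isCont g x" if "ereal 0 < ereal x" "ereal x < ereal N" for x
    proof -
      have x: "0 < x" "x < N" using that by auto
      \<comment> \<open>\<open>g\<close> with the indicators dropped; both agree on the open
        interval, so continuity carries over.\<close>
      define h where "h = (\<lambda>x. of_real a * (of_real (x powr (a-1) * (1 - x/N)^k) * K x)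
        - of_real (real k / N) * (of_real (x powr a * (1 - x/N)^(k-1)) * K x)
        - of_real s * (of_real (x powr (a-1) * (1 - x/N)^k) * K' x))"
      have "isCont (resolvent_power' m) (w - of_real (s * ln x))"
        using assms by (intro isCont_resolvent_power') auto
      moreover have "isCont (\<lambda>x. w - of_real (s * ln x)) x"
        using x(1) by (intro continuous_intros) auto
      ultimately have "isCont K' x" unfolding K'_def by (rule isCont_o2[rotated])
      hence "isCont h x" unfolding h_def using contK[OF x(1)] x assms by (intro continuous_intros) auto
      moreover have "eventually (\<lambda>y. g y = h y) (nhds x)"
        by (rule eventually_mono[OF eventually_nhds_in_open[of "{0<..<N}" x]])
          (use x in \<open>auto simp: g_def h_def beta_weight_def\<close>)
      ultimately show ?thesis by (simp add: isCont_cong)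
    qed
    show "set_integrable lborel (einterval (ereal 0) (ereal N)) g"
      unfolding set_integrable_def by (simp add: gind gint)
    have "((\<lambda>x. x powr a) \<longlongrightarrow> 0) (at_right 0)"
      by (rule tendsto_zero_powrI[where b=a])
        (use assms in \<open>auto intro!: tendsto_intros eventually_at_rightI[of 0 1]\<close>)
    hence lim0: "((\<lambda>x. x powr a * (1 - x/N)^k) \<longlongrightarrow> 0 * (1 - 0/N)^k) (at_right 0)"
      by (intro tendsto_intros) (use assms in auto)
    have "(G \<longlongrightarrow> 0) (at_right 0)"
    proof (rule Lim_null_comparison)
      show "\<forall>\<^sub>F x in at_right 0. norm (G x) \<le> \<bar>x powr a * (1 - x/N)^k\<bar> * (1 / cos (\<bar>Im w\<bar>/2)) ^ m"
        using Kb by (intro always_eventually) (auto simp: G_def norm_mult simp del: of_real_mult of_real_power intro!: mult_left_mono)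
      show "((\<lambda>x. \<bar>x powr a * (1 - x/N)^k\<bar> * (1 / cos (\<bar>Im w\<bar>/2)) ^ m) \<longlongrightarrow> 0) (at_right 0)"
        using tendsto_mult_right[OF tendsto_rabs[OF lim0], of "(1 / cos (\<bar>Im w\<bar>/2)) ^ m"] assms by simp
    qed
    thus "((G \<circ> real_of_ereal) \<longlongrightarrow> 0) (at_right (ereal 0))"
      unfolding ereal_tendsto_simps .
    have "isCont G N" unfolding G_def using contK[of N] assms by (intro continuous_intros) auto
    hence "(G \<longlongrightarrow> G N) (at_left N)" by (simp add: isCont_def filterlim_at_split)
    moreover have "G N = of_real (0 ^ k * N powr a) * K N" using assms by (simp add: G_def mult.commute)
    ultimately show "((G \<circ> real_of_ereal) \<longlongrightarrow> of_real (0 ^ k * N powr a) * K N) (at_left (ereal N))"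
      unfolding ereal_tendsto_simps by simp
  qed
  moreover have "(LBINT x=ereal 0..ereal N. g x) = integral\<^sup>L lborel g"
    using assms by (subst interval_lebesgue_integral_le_eq) (auto simp: set_lebesgue_integral_def gind)
  moreover have "integral\<^sup>L lborel g = of_real a * beta_mixture N m s a k w
      - of_real (real k / N) * beta_mixture N m s (a + 1) (k - 1) w - of_real s * beta_mixture' N m s a k w"
    unfolding g_def using int by (simp add: beta_mixture_def beta_mixture'_def K_def K'_def)
  ultimately show ?thesis by (simp add: K_def algebra_simps)
qed

lemma beta_mixture_limits_bot:
  assumes a: "0 < a" "0 < N" "0 < m" and th: "\<theta> < pi"
    and u: "\<And>n. \<bar>Im (u n)\<bar> \<le> \<theta>" and lim: "filterlim (\<lambda>n. Re (u n)) at_bot sequentially"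
  shows "(\<lambda>n. beta_mixture N m s a k (u n)) \<longlonglongrightarrow> of_real (\<integral>x. beta_weight N a k x \<partial>lborel)"
    and "(\<lambda>n. beta_mixture' N m s a k (u n)) \<longlonglongrightarrow> 0"
proof -
  note l = resolvent_power_limits_bot[OF shift_limits(1)[OF lim]]
  show "(\<lambda>n. beta_mixture N m s a k (u n)) \<longlonglongrightarrow> of_real (\<integral>x. beta_weight N a k x \<partial>lborel)"
    using beta_mixture_limit[OF beta_weight_integrable[OF a(1,2)] resolvent_power_measurable norm_resolvent_power_le(1)[OF _ th a(3)] u l(1), of k s]
    by (simp add: beta_mixture_def)
  show "(\<lambda>n. beta_mixture' N m s a k (u n)) \<longlonglongrightarrow> 0"
    using beta_mixture_limit[OF beta_weight_integrable[OF a(1,2)] resolvent_power'_measurable norm_resolvent_power_le(2)[OF _ th a(3)] u l(2), of k s]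
    by (simp add: beta_mixture'_def)
qed

text \<open>Since exp (m w) = exp (m (w - s ln x)) x^(s m), the exponential goes to the resolvent,
  where it compensates the decay, and the power of x goes into the weight, raising a to a + s
  m.\<close>

lemma exp_mult_beta_mixture:
  fixes \<psi> :: "complex \<Rightarrow> complex"
  shows "exp (of_nat m * w) * (\<integral>x. of_real (beta_weight N a k x) * \<psi> (w - of_real (s * ln x)) \<partial>lborel)
    = (\<integral>x. of_real (beta_weight N (a + s * real m) k x) * (exp (of_nat m * (w - of_real (s * ln x))) * \<psi> (w - of_real (s * ln x))) \<partial>lborel)"
proof -
  have "exp (of_nat m * w) * (of_real (beta_weight N a k x) * \<psi> (w - of_real (s * ln x)))
    = of_real (beta_weight N (a + s * real m) k x) * (exp (of_nat m * (w - of_real (s * ln x))) * \<psi> (w - of_real (s * ln x)))" for x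
  proof (cases "0 < x")
    case True
    have "of_nat m * w = of_nat m * (w - of_real (s * ln x)) + of_real (s * real m * ln x)"
      by (simp add: algebra_simps)
    hence "exp (of_nat m * w) = exp (of_nat m * (w - of_real (s * ln x))) * of_real (exp (s * real m * ln x))"
      by (simp only: exp_add exp_of_real)
    also have "exp (s * real m * ln x) = x powr (s * real m)" using True by (simp add: powr_def)
    finally have e: "exp (of_nat m * w) = exp (of_nat m * (w - of_real (s * ln x))) * of_real (x powr (s * real m))" .
    show ?thesis unfolding e beta_weight_shift[of x "s * real m" N a k, symmetric] by (simp only: of_real_mult mult_ac)
  qed (simp add: beta_weight_def)
  note eq = this
  show ?thesis by (subst integral_mult_right_zero[symmetric], subst eq) (rule refl)
qed

lemma beta_mixture_limits_top:
  fixes k m :: nat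
  assumes a: "0 < a" "0 < N" "0 < m" "0 < s" and th: "\<theta> < pi"
    and u: "\<And>n. \<bar>Im (u n)\<bar> \<le> \<theta>" and lim: "filterlim (\<lambda>n. Re (u n)) at_top sequentially"
  defines "c \<equiv> (\<integral>x. beta_weight N (a + s * real m) k x \<partial>lborel)"
  shows "(\<lambda>n. exp (of_nat m * u n) * beta_mixture N m s a k (u n)) \<longlonglongrightarrow> of_real (c * real m ^ m)"
    and "(\<lambda>n. exp (of_nat m * u n) * beta_mixture' N m s a k (u n)) \<longlonglongrightarrow> - of_real (c * real m ^ Suc m)"
proof -
  have a': "0 < a + s * real m" using a by (intro add_pos_pos mult_pos_pos) auto
  note l = resolvent_power_limits_top[OF shift_limits(2)[OF lim] a(3)]
  show "(\<lambda>n. exp (of_nat m * u n) * beta_mixture N m s a k (u n)) \<longlonglongrightarrow> of_real (c * real m ^ m)"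
    using beta_mixture_limit[OF beta_weight_integrable[OF a' a(2)] _ norm_resolvent_power_le(3)[OF _ th a(3)] u l(1), of k s]
    unfolding beta_mixture_def exp_mult_beta_mixture c_def by simp
  show "(\<lambda>n. exp (of_nat m * u n) * beta_mixture' N m s a k (u n)) \<longlonglongrightarrow> - of_real (c * real m ^ Suc m)"
    using beta_mixture_limit[OF beta_weight_integrable[OF a' a(2)] _ norm_resolvent_power_le(4)[OF _ th a(3)] u l(2), of k s]
    unfolding beta_mixture'_def exp_mult_beta_mixture c_def by simp
qed

section \<open>Positivity on the real axis and limits at the two ends of the strip\<close>

lemma resolvent_power_of_real: "resolvent_power m (of_real t) = of_real (inverse ((1 + exp t / real m) ^ m))"
  by (simp add: resolvent_power_def exp_of_real)

lemma beta_mixture_of_real: "beta_mixture N m s a k (of_real t) =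
   of_real (\<integral>x. beta_weight N a k x * inverse ((1 + exp (t - s * ln x) / real m) ^ m) \<partial>lborel)"
  unfolding beta_mixture_def of_real_diff[symmetric] resolvent_power_of_real of_real_mult[symmetric] by (simp only: integral_complex_of_real)

lemma beta_mixture'_of_real: "beta_mixture' N m s a k (of_real t) =
   of_real (\<integral>x. beta_weight N a k x * (- exp (t - s * ln x) * inverse ((1 + exp (t - s * ln x) / real m) ^ Suc m)) \<partial>lborel)"
proof -
  have "resolvent_power' m (of_real t) = of_real (- exp t * inverse ((1 + exp t / real m) ^ Suc m))" for t
    by (simp add: resolvent_power'_def exp_of_real del: power_Suc)
  thus ?thesis
    unfolding beta_mixture'_def of_real_diff[symmetric] of_real_mult[symmetric] by (simp only: integral_complex_of_real of_real_mult[symmetric])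
qed

lemma beta_mixture_real_pos:
  assumes "0 < a" "0 < N" "0 < m"
  shows "0 < (\<integral>x. beta_weight N a k x * inverse ((1 + exp (t - s * ln x) / real m) ^ m) \<partial>lborel)"
proof (rule lborel_integral_pos[OF _ _ assms(2)])
  have p: "0 < 1 + exp (t - s * ln x) / real m" for x by (simp add: add_pos_nonneg)
  show "integrable lborel (\<lambda>x. beta_weight N a k x * inverse ((1 + exp (t - s * ln x) / real m) ^ m))"
  proof -
    have "integrable lborel (\<lambda>x. of_real (beta_weight N a k x) * resolvent_power m (of_real t - of_real (s * ln x)))"
      using assms by (intro beta_mixture_resolvent_power_integrable) auto
    hence "integrable lborel (\<lambda>x. complex_of_real (beta_weight N a k x * inverse ((1 + exp (t - s * ln x) / real m) ^ m)))"
      unfolding of_real_diff[symmetric] resolvent_power_of_real of_real_mult[symmetric] .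
    thus ?thesis by (simp only: complex_of_real_integrable_eq)
  qed
  show "0 \<le> beta_weight N a k x * inverse ((1 + exp (t - s * ln x) / real m) ^ m)" for x
    using beta_weight_nonneg p[of x] by (intro mult_nonneg_nonneg) auto
  show "0 < beta_weight N a k x * inverse ((1 + exp (t - s * ln x) / real m) ^ m)" if "0 < x" "x < N" for x
    using beta_weight_pos[OF that] p[of x] by (intro mult_pos_pos) auto
qed

text \<open>Counterexamples beyond every integer would form a sequence against the assumption. This
  converts dominated convergence, which speaks of sequences, into bounds uniform over a
  strip.\<close>

lemma eventually_of_sequences:
  fixes g :: "'a \<Rightarrow> real"
  assumes "\<And>u. (\<And>n. u n \<in> S) \<Longrightarrow> filterlim (\<lambda>n. g (u n)) at_top sequentially \<Longrightarrow> eventually (\<lambda>n. P (u n)) sequentially"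
  shows "\<exists>B. \<forall>w\<in>S. B \<le> g w \<longrightarrow> P w"
proof (rule ccontr)
  assume "\<not> ?thesis"
  hence "\<forall>n. \<exists>w. w \<in> S \<and> real n \<le> g w \<and> \<not> P w" by blast
  then obtain u where u: "\<And>n. u n \<in> S" "\<And>n. real n \<le> g (u n)" "\<And>n. \<not> P (u n)" by metis
  have "filterlim (\<lambda>n. g (u n)) at_top sequentially"
    by (rule filterlim_at_top_mono[OF filterlim_real_sequentially]) (use u in auto)
  from assms[OF u(1) this] u(3) show False by simp
qed

text \<open>The sequences may wander vertically, so the two limits are uniform in closed substrips.\<close>

definition strip_limits :: "nat \<Rightarrow> (complex \<Rightarrow> complex) \<Rightarrow> bool" where
  "strip_limits m f \<longleftrightarrow> (\<exists>A B::real. A \<noteq> 0 \<and> B \<noteq> 0 \<and> (\<forall>\<theta><pi. \<forall>u. (\<forall>n. \<bar>Im (u n)\<bar> \<le> \<theta>) \<longrightarrow>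
     (filterlim (\<lambda>n. Re (u n)) at_bot sequentially \<longrightarrow> (\<lambda>n. f (u n)) \<longlonglongrightarrow> of_real A) \<and>
     (filterlim (\<lambda>n. Re (u n)) at_top sequentially \<longrightarrow> (\<lambda>n. exp (of_nat m * u n) * f (u n)) \<longlonglongrightarrow> of_real B)))"

text \<open>The factor exp (m u) cancels in the quotient, so its limits are the real numbers A / A'
  and B / B' and the imaginary part tends to 0. This delivers \<open>lim\<close> in
  \<open>argument_decreasing_step\<close>.\<close>

lemma strip_limits_ratio:
  assumes f: "strip_limits m f" and g: "strip_limits m g" and th: "0 < \<theta>" "\<theta> < pi" and e: "0 < e"
  shows "\<exists>B. \<forall>w. 0 \<le> Im w \<and> Im w \<le> \<theta> \<and> B \<le> \<bar>Re w\<bar> \<longrightarrow> Im (f w / g w) < e"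
proof -
  define S where "S = {w. 0 \<le> Im w \<and> Im w \<le> \<theta>}"
  from f[unfolded strip_limits_def] obtain A B :: real where AB: "A \<noteq> 0" "B \<noteq> 0" and fl:
    "(\<forall>\<theta><pi. \<forall>u. (\<forall>n. \<bar>Im (u n)\<bar> \<le> \<theta>) \<longrightarrow>
     (filterlim (\<lambda>n. Re (u n)) at_bot sequentially \<longrightarrow> (\<lambda>n. f (u n)) \<longlonglongrightarrow> of_real A) \<and>
     (filterlim (\<lambda>n. Re (u n)) at_top sequentially \<longrightarrow> (\<lambda>n. exp (of_nat m * u n) * f (u n)) \<longlonglongrightarrow> of_real B))"
    by (elim exE conjE) (rule that)
  note fl = fl[rule_format, OF th(2), THEN conjunct1, rule_format] fl[rule_format, OF th(2), THEN conjunct2, rule_format]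
  from g[unfolded strip_limits_def] obtain A' B' :: real where AB': "A' \<noteq> 0" "B' \<noteq> 0" and gl:
    "(\<forall>\<theta><pi. \<forall>u. (\<forall>n. \<bar>Im (u n)\<bar> \<le> \<theta>) \<longrightarrow>
     (filterlim (\<lambda>n. Re (u n)) at_bot sequentially \<longrightarrow> (\<lambda>n. g (u n)) \<longlonglongrightarrow> of_real A') \<and>
     (filterlim (\<lambda>n. Re (u n)) at_top sequentially \<longrightarrow> (\<lambda>n. exp (of_nat m * u n) * g (u n)) \<longlonglongrightarrow> of_real B'))"
    by (elim exE conjE) (rule that)
  note gl = gl[rule_format, OF th(2), THEN conjunct1, rule_format] gl[rule_format, OF th(2), THEN conjunct2, rule_format]
  have ev: "eventually (\<lambda>n. Im (f (u n) / g (u n)) < e) sequentially" if "(\<lambda>n. f (u n) / g (u n)) \<longlonglongrightarrow> of_real C" for u C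
    using order_tendstoD(2)[OF tendsto_Im[OF that], of e] e by simp
  have "\<exists>B. \<forall>w\<in>S. B \<le> Re w \<longrightarrow> Im (f w / g w) < e"
  proof (rule eventually_of_sequences)
    fix u :: "nat \<Rightarrow> complex" assume u: "\<And>n. u n \<in> S" and l: "filterlim (\<lambda>n. Re (u n)) at_top sequentially"
    have u': "\<bar>Im (u n)\<bar> \<le> \<theta>" for n using u[of n] by (simp add: S_def)
    have "(\<lambda>n. (exp (of_nat m * u n) * f (u n)) / (exp (of_nat m * u n) * g (u n))) \<longlonglongrightarrow> of_real B / of_real B'"
      by (intro tendsto_divide fl(2)[OF u' l] gl(2)[OF u' l]) (use AB' in auto)
    thus "eventually (\<lambda>n. Im (f (u n) / g (u n)) < e) sequentially" by (intro ev[of u "B/B'"]) simp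
  qed
  moreover have "\<exists>B. \<forall>w\<in>S. B \<le> - Re w \<longrightarrow> Im (f w / g w) < e"
  proof (rule eventually_of_sequences)
    fix u :: "nat \<Rightarrow> complex" assume u: "\<And>n. u n \<in> S" and "filterlim (\<lambda>n. - Re (u n)) at_top sequentially"
    hence l: "filterlim (\<lambda>n. Re (u n)) at_bot sequentially" by (simp add: filterlim_uminus_at_top)
    have u': "\<bar>Im (u n)\<bar> \<le> \<theta>" for n using u[of n] by (simp add: S_def)
    have "(\<lambda>n. f (u n) / g (u n)) \<longlonglongrightarrow> of_real A / of_real A'"
      by (intro tendsto_divide fl(1)[OF u' l] gl(1)[OF u' l]) (use AB' in auto)
    thus "eventually (\<lambda>n. Im (f (u n) / g (u n)) < e) sequentially" by (intro ev[of u "A/A'"]) simp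
  qed
  ultimately obtain B1 B2 where B: "\<And>w. w \<in> S \<Longrightarrow> B1 \<le> Re w \<Longrightarrow> Im (f w / g w) < e"
    "\<And>w. w \<in> S \<Longrightarrow> B2 \<le> - Re w \<Longrightarrow> Im (f w / g w) < e" by blast
  show ?thesis
  proof (intro exI[of _ "max B1 B2"] allI impI)
    fix w assume "0 \<le> Im w \<and> Im w \<le> \<theta> \<and> max B1 B2 \<le> \<bar>Re w\<bar>"
    thus "Im (f w / g w) < e" using B[of w] by (cases "0 \<le> Re w") (auto simp: S_def)
  qed
qed

lemma strip_limits_beta_mixture:
  assumes a: "0 < a" "0 < N" "0 < m" "0 < s"
  shows "strip_limits m (beta_mixture N m s a k)"
proof -
  have a': "0 < a + s * real m" using a by (intro add_pos_pos mult_pos_pos) auto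
  show ?thesis
    unfolding strip_limits_def
  proof (intro exI conjI allI impI)
    show "(\<integral>x. beta_weight N a k x \<partial>lborel) \<noteq> 0" using beta_weight_integral_pos[OF a(1,2), of k] by simp
    show "(\<integral>x. beta_weight N (a + s * real m) k x \<partial>lborel) * real m ^ m \<noteq> 0" using beta_weight_integral_pos[OF a' a(2), of k] a by simp
    fix \<theta> :: real and u :: "nat \<Rightarrow> complex" assume th: "\<theta> < pi" and u: "\<forall>n. \<bar>Im (u n)\<bar> \<le> \<theta>"
    show "(\<lambda>n. beta_mixture N m s a k (u n)) \<longlonglongrightarrow> of_real (\<integral>x. beta_weight N a k x \<partial>lborel)"
      if "filterlim (\<lambda>n. Re (u n)) at_bot sequentially"
      using beta_mixture_limits_bot(1)[OF a(1-3) th _ that] u by blast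
    show "(\<lambda>n. exp (of_nat m * u n) * beta_mixture N m s a k (u n)) \<longlonglongrightarrow> of_real ((\<integral>x. beta_weight N (a + s * real m) k x \<partial>lborel) * real m ^ m)"
      if "filterlim (\<lambda>n. Re (u n)) at_top sequentially"
      using beta_mixture_limits_top(1)[OF a th _ that] u by blast
  qed
qed

lemma strip_limits_resolvent_power:
  assumes m: "0 < m"
  shows "strip_limits m (\<lambda>w. resolvent_power m (w - of_real c))"
  unfolding strip_limits_def
proof (intro exI conjI allI impI)
  show "(1::real) \<noteq> 0" "exp (real m * c) * real m ^ m \<noteq> 0" using m by auto
  fix \<theta> :: real and u :: "nat \<Rightarrow> complex"
  show "(\<lambda>n. resolvent_power m (u n - of_real c)) \<longlonglongrightarrow> of_real 1"
    if "filterlim (\<lambda>n. Re (u n)) at_bot sequentially"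
    using resolvent_power_limits_bot(1)[OF shift_limits(1)[OF that]] by simp
  show "(\<lambda>n. exp (of_nat m * u n) * resolvent_power m (u n - of_real c)) \<longlonglongrightarrow> of_real (exp (real m * c) * real m ^ m)"
    if "filterlim (\<lambda>n. Re (u n)) at_top sequentially"
  proof -
    have "exp (of_nat m * u n) * resolvent_power m (u n - of_real c)
        = of_real (exp (real m * c)) * (exp (of_nat m * (u n - of_real c)) * resolvent_power m (u n - of_real c))" for n
    proof -
      have "of_nat m * u n = of_real (real m * c) + of_nat m * (u n - of_real c)" by (simp add: algebra_simps)
      thus ?thesis by (simp only: exp_add exp_of_real mult.assoc)
    qed
    note eq = this
    show ?thesis unfolding eq of_real_mult of_real_power of_real_of_nat_eq
      by (rule tendsto_mult_left[OF resolvent_power_limits_top(1)[OF shift_limits(2)[OF that] m]])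
  qed
qed

section \<open>Induction along the Beta recursion\<close>

text \<open>With E = 1 + exp z / m the logarithmic derivative is m / E - m, and exp maps the strip 0
  < Im z < pi into the upper half-plane, so Im E >= 0.\<close>

lemma argument_decreasing_resolvent_power:
  assumes m: "0 < m"
  shows "argument_decreasing (\<lambda>w. resolvent_power m (w - of_real c))"
  unfolding argument_decreasing_def
proof (intro allI impI)
  fix w assume w: "0 < Im w" "Im w < pi"
  define z where "z = w - of_real c"
  have z: "0 < Im z" "Im z < pi" using w by (auto simp: z_def)
  define E where "E = 1 + exp z / of_nat m"
  have nz: "E \<noteq> 0" using one_plus_exp_nonzero[of z m] z m by (simp add: E_def)
  have d: "deriv (\<lambda>w. resolvent_power m (w - of_real c)) w = resolvent_power' m z"
    using DERIV_resolvent_power_shift[of w m c] w m by (simp add: DERIV_imp_deriv z_def)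
  have "exp z = of_nat m * E - of_nat m" using m by (simp add: E_def algebra_simps)
  hence "resolvent_power' m z / resolvent_power m z = of_nat m * inverse E - of_nat m"
    using nz by (simp add: resolvent_power'_def resolvent_power_def E_def[symmetric] field_simps)
  hence "Im (resolvent_power' m z / resolvent_power m z) = - real m * (Im E / ((Re E)\<^sup>2 + (Im E)\<^sup>2))"
    by simp
  moreover have "0 \<le> Im E" using z by (simp add: E_def Im_exp sin_gt_zero less_imp_le)
  moreover have "resolvent_power m z \<noteq> 0" using nz by (simp add: resolvent_power_def E_def[symmetric])
  ultimately show "resolvent_power m (w - of_real c) \<noteq> 0 \<and> Im (deriv (\<lambda>w. resolvent_power m (w - of_real c)) w / resolvent_power m (w - of_real c)) \<le> 0"
    unfolding d z_def[symmetric] by (simp add: divide_nonneg_nonneg mult_nonneg_nonneg)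
qed

text \<open>\<open>a\<close> is generalised because the parameters (a, k + 1) arise from (a + 1, k)
  by one Pareto factor. For k = 0 the Beta variable is itself a power of U scaled to (0, N), so the
  recursion bottoms out in the resolvent power shifted by s ln N. The constants c and d are those of
  \<open>beta_mixture'_eq\<close> divided by s.\<close>

lemma argument_decreasing_beta_mixture:
  assumes N: "0 < N" "0 < m" "0 < s" and a: "0 < a"
  shows "argument_decreasing (beta_mixture N m s a k)"
  using a
proof (induction k arbitrary: a)
  case 0
  show ?case
  proof (rule argument_decreasing_step[where \<phi>="\<lambda>w. resolvent_power m (w - of_real (s * ln N))" and c="a / s" and d="N powr a / s"])
    show "argument_decreasing (\<lambda>w. resolvent_power m (w - of_real (s * ln N)))" by (rule argument_decreasing_resolvent_power[OF N(2)])
    show "(\<lambda>w. resolvent_power m (w - of_real (s * ln N))) field_differentiable (at w)" if "\<bar>Im w\<bar> < pi" for w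
      using DERIV_resolvent_power_shift[OF that N(2)] field_differentiable_def by blast
    show "resolvent_power m (w - of_real (s * ln N)) \<noteq> 0 \<and> Im (beta_mixture N m s a 0 w / resolvent_power m (w - of_real (s * ln N))) = 0" if "Im w = 0" for w
    proof -
      have w: "w = of_real (Re w)" using that by (simp add: complex_eq_iff)
      have "0 < 1 + exp (Re w - s * ln N) / real m" by (simp add: add_pos_nonneg)
      thus ?thesis
        by (subst (1 2 3) w, unfold beta_mixture_of_real of_real_diff[symmetric] resolvent_power_of_real of_real_divide[symmetric])
          (simp only: of_real_eq_0_iff Im_complex_of_real, simp)
    qed
    show "(beta_mixture N m s a 0 has_field_derivative (of_real (a / s) * beta_mixture N m s a 0 w - of_real (N powr a / s) * resolvent_power m (w - of_real (s * ln N)))) (at w)"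
      if "\<bar>Im w\<bar> < pi" for w
    proof -
      have "beta_mixture' N m s a 0 w = of_real (a / s) * beta_mixture N m s a 0 w - of_real (N powr a / s) * resolvent_power m (w - of_real (s * ln N))"
        using beta_mixture'_eq[of a N m w s 0] 0 N that by (simp add: field_simps)
      thus ?thesis using DERIV_beta_mixture[of a N m w s 0] 0 N that by simp
    qed
    show "0 < N powr a / s" using N by simp
  qed (rule strip_limits_ratio[OF strip_limits_beta_mixture[OF 0 N] strip_limits_resolvent_power[OF N(2)]])
next
  case (Suc k)
  have a1: "0 < a + 1" using Suc.prems by simp
  show ?case
  proof (rule argument_decreasing_step[where \<phi>="beta_mixture N m s (a + 1) k" and c="a / s" and d="real (Suc k) / N / s"])
    show "argument_decreasing (beta_mixture N m s (a + 1) k)" by (rule Suc.IH[OF a1])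
    show "beta_mixture N m s (a + 1) k field_differentiable (at w)" if "\<bar>Im w\<bar> < pi" for w
      using DERIV_beta_mixture[OF a1 N(1,2) that] field_differentiable_def by blast
    show "beta_mixture N m s (a + 1) k w \<noteq> 0 \<and> Im (beta_mixture N m s a (Suc k) w / beta_mixture N m s (a + 1) k w) = 0" if "Im w = 0" for w
    proof -
      have w: "w = of_real (Re w)" using that by (simp add: complex_eq_iff)
      show ?thesis using beta_mixture_real_pos[OF a1 N(1,2), of k "Re w" s]
        by (subst (1 2 3) w, unfold beta_mixture_of_real of_real_divide[symmetric])
          (simp only: of_real_eq_0_iff Im_complex_of_real, simp)
    qed
    show "(beta_mixture N m s a (Suc k) has_field_derivative (of_real (a / s) * beta_mixture N m s a (Suc k) w - of_real (real (Suc k) / N / s) * beta_mixture N m s (a + 1) k w)) (at w)"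
      if "\<bar>Im w\<bar> < pi" for w
    proof -
      have "beta_mixture' N m s a (Suc k) w = of_real (a / s) * beta_mixture N m s a (Suc k) w - of_real (real (Suc k) / N / s) * beta_mixture N m s (a + 1) k w"
        using beta_mixture'_eq[of a N m w s "Suc k"] Suc.prems N that by (simp add: field_simps)
      thus ?thesis using DERIV_beta_mixture[of a N m w s "Suc k"] Suc.prems N that by simp
    qed
    show "0 < real (Suc k) / N / s" using N by simp
  qed (rule strip_limits_ratio[OF strip_limits_beta_mixture[OF Suc.prems N] strip_limits_beta_mixture[OF a1 N]])
qed

section \<open>Stieltjes representation of logarithmic derivatives\<close>

text \<open>The periods of exp are the multiples of 2 pi i. Hence exp z - exp l has a single zero in
  the region that contains the contour.\<close>

lemma exp_eq_in_strip:
  assumes "exp w = exp (of_real l)" "\<bar>Im w\<bar> < 2 * pi"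
  shows "w = of_real l"
proof -
  obtain n where n: "w = of_real l + of_int (2 * n) * of_real pi * \<i>"
    using assms(1) unfolding exp_eq by auto
  hence "\<bar>2 * of_int n * pi\<bar> < 2 * pi" using assms(2) by simp
  hence "\<bar>real_of_int n\<bar> < 1" by (simp add: abs_mult)
  hence "n = 0" by linarith
  thus ?thesis using n by simp
qed

text \<open>The mean value inequality for G w - c w on a segment of length 2 pi. It evaluates the
  short sides of the rectangle, where the integrand is nearly constant.\<close>

lemma vertical_increment_bound:
  fixes G :: "complex \<Rightarrow> complex"
  assumes G: "\<And>w. \<bar>Im w\<bar> \<le> pi \<Longrightarrow> (G has_field_derivative g w) (at w)"
    and e: "\<And>w. \<bar>Im w\<bar> \<le> pi \<Longrightarrow> Re w = x \<Longrightarrow> norm (g w - c) \<le> e"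
  shows "norm (G (Complex x pi) - G (Complex x (-pi)) - 2 * pi * \<i> * c) \<le> e * (2 * pi)"
proof -
  define S where "S = {w. Re w = x \<and> \<bar>Im w\<bar> \<le> pi}"
  have "S = {w. Re w \<le> x} \<inter> {w. Re w \<ge> x} \<inter> {w. Im w \<le> pi} \<inter> {w. Im w \<ge> - pi}" by (auto simp: S_def)
  hence "convex S"
    by (simp only:) (intro convex_Int convex_halfspace_Re_le convex_halfspace_Re_ge convex_halfspace_Im_le convex_halfspace_Im_ge)
  hence "norm ((G (Complex x pi) - c * Complex x pi) - (G (Complex x (-pi)) - c * Complex x (-pi))) \<le> e * norm (Complex x pi - Complex x (-pi))"
  proof (rule field_differentiable_bound[where f="\<lambda>w. G w - c * w" and f'="\<lambda>w. g w - c"])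
    show "((\<lambda>w. G w - c * w) has_field_derivative g w - c) (at w within S)" if "w \<in> S" for w
    proof -
      have "(G has_field_derivative g w) (at w within S)"
        using G[of w] that by (auto simp: S_def intro: has_field_derivative_at_within)
      thus ?thesis by (auto intro!: derivative_eq_intros)
    qed
  qed (use e in \<open>auto simp: S_def\<close>)
  moreover have "Complex x pi - Complex x (-pi) = 2 * pi * \<i>" by (simp add: complex_eq_iff)
  moreover have "(G (Complex x pi) - c * Complex x pi) - (G (Complex x (-pi)) - c * Complex x (-pi))
      = G (Complex x pi) - G (Complex x (-pi)) - c * (Complex x pi - Complex x (-pi))"
    by (simp add: algebra_simps)
  ultimately show ?thesis by (simp add: norm_mult mult_ac)
qed

text \<open>The contour integral of $(q(\kappa w) - q(\kappa l)) / (e^w - e^l)$ around a long rectangle of height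
  $2\pi$, written with a primitive: the constant $q(\kappa l)$ makes the singularity removable and cancels
  on the two horizontal sides.\<close>

lemma stieltjes_representation:
  fixes q :: "complex \<Rightarrow> complex" and \<kappa> l C :: real
  assumes kap: "0 < \<kappa>" "\<kappa> < 1"
    and hol: "q holomorphic_on {w. \<bar>Im w\<bar> < pi}"
    and sym: "\<And>w. \<bar>Im w\<bar> < pi \<Longrightarrow> q (cnj w) = cnj (q w)"
    and pos: "\<And>w. 0 < Im w \<Longrightarrow> Im w < pi \<Longrightarrow> 0 \<le> Im (q w)"
    and bot: "\<And>\<theta> u. \<theta> < pi \<Longrightarrow> (\<And>n. \<bar>Im (u n)\<bar> \<le> \<theta>) \<Longrightarrow> filterlim (\<lambda>n. Re (u n)) at_bot sequentially \<Longrightarrow> (\<lambda>n. q (u n)) \<longlonglongrightarrow> 0"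
    and top: "\<And>\<theta> u. \<theta> < pi \<Longrightarrow> (\<And>n. \<bar>Im (u n)\<bar> \<le> \<theta>) \<Longrightarrow> filterlim (\<lambda>n. Re (u n)) at_top sequentially \<Longrightarrow> (\<lambda>n. q (u n)) \<longlonglongrightarrow> of_real C"
  shows "has_bochner_integral lborel (\<lambda>x. Im (q (Complex (\<kappa> * x) (\<kappa> * pi))) / pi * (exp l / (exp x + exp l))) (Re (q (of_real (\<kappa> * l))))"
proof -
  \<comment> \<open>q (\<kappa> w) is holomorphic for |Im w| < pi / \<kappa>, and exp w = exp l
    forces w = l while |Im w| < 2 pi. As \<beta> > pi, the edges |Im w| = pi are interior.\<close>
  define \<beta> where "\<beta> = min (2 * pi) (pi / \<kappa>)"
  have beta: "pi < \<beta>" "\<beta> \<le> 2 * pi" "\<kappa> * \<beta> \<le> pi" using kap by (auto simp: \<beta>_def field_simps min_def)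
  define S where "S = {w. \<bar>Im w\<bar> < \<beta>}"
  have S': "S = {w. Im w < \<beta>} \<inter> {w. Im w > - \<beta>}" by (auto simp: S_def)
  have S: "open S" "convex S"
    unfolding S' by (auto intro!: open_Int open_halfspace_Im_lt open_halfspace_Im_gt convex_Int convex_halfspace_Im_lt convex_halfspace_Im_gt)
  define L where "L = complex_of_real l"
  have LS: "L \<in> interior S" using S beta pi_gt_zero by (simp add: interior_open) (simp add: L_def S_def)
  have qk: "(\<lambda>w. q (of_real \<kappa> * w)) holomorphic_on S"
  proof -
    have "(q \<circ> (\<lambda>w. of_real \<kappa> * w)) holomorphic_on S"
    proof (rule holomorphic_on_compose_gen[OF _ hol])
      show "(\<lambda>w. of_real \<kappa> * w) ` S \<subseteq> {w. \<bar>Im w\<bar> < pi}"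
      proof safe
        fix w assume "w \<in> S"
        hence "\<kappa> * \<bar>Im w\<bar> < \<kappa> * \<beta>" using kap by (simp add: S_def)
        moreover have "\<bar>Im (of_real \<kappa> * w)\<bar> = \<kappa> * \<bar>Im w\<bar>" using kap by (simp add: abs_mult)
        ultimately show "\<bar>Im (of_real \<kappa> * w)\<bar> < pi" using beta by linarith
      qed
    qed (intro holomorphic_intros)
    thus ?thesis by (simp add: o_def)
  qed
  \<comment> \<open>Both difference quotients extend holomorphically over \<open>L\<close>, and
    \<open>E\<close> has no zeros; their quotient \<open>h\<close> is therefore holomorphic and has
    a primitive on the convex strip.\<close>
  define P where "P = (\<lambda>z. if z = L then deriv (\<lambda>w. q (of_real \<kappa> * w)) L else (q (of_real \<kappa> * z) - q (of_real \<kappa> * L)) / (z - L))"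
  define E where "E = (\<lambda>z. if z = L then deriv exp L else (exp z - exp L) / (z - L))"
  have P: "P holomorphic_on S" unfolding P_def by (rule pole_lemma[OF qk LS])
  have E: "E holomorphic_on S" unfolding E_def by (rule pole_lemma[OF _ LS]) (intro holomorphic_intros)
  have E0: "E z \<noteq> 0" if "z \<in> S" for z
    using exp_eq_in_strip[of z l] that beta by (auto simp: E_def L_def S_def DERIV_imp_deriv[OF DERIV_exp])
  define h where "h = (\<lambda>z. exp L * (P z / E z))"
  have h: "h holomorphic_on S" unfolding h_def by (intro holomorphic_intros P E E0)
  obtain G where G: "\<And>z. z \<in> S \<Longrightarrow> (G has_field_derivative h z) (at z)"
    using holomorphic_convex_primitive'[OF S(2,1) h] at_within_open[OF _ S(1)] by metis
  define Q where "Q = q (of_real \<kappa> * L)"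
  have heq: "h z = (q (of_real \<kappa> * z) - Q) * (exp L / (exp z - exp L))" if "z \<noteq> L" for z
    using that by (simp add: h_def P_def E_def Q_def)
  define f where "f = (\<lambda>x. Im (q (Complex (\<kappa> * x) (\<kappa> * pi))) / pi * (exp l / (exp x + exp l)))"
  \<comment> \<open>The integral of \<open>h\<close> across the strip at abscissa x, scaled so that
    F' = f: on both edges exp w = - exp x, the values of q there are conjugate by
    \<open>sym\<close>, and \<open>Q\<close> contributes equally to both and cancels. The total
    increase of \<open>F\<close> will be Re Q.\<close>
  define F where "F = (\<lambda>x. - Im (G (Complex x pi) - G (Complex x (-pi))) / (2 * pi))"
  have inS: "\<bar>Im w\<bar> \<le> pi \<Longrightarrow> w \<in> S" for w using beta by (simp add: S_def)
  have dF: "(F has_real_derivative f x) (at x)" for x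
  proof -
    have "((\<lambda>x. Im (G (Complex x pi))) has_real_derivative Im (h (Complex x pi))) (at x)"
      "((\<lambda>x. Im (G (Complex x (-pi)))) has_real_derivative Im (h (Complex x (-pi)))) (at x)"
      by (rule DERIV_Im_horizontal[OF G[OF inS]], simp)+
    hence "(F has_real_derivative - (Im (h (Complex x pi)) - Im (h (Complex x (-pi)))) / (2 * pi)) (at x)"
      unfolding F_def minus_complex.sel by (intro DERIV_cdivide DERIV_minus DERIV_diff)
    also have "- (Im (h (Complex x pi)) - Im (h (Complex x (-pi)))) / (2 * pi) = f x"
    proof -
      have e: "exp (Complex x pi) = - of_real (exp x)" "exp (Complex x (-pi)) = - of_real (exp x)"
        by (simp_all add: complex_eq_iff Re_exp Im_exp)
      define t where "t = exp l / (exp x + exp l)"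
      have t: "exp L / (- of_real (exp x) - exp L) = - of_real t"
      proof -
        have "exp L / (- of_real (exp x) - exp L) = of_real (exp l / (- exp x - exp l))"
          by (simp add: L_def exp_of_real)
        also have "exp l / (- exp x - exp l) = - t"
          unfolding t_def by (metis add_uminus_conv_diff minus_add_distrib minus_divide_right)
        finally show ?thesis by simp
      qed
      have c: "of_real \<kappa> * Complex x pi = Complex (\<kappa> * x) (\<kappa> * pi)"
        "of_real \<kappa> * Complex x (-pi) = cnj (Complex (\<kappa> * x) (\<kappa> * pi))"
        by (simp_all add: complex_eq_iff)
      have "\<bar>Im (Complex (\<kappa> * x) (\<kappa> * pi))\<bar> < pi" using kap by (simp add: abs_mult)
      note s = sym[OF this]
      have ne: "Complex x pi \<noteq> L" "Complex x (-pi) \<noteq> L" by (auto simp: L_def complex_eq_iff)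
      define y where "y = Im (q (Complex (\<kappa> * x) (\<kappa> * pi)))"
      have "h (Complex x pi) = - of_real t * (q (Complex (\<kappa> * x) (\<kappa> * pi)) - Q)"
        "h (Complex x (-pi)) = - of_real t * (cnj (q (Complex (\<kappa> * x) (\<kappa> * pi))) - Q)"
        unfolding heq[OF ne(1)] heq[OF ne(2)] e c s t by simp_all
      hence "Im (h (Complex x pi)) = - t * (y - Im Q)" "Im (h (Complex x (-pi))) = - t * (- y - Im Q)"
        by (simp_all add: y_def)
      hence "- (Im (h (Complex x pi)) - Im (h (Complex x (-pi)))) = 2 * (y * t)"
        by (simp add: algebra_simps)
      moreover have "f x = y / pi * t" by (simp add: f_def t_def y_def)
      ultimately show ?thesis by simp
    qed
    finally show ?thesis .
  qed
  \<comment> \<open>At the left end q and exp w tend to 0, so \<open>h\<close> tends to (- Q) exp L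
    / (- exp L) = Q; at the right end the denominator grows and \<open>h\<close> tends to 0. The
    increments of G then approach 2 pi i Q and 0, giving \<open>F\<close> the limits - Re Q and
    0.\<close>
  have hbot: "\<exists>B. \<forall>w\<in>{w. \<bar>Im w\<bar> \<le> pi}. B \<le> - Re w \<longrightarrow> norm (h w - Q) \<le> e" if e: "0 < e" for e
  proof (rule eventually_of_sequences)
    fix u assume u: "\<And>n. u n \<in> {w. \<bar>Im w\<bar> \<le> pi}" "filterlim (\<lambda>n. - Re (u n)) at_top sequentially"
    hence l': "filterlim (\<lambda>n. Re (u n)) at_bot sequentially" by (simp add: filterlim_uminus_at_top)
    have "(\<lambda>n. q (of_real \<kappa> * u n)) \<longlonglongrightarrow> 0"
    proof (rule bot[of "\<kappa> * pi"])
      show "filterlim (\<lambda>n. Re (of_real \<kappa> * u n)) at_bot sequentially"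
        using filterlim_tendsto_pos_mult_at_bot[OF tendsto_const kap(1) l'] by simp
    qed (use u kap in \<open>auto simp: abs_mult\<close>)
    hence "(\<lambda>n. (q (of_real \<kappa> * u n) - Q) * (exp L / (exp (u n) - exp L))) \<longlonglongrightarrow> (0 - Q) * (exp L / (0 - exp L))"
      by (intro tendsto_intros exp_tendsto_0_seq[OF l']) auto
    moreover have "\<forall>\<^sub>F n in sequentially. (q (of_real \<kappa> * u n) - Q) * (exp L / (exp (u n) - exp L)) = h (u n)"
    proof -
      have "\<forall>\<^sub>F n in sequentially. Re (u n) < l" using l' by (simp add: filterlim_at_bot_dense)
      thus ?thesis
      proof (rule eventually_mono)
        fix n assume "Re (u n) < l"
        hence ne: "u n \<noteq> L" by (auto simp: L_def)
        show "(q (of_real \<kappa> * u n) - Q) * (exp L / (exp (u n) - exp L)) = h (u n)"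
          by (simp add: heq[OF ne])
      qed
    qed
    ultimately have "(\<lambda>n. h (u n)) \<longlonglongrightarrow> (0 - Q) * (exp L / (0 - exp L))" by (rule Lim_transform_eventually)
    hence "(\<lambda>n. norm (h (u n) - Q)) \<longlonglongrightarrow> norm (Q - Q)" by (intro tendsto_intros) simp
    thus "\<forall>\<^sub>F n in sequentially. norm (h (u n) - Q) \<le> e"
      using order_tendstoD(2)[of "\<lambda>n. norm (h (u n) - Q)" 0 sequentially e] e by (auto elim!: eventually_mono)
  qed
  have htop: "\<exists>B. \<forall>w\<in>{w. \<bar>Im w\<bar> \<le> pi}. B \<le> Re w \<longrightarrow> norm (h w - 0) \<le> e" if e: "0 < e" for e
  proof (rule eventually_of_sequences)
    fix u assume u: "\<And>n. u n \<in> {w. \<bar>Im w\<bar> \<le> pi}" "filterlim (\<lambda>n. Re (u n)) at_top sequentially"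
    have "(\<lambda>n. q (of_real \<kappa> * u n)) \<longlonglongrightarrow> of_real C"
    proof (rule top[of "\<kappa> * pi"])
      show "filterlim (\<lambda>n. Re (of_real \<kappa> * u n)) at_top sequentially"
        using filterlim_tendsto_pos_mult_at_top[OF tendsto_const kap(1) u(2)] by simp
    qed (use u kap in \<open>auto simp: abs_mult\<close>)
    moreover have "(\<lambda>n. exp (- u n)) \<longlonglongrightarrow> 0"
      by (rule exp_tendsto_0_seq) (use u in \<open>simp add: filterlim_uminus_at_top\<close>)
    ultimately have "(\<lambda>n. (q (of_real \<kappa> * u n) - Q) * (exp L * exp (- u n) / (1 - exp L * exp (- u n)))) \<longlonglongrightarrow> (of_real C - Q) * (exp L * 0 / (1 - exp L * 0))"
      by (intro tendsto_intros) auto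
    moreover have "\<forall>\<^sub>F n in sequentially. (q (of_real \<kappa> * u n) - Q) * (exp L * exp (- u n) / (1 - exp L * exp (- u n))) = h (u n)"
    proof -
      have "\<forall>\<^sub>F n in sequentially. l < Re (u n)" using u(2) by (simp add: filterlim_at_top_dense)
      thus ?thesis
      proof (rule eventually_mono)
        fix n assume "l < Re (u n)"
        hence ne: "u n \<noteq> L" by (auto simp: L_def)
        have "exp L * exp (- u n) / (1 - exp L * exp (- u n)) = exp L / (exp (u n) - exp L)"
          by (simp add: exp_minus field_simps)
        thus "(q (of_real \<kappa> * u n) - Q) * (exp L * exp (- u n) / (1 - exp L * exp (- u n))) = h (u n)"
          by (simp add: heq[OF ne])
      qed
    qed
    ultimately have "(\<lambda>n. h (u n)) \<longlonglongrightarrow> 0" by (simp add: Lim_transform_eventually)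
    hence "(\<lambda>n. norm (h (u n) - 0)) \<longlonglongrightarrow> norm (0 - 0 :: complex)" by (intro tendsto_intros)
    thus "\<forall>\<^sub>F n in sequentially. norm (h (u n) - 0) \<le> e"
      using order_tendstoD(2)[of "\<lambda>n. norm (h (u n) - 0)" 0 sequentially e] e by (auto elim!: eventually_mono)
  qed
  have Gd: "\<And>w. \<bar>Im w\<bar> \<le> pi \<Longrightarrow> (G has_field_derivative h w) (at w)" using G inS by blast
  have Fc: "\<bar>F x + Re c\<bar> \<le> e" if "norm (G (Complex x pi) - G (Complex x (-pi)) - 2 * pi * \<i> * c) \<le> e * (2 * pi)" for x c e
  proof -
    have "\<bar>Im (G (Complex x pi) - G (Complex x (-pi)) - 2 * pi * \<i> * c)\<bar> \<le> e * (2 * pi)"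
      using abs_Im_le_cmod that order_trans by blast
    also have "Im (G (Complex x pi) - G (Complex x (-pi)) - 2 * pi * \<i> * c) = - (2 * pi) * (F x + Re c)"
      by (simp add: F_def field_simps)
    also have "\<bar>- (2 * pi) * (F x + Re c)\<bar> = \<bar>F x + Re c\<bar> * (2 * pi)" by (simp add: abs_mult)
    finally show ?thesis by (rule mult_right_le_imp_le) simp
  qed
  have "(F \<longlongrightarrow> - Re Q) at_bot"
  proof (rule tendstoI)
    fix e :: real assume e: "0 < e"
    obtain B where B: "\<And>w. \<bar>Im w\<bar> \<le> pi \<Longrightarrow> B \<le> - Re w \<Longrightarrow> norm (h w - Q) \<le> e / 2"
      using hbot[of "e/2"] e by auto
    show "\<forall>\<^sub>F x in at_bot. dist (F x) (- Re Q) < e"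
      unfolding eventually_at_bot_linorder
    proof (intro exI[of _ "- B"] allI impI)
      fix x assume "x \<le> - B"
      have "\<bar>F x + Re Q\<bar> \<le> e / 2"
        by (rule Fc[OF vertical_increment_bound[OF Gd]]) (use B \<open>x \<le> - B\<close> in auto)
      thus "dist (F x) (- Re Q) < e" using e by (simp add: dist_real_def)
    qed
  qed
  moreover have "(F \<longlongrightarrow> 0) at_top"
  proof (rule tendstoI)
    fix e :: real assume e: "0 < e"
    obtain B where B: "\<And>w. \<bar>Im w\<bar> \<le> pi \<Longrightarrow> B \<le> Re w \<Longrightarrow> norm (h w - 0) \<le> e / 2"
      using htop[of "e/2"] e by auto
    show "\<forall>\<^sub>F x in at_top. dist (F x) 0 < e"
      unfolding eventually_at_top_linorder
    proof (intro exI[of _ B] allI impI)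
      fix x assume "x \<ge> B"
      have "\<bar>F x + Re 0\<bar> \<le> e / 2"
        by (rule Fc[OF vertical_increment_bound[OF Gd]]) (use B \<open>x \<ge> B\<close> in auto)
      thus "dist (F x) 0 < e" using e by (simp add: dist_real_def)
    qed
  qed
  moreover have "isCont f x" for x
  proof -
    have "\<bar>Im (Complex (\<kappa> * x) (\<kappa> * pi))\<bar> < pi" using kap by (simp add: abs_mult)
    moreover have "open {w. \<bar>Im w\<bar> < pi}"
      using open_Int[OF open_halfspace_Im_lt[of pi] open_halfspace_Im_gt[of "-pi"]]
      by (simp add: Collect_conj_eq[symmetric] abs_less_iff conj_commute minus_less_iff)
    ultimately have "isCont q (Complex (\<kappa> * x) (\<kappa> * pi))"
      using hol holomorphic_on_imp_continuous_on continuous_on_eq_continuous_at by blast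
    moreover have "isCont (\<lambda>x. Complex (\<kappa> * x) (\<kappa> * pi)) x"
      unfolding complex_eq_iff isCont_def by (intro tendsto_intros)
    ultimately have "isCont (\<lambda>x. q (Complex (\<kappa> * x) (\<kappa> * pi))) x" by (rule isCont_o2[rotated])
    moreover have "exp x + exp l \<noteq> 0" using exp_gt_zero[of x] exp_gt_zero[of l] by linarith
    ultimately show ?thesis unfolding f_def by (intro continuous_intros) auto
  qed
  moreover have f0: "0 \<le> f x" for x
    unfolding f_def using pos[of "Complex (\<kappa> * x) (\<kappa> * pi)"] kap
    by (intro mult_nonneg_nonneg divide_nonneg_nonneg add_nonneg_nonneg) auto
  \<comment> \<open>Since f >= 0, the finite limits of \<open>F\<close> yield integrability together
    with the value.\<close>
  ultimately have "set_integrable lborel (einterval (-\<infinity>) \<infinity>) f" "(LBINT x=-\<infinity>..\<infinity>. f x) = 0 - (- Re Q)"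
    using interval_integral_FTC_nonneg[of "-\<infinity>" "\<infinity>" F f "- Re Q" 0] dF
    by (auto simp: ereal_tendsto_simps)
  hence "integrable lborel f" "integral\<^sup>L lborel f = Re Q"
    by (auto simp: set_integrable_def interval_lebesgue_integral_def set_lebesgue_integral_def)
  thus ?thesis unfolding has_bochner_integral_iff f_def Q_def L_def by simp
qed

section \<open>Weak limits of Stieltjes representations\<close>

lemma real_distribution_concentrated:
  assumes "real_distribution M" "0 < e"
  shows "\<exists>k\<ge>1::real. 1 - e < measure M {-k<..k}"
proof -
  interpret real_distribution M by fact
  have "(\<lambda>i. cdf M (real i) - cdf M (- real i)) \<longlonglongrightarrow> 1 - 0"
    by (intro tendsto_diff cdf_lim_infty_prob cdf_lim_neg_infty)
  hence "\<forall>\<^sub>F i in sequentially. 1 - e < cdf M (real i) - cdf M (- real i) \<and> 1 \<le> i"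
    using assms(2) by (intro eventually_conj order_tendstoD(1)[of _ "1 - 0"] eventually_ge_at_top) auto
  then obtain i :: nat where i: "1 - e < cdf M (real i) - cdf M (- real i)" "1 \<le> i"
    by (auto simp: eventually_sequentially)
  hence "1 - e < measure M {- real i<..real i}" using cdf_diff_eq[of "- real i" "real i"] by simp
  thus ?thesis using i(2) by (intro exI[of _ "real i"]) simp
qed

text \<open>\<open>tight\<close> quantifies over all indices. The finitely many early measures are
  each concentrated on some interval, and a maximum of radii absorbs them.\<close>

lemma tight_from_eventually:
  assumes rd: "\<And>n. real_distribution (\<mu> n)"
    and ev: "\<And>e. 0 < e \<Longrightarrow> \<exists>A. \<forall>\<^sub>F n in sequentially. 1 - e < measure (\<mu> n) {-A<..A}"
  shows "tight \<mu>"
  unfolding tight_def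
proof (intro conjI allI impI rd)
  fix e :: real assume e: "0 < e"
  obtain A N where A: "\<And>n. n \<ge> N \<Longrightarrow> 1 - e < measure (\<mu> n) {-A<..A}"
    using ev[OF e] by (auto simp: eventually_sequentially)
  obtain k where k: "\<And>n. 1 \<le> (k n :: real)" "\<And>n. 1 - e < measure (\<mu> n) {-k n<..k n}"
    using real_distribution_concentrated[OF rd e] by metis
  define K where "K = Max (insert (max A 1) (k ` {..<N}))"
  have K: "max A 1 \<le> K" "\<And>n. n < N \<Longrightarrow> k n \<le> K" unfolding K_def by (rule Max_ge; simp)+
  show "\<exists>a b. a < b \<and> (\<forall>n. 1 - e < measure (\<mu> n) {a<..b})"
  proof (intro exI conjI allI)
    show "- K < K" using K(1) by simp
    fix n
    interpret real_distribution "\<mu> n" by (rule rd)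
    show "1 - e < measure (\<mu> n) {-K<..K}"
    proof (cases "n < N")
      case True
      have "measure (\<mu> n) {-k n<..k n} \<le> measure (\<mu> n) {-K<..K}"
        using K(2)[OF True] by (intro finite_measure_mono) auto
      thus ?thesis using k(2)[of n] by linarith
    next
      case False
      have "measure (\<mu> n) {-A<..A} \<le> measure (\<mu> n) {-K<..K}"
        using K(1) by (intro finite_measure_mono) auto
      thus ?thesis using A[of n] False by linarith
    qed
  qed
qed

text \<open>Used with l = - A on the left tail and l = A on the right tail: the kernel with
  parameter 0 is dominated by those with parameters - A and A, so tail masses are controlled by
  values of the transform alone.\<close>

lemma logistic_bounds:
  fixes x l :: real
  shows "x \<le> l \<Longrightarrow> 1 / (exp x + 1) \<le> 2 * (exp l / (exp x + exp l))"
    and "l \<le> x \<Longrightarrow> 1 / (exp x + 1) \<le> 2 * exp (- l) * (exp l / (exp x + exp l))"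
proof -
  have p: "0 < exp x + exp l" "0 < exp x + 1" by (simp_all add: add_pos_pos)
  show "1 / (exp x + 1) \<le> 2 * (exp l / (exp x + exp l))" if "x \<le> l"
  proof -
    have "exp x \<le> exp l" using that by simp
    hence "exp x + exp l \<le> 2 * exp l * 1" by simp
    also have "\<dots> \<le> 2 * exp l * (exp x + 1)" by (intro mult_left_mono) auto
    finally show ?thesis using p by (simp add: field_simps)
  qed
  show "1 / (exp x + 1) \<le> 2 * exp (- l) * (exp l / (exp x + exp l))" if "l \<le> x"
  proof -
    have "exp l \<le> exp x" using that by simp
    moreover have "b \<le> a \<Longrightarrow> 0 < a \<Longrightarrow> a + b \<le> 2 * (a + 1)" for a b :: real by (simp add: algebra_simps)
    ultimately have "exp x + exp l \<le> 2 * (exp x + 1)" using exp_gt_zero by blast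
    hence "1 / (exp x + 1) \<le> 2 / (exp x + exp l)" using p by (simp add: field_simps)
    also have "\<dots> = 2 * exp (- l) * (exp l / (exp x + exp l))" by (simp add: exp_minus)
    finally show ?thesis .
  qed
qed

text \<open>Splitting off the kernel at l = 0 produces probability densities, and the remaining
  kernel is bounded and continuous, so weak convergence suffices. Mass lost at minus infinity would
  leave a constant in \<open>Q\<close>, mass lost at plus infinity a multiple of exp l;
  \<open>bot\<close> and \<open>top\<close> exclude the two.\<close>

lemma stieltjes_limit:
  fixes g R :: "nat \<Rightarrow> real \<Rightarrow> real" and Q :: "real \<Rightarrow> real"
  assumes g0: "\<And>n x. 0 \<le> g n x" and gm [measurable]: "\<And>n. g n \<in> borel_measurable borel"
    and rep: "\<And>n l. has_bochner_integral lborel (\<lambda>x. g n x * (exp l / (exp x + exp l))) (R n l)"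
    and R0: "\<And>n. 0 < R n 0"
    and conv: "\<And>l. (\<lambda>n. R n l) \<longlonglongrightarrow> Q l"
    and Q0: "0 < Q 0"
    and bot: "(Q \<longlongrightarrow> 0) at_bot"
    and top: "((\<lambda>l. Q l * exp (- l)) \<longlongrightarrow> 0) at_top"
  obtains M where "real_distribution M"
    "\<And>l. Q l = Q 0 * (\<integral>x. exp l * (exp x + 1) / (exp x + exp l) \<partial>M)"
proof -
  define p where "p n x = g n x * (1 / (exp x + 1)) / R n 0" for n x
  define \<mu> where "\<mu> n = density lborel (\<lambda>x. ennreal (p n x))" for n
  have pm [measurable]: "p n \<in> borel_measurable borel" for n unfolding p_def[abs_def] by measurable
  have p0: "0 \<le> p n x" for n x
    unfolding p_def using g0 R0[of n] by (intro divide_nonneg_pos mult_nonneg_nonneg divide_nonneg_nonneg add_nonneg_nonneg) auto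
  have pi: "has_bochner_integral lborel (p n) 1" for n
    using has_bochner_integral_divide_zero[OF rep[of n 0], of "R n 0"] R0[of n] by (simp add: p_def[abs_def])
  have rd: "real_distribution (\<mu> n)" for n
  proof -
    have "(\<integral>\<^sup>+x. ennreal (p n x) \<partial>lborel) = 1"
      using pi[of n] p0 by (subst nn_integral_eq_integral) (auto simp: has_bochner_integral_iff)
    hence "prob_space (\<mu> n)" by (intro prob_spaceI) (simp add: \<mu>_def emeasure_density)
    thus ?thesis by (simp add: real_distribution_def real_distribution_axioms_def \<mu>_def)
  qed
  have ker: "integral\<^sup>L (\<mu> n) (\<lambda>x. exp l * (exp x + 1) / (exp x + exp l)) = R n l / R n 0" for n l
  proof -
    have "integral\<^sup>L (\<mu> n) (\<lambda>x. exp l * (exp x + 1) / (exp x + exp l))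
       = (\<integral>x. p n x * (exp l * (exp x + 1) / (exp x + exp l)) \<partial>lborel)"
      unfolding \<mu>_def using p0 by (subst integral_density) auto
    also have "(\<lambda>x. p n x * (exp l * (exp x + 1) / (exp x + exp l)))
       = (\<lambda>x. g n x * (exp l / (exp x + exp l)) / R n 0)"
    proof
      fix x :: real
      have "0 < exp x + 1" by (simp add: add_pos_pos)
      thus "p n x * (exp l * (exp x + 1) / (exp x + exp l)) = g n x * (exp l / (exp x + exp l)) / R n 0"
        by (simp add: p_def)
    qed
    also have "integral\<^sup>L lborel \<dots> = R n l / R n 0"
      by (rule has_bochner_integral_integral_eq[OF has_bochner_integral_divide_zero[OF rep]])
    finally show ?thesis .
  qed
  \<comment> \<open>A Markov-type bound: outside the interval the density is dominated by the
    kernels at - A and A, whose integrals are the two values of R n.\<close>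
  have low: "1 - 2 * (R n (-A) + exp (-A) * R n A) / R n 0 \<le> measure (\<mu> n) {-A<..A}" for n A
  proof -
    define K where "K l x = g n x * (exp l / (exp x + exp l))" for l x
    have K: "has_bochner_integral lborel (K l) (R n l)" for l using rep[of n l] by (simp add: K_def[abs_def])
    have K0: "0 \<le> K l x" for l x unfolding K_def by (intro mult_nonneg_nonneg g0 divide_nonneg_nonneg) (auto intro: add_nonneg_nonneg)
    have i1: "has_bochner_integral lborel (\<lambda>x. p n x - 2 * (K (-A) x + exp (-A) * K A x) / R n 0) (1 - 2 * (R n (-A) + exp (-A) * R n A) / R n 0)"
      by (intro has_bochner_integral_diff pi has_bochner_integral_divide_zero has_bochner_integral_mult_right has_bochner_integral_add K)
    have i2: "integrable lborel (\<lambda>x. p n x * indicator {-A<..A} x)"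
      using pi[of n] by (intro integrable_real_mult_indicator) (auto simp: has_bochner_integral_iff)
    have "1 - 2 * (R n (-A) + exp (-A) * R n A) / R n 0 = (\<integral>x. p n x - 2 * (K (-A) x + exp (-A) * K A x) / R n 0 \<partial>lborel)"
      using i1 by (simp add: has_bochner_integral_iff)
    also have "\<dots> \<le> (\<integral>x. p n x * indicator {-A<..A} x \<partial>lborel)"
    proof (rule integral_mono)
      show "integrable lborel (\<lambda>x. p n x - 2 * (K (-A) x + exp (-A) * K A x) / R n 0)"
        using i1 by (simp add: has_bochner_integral_iff)
      fix x :: real
      show "p n x - 2 * (K (-A) x + exp (-A) * K A x) / R n 0 \<le> p n x * indicator {-A<..A} x"
      proof (cases "x \<in> {-A<..A}")
        case True
        have "0 \<le> 2 * (K (-A) x + exp (-A) * K A x) / R n 0"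
          using K0 R0[of n] by (intro divide_nonneg_pos mult_nonneg_nonneg add_nonneg_nonneg) auto
        thus ?thesis using True by simp
      next
        case False
        have "g n x * (1 / (exp x + 1)) \<le> 2 * (K (-A) x + exp (-A) * K A x)"
        proof (cases "x \<le> - A")
          case True
          have "g n x * (1 / (exp x + 1)) \<le> g n x * (2 * (exp (-A) / (exp x + exp (-A))))"
            using logistic_bounds(1)[OF True] g0 by (intro mult_left_mono) auto
          also have "\<dots> = 2 * K (-A) x" by (simp add: K_def)
          also have "\<dots> \<le> 2 * (K (-A) x + exp (-A) * K A x)" using K0[of A x] by simp
          finally show ?thesis .
        next
          case False
          with \<open>x \<notin> {-A<..A}\<close> have "A \<le> x" by auto
          have "g n x * (1 / (exp x + 1)) \<le> g n x * (2 * exp (-A) * (exp A / (exp x + exp A)))"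
            using logistic_bounds(2)[OF \<open>A \<le> x\<close>] g0 by (intro mult_left_mono) auto
          also have "\<dots> = 2 * (exp (-A) * K A x)" by (simp add: K_def)
          also have "\<dots> \<le> 2 * (K (-A) x + exp (-A) * K A x)" using K0[of "-A" x] by simp
          finally show ?thesis .
        qed
        hence "p n x \<le> 2 * (K (-A) x + exp (-A) * K A x) / R n 0"
          unfolding p_def using R0[of n] by (intro divide_right_mono) auto
        thus ?thesis using False by simp
      qed
    qed (rule i2)
    also have "\<dots> = measure (\<mu> n) {-A<..A}"
    proof -
      have "ennreal (measure (\<mu> n) {-A<..A}) = emeasure (\<mu> n) {-A<..A}"
        using rd[of n] by (simp add: finite_measure.emeasure_eq_measure real_distribution_def prob_space_def)
      also have "\<dots> = (\<integral>\<^sup>+x. ennreal (p n x * indicator {-A<..A} x) \<partial>lborel)"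
        unfolding \<mu>_def by (subst emeasure_density) (auto intro!: nn_integral_cong simp: indicator_def)
      also have "\<dots> = ennreal (\<integral>x. p n x * indicator {-A<..A} x \<partial>lborel)"
        using i2 p0 by (intro nn_integral_eq_integral) auto
      finally show ?thesis
        using p0 by (subst (asm) ennreal_inj) (auto intro!: Bochner_Integration.integral_nonneg)
    qed
    finally show ?thesis .
  qed
  have "tight \<mu>"
  proof (rule tight_from_eventually[OF rd])
    fix e :: real assume e: "0 < e"
    have "((\<lambda>A. 1 - 2 * (Q (-A) + Q A * exp (-A)) / Q 0) \<longlongrightarrow> 1 - 2 * (0 + 0) / Q 0) at_top"
      using Q0 by (intro tendsto_intros top filterlim_compose[OF bot filterlim_uminus_at_bot_at_top]) auto
    hence "\<forall>\<^sub>F A in at_top. 1 - e < 1 - 2 * (Q (-A) + Q A * exp (-A)) / Q 0"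
      by (rule order_tendstoD) (use e in simp)
    then obtain A where A: "1 - e < 1 - 2 * (Q (-A) + exp (-A) * Q A) / Q 0"
      by (auto simp: eventually_at_top_linorder mult.commute)
    have "(\<lambda>n. 1 - 2 * (R n (-A) + exp (-A) * R n A) / R n 0) \<longlonglongrightarrow> 1 - 2 * (Q (-A) + exp (-A) * Q A) / Q 0"
      using Q0 by (intro tendsto_intros conv) auto
    hence "\<forall>\<^sub>F n in sequentially. 1 - e < 1 - 2 * (R n (-A) + exp (-A) * R n A) / R n 0"
      by (rule order_tendstoD) (rule A)
    hence "\<forall>\<^sub>F n in sequentially. 1 - e < measure (\<mu> n) {-A<..A}"
      by (rule eventually_mono) (use low order_less_le_trans in blast)
    thus "\<exists>A. \<forall>\<^sub>F n in sequentially. 1 - e < measure (\<mu> n) {-A<..A}" by blast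
  qed
  then obtain r M where rM: "strict_mono (r :: nat \<Rightarrow> nat)" "real_distribution M" "weak_conv_m (\<mu> \<circ> r) M"
    using tight_imp_convergent_subsubsequence[of \<mu> id] by (auto simp: strict_mono_id)
  show thesis
  proof (rule that[OF rM(2)])
    fix l :: real
    let ?k = "\<lambda>x::real. exp l * (exp x + 1) / (exp x + exp l)"
    have "(\<lambda>n. integral\<^sup>L ((\<mu> \<circ> r) n) ?k) \<longlonglongrightarrow> integral\<^sup>L M ?k"
    proof (rule weak_conv_imp_integral_bdd_continuous_conv[OF _ rM(2,3)])
      show "real_distribution ((\<mu> \<circ> r) n)" for n by (simp add: rd)
      have pos: "0 < exp x + exp l" for x by (simp add: add_pos_pos)
      show "isCont ?k x" for x using pos[of x] by (intro continuous_intros) auto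
      show "norm (?k x) \<le> exp l + 1" for x
      proof -
        have "exp l * (exp x + 1) \<le> (exp l + 1) * (exp x + exp l)" by (simp add: algebra_simps)
        thus ?thesis using pos[of x] by (simp add: field_simps add_nonneg_nonneg)
      qed
    qed
    moreover have "(\<lambda>n. integral\<^sup>L ((\<mu> \<circ> r) n) ?k) \<longlonglongrightarrow> Q l / Q 0"
    proof -
      have "(\<lambda>n. R n l / R n 0) \<longlonglongrightarrow> Q l / Q 0" using Q0 by (intro tendsto_divide conv) auto
      from LIMSEQ_subseq_LIMSEQ[OF this rM(1)] show ?thesis by (simp add: ker o_def)
    qed
    ultimately have "integral\<^sup>L M ?k = Q l / Q 0" by (rule LIMSEQ_unique)
    thus "Q l = Q 0 * integral\<^sup>L M ?k" using Q0 by simp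
  qed
qed

section \<open>Passage to the Gamma distribution\<close>

lemma beta_mixture_cnj: "beta_mixture N m s a k (cnj w) = cnj (beta_mixture N m s a k w)"
proof -
  have "resolvent_power m (cnj w - of_real c) = cnj (resolvent_power m (w - of_real c))" for c
    by (simp add: resolvent_power_def exp_cnj)
  note eq = this
  show ?thesis
    by (simp only: beta_mixture_def eq Bochner_Integration.integral_cnj[symmetric] complex_cnj_mult complex_cnj_complex_of_real)
qed

lemma beta_mixture'_cnj: "beta_mixture' N m s a k (cnj w) = cnj (beta_mixture' N m s a k w)"
proof -
  have "resolvent_power' m (cnj w - of_real c) = cnj (resolvent_power' m (w - of_real c))" for c
    by (simp add: resolvent_power'_def exp_cnj)
  note eq = this
  show ?thesis
    by (simp only: beta_mixture'_def eq Bochner_Integration.integral_cnj[symmetric] complex_cnj_mult complex_cnj_complex_of_real)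
qed

lemma beta_mixture_nonzero:
  assumes "0 < a" "0 < N" "0 < m" "0 < s" "\<bar>Im w\<bar> < pi"
  shows "beta_mixture N m s a k w \<noteq> 0"
proof -
  have up: "beta_mixture N m s a k z \<noteq> 0" if "0 < Im z" "Im z < pi" for z
    using argument_decreasing_beta_mixture[OF assms(2-4,1)] that unfolding argument_decreasing_def by blast
  consider "0 < Im w" | "Im w < 0" | "Im w = 0" by linarith
  thus ?thesis
  proof cases
    case 3
    hence w: "w = of_real (Re w)" by (simp add: complex_eq_iff)
    show ?thesis using beta_mixture_real_pos[OF assms(1-3), of k "Re w" s] by (subst w) (simp only: beta_mixture_of_real of_real_eq_0_iff)
  next
    case 2
    hence "beta_mixture N m s a k (cnj w) \<noteq> 0" using assms by (intro up) auto
    thus ?thesis by (simp add: beta_mixture_cnj)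
  qed (use up assms in auto)
qed

lemma beta_mixture_log_derivative_stieltjes:
  fixes k :: nat
  assumes "0 < a" "0 < N" "0 < m" "0 < s" "0 < \<kappa>" "\<kappa> < 1"
  defines "q \<equiv> \<lambda>w. - beta_mixture' N m s a k w / beta_mixture N m s a k w"
  shows "has_bochner_integral lborel (\<lambda>x. Im (q (Complex (\<kappa> * x) (\<kappa> * pi))) / pi * (exp l / (exp x + exp l))) (Re (q (of_real (\<kappa> * l))))"
    and "0 \<le> Im (q (Complex (\<kappa> * x) (\<kappa> * pi)))"
proof -
  have "open {w. \<bar>Im w\<bar> < pi}"
    using open_Int[OF open_halfspace_Im_lt[of pi] open_halfspace_Im_gt[of "-pi"]]
    by (simp add: Collect_conj_eq[symmetric] abs_less_iff conj_commute minus_less_iff)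
  note op = this
  have d: "deriv (beta_mixture N m s a k) w = beta_mixture' N m s a k w" if "\<bar>Im w\<bar> < pi" for w
    using DERIV_beta_mixture[OF assms(1-3) that] by (rule DERIV_imp_deriv)
  have hol: "beta_mixture N m s a k holomorphic_on {w. \<bar>Im w\<bar> < pi}"
    using DERIV_beta_mixture[OF assms(1-3)] op by (auto simp: holomorphic_on_open)
  have hol': "beta_mixture' N m s a k holomorphic_on {w. \<bar>Im w\<bar> < pi}"
    using holomorphic_deriv[OF hol op] by (rule holomorphic_transform) (simp add: d)
  have pos: "0 \<le> Im (q w)" if "0 < Im w" "Im w < pi" for w
  proof -
    have "Im (deriv (beta_mixture N m s a k) w / beta_mixture N m s a k w) \<le> 0"
      using argument_decreasing_beta_mixture[OF assms(2-4,1), of k] that unfolding argument_decreasing_def by blast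
    thus ?thesis using d[of w] that by (simp add: q_def)
  qed
  show "0 \<le> Im (q (Complex (\<kappa> * x) (\<kappa> * pi)))" using assms by (intro pos) auto
  show "has_bochner_integral lborel (\<lambda>x. Im (q (Complex (\<kappa> * x) (\<kappa> * pi))) / pi * (exp l / (exp x + exp l))) (Re (q (of_real (\<kappa> * l))))"
  proof (rule stieltjes_representation[OF assms(5,6), where C="real m"])
    show "q holomorphic_on {w. \<bar>Im w\<bar> < pi}"
      unfolding q_def using beta_mixture_nonzero[OF assms(1-4)] by (intro holomorphic_intros hol hol') auto
    show "q (cnj w) = cnj (q w)" for w by (simp add: q_def beta_mixture_cnj beta_mixture'_cnj)
    fix \<theta> :: real and u :: "nat \<Rightarrow> complex" assume u: "\<theta> < pi" "\<And>n. \<bar>Im (u n)\<bar> \<le> \<theta>"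
    show "(\<lambda>n. q (u n)) \<longlonglongrightarrow> 0" if "filterlim (\<lambda>n. Re (u n)) at_bot sequentially"
    proof -
      have "(\<lambda>n. q (u n)) \<longlonglongrightarrow> - 0 / of_real (\<integral>x. beta_weight N a k x \<partial>lborel)"
        unfolding q_def using beta_weight_integral_pos[OF assms(1,2), of k]
        by (intro tendsto_divide tendsto_minus beta_mixture_limits_bot[OF assms(1-3) u that]) auto
      thus ?thesis by simp
    qed
    \<comment> \<open>Mixture and derivative both decay like exp (- m w), with leading coefficients
      in ratio - m, so q tends to m.\<close>
    show "(\<lambda>n. q (u n)) \<longlonglongrightarrow> of_real (real m)" if "filterlim (\<lambda>n. Re (u n)) at_top sequentially"
    proof -
      define c where "c = (\<integral>x. beta_weight N (a + s * real m) k x \<partial>lborel)"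
      have "0 < a + s * real m" using assms by (intro add_pos_pos mult_pos_pos) auto
      hence c: "0 < c" unfolding c_def using assms by (intro beta_weight_integral_pos)
      have "(\<lambda>n. - (exp (of_nat m * u n) * beta_mixture' N m s a k (u n)) / (exp (of_nat m * u n) * beta_mixture N m s a k (u n)))
         \<longlonglongrightarrow> - (- of_real (c * real m ^ Suc m)) / of_real (c * real m ^ m)"
        unfolding c_def using c assms
        by (intro tendsto_divide tendsto_minus beta_mixture_limits_top[OF assms(1-4) u that]) (auto simp: c_def)
      moreover have "- (- of_real (c * real m ^ Suc m)) / of_real (c * real m ^ m) = (of_real (real m) :: complex)"
        using c assms(3) by simp
      ultimately show ?thesis by (simp add: q_def)
    qed
  qed (rule pos)
qed

section \<open>The Gamma weight as a limit of Beta weights\<close>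

definition gamma_weight :: "real \<Rightarrow> real \<Rightarrow> real" where
  "gamma_weight a x = indicator {0<..} x * (x powr (a - 1) * exp (- x))"

lemma gamma_weight_nonneg: "0 \<le> gamma_weight a x" by (auto simp: gamma_weight_def)

lemma gamma_weight_pos: "0 < x \<Longrightarrow> 0 < gamma_weight a x" by (auto simp: gamma_weight_def)

lemma gamma_weight_measurable [measurable]: "gamma_weight a \<in> borel_measurable borel"
  unfolding gamma_weight_def[abs_def] by measurable

lemma gamma_weight_integral:
  assumes "0 < a"
  shows "has_bochner_integral lborel (gamma_weight a) (Gamma a)"
proof -
  have "((\<lambda>x. x powr (a - 1) / exp x) has_integral Gamma a) {0..}" by (rule Gamma_integral_real[OF assms])
  moreover have "(\<lambda>x. if x \<in> {0..} then x powr (a - 1) / exp x else 0) = gamma_weight a"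
    by (auto simp: fun_eq_iff gamma_weight_def indicator_def exp_minus divide_inverse)
  ultimately have "(gamma_weight a has_integral Gamma a) UNIV"
    by (metis has_integral_restrict_UNIV)
  hence "integral\<^sup>N lborel (\<lambda>x. ennreal (gamma_weight a x)) = ennreal (Gamma a)"
    using gamma_weight_nonneg by (intro nn_integral_has_integral_lborel) auto
  thus ?thesis
    using gamma_weight_nonneg Gamma_real_pos[OF assms] by (intro has_bochner_integral_nn_integral) auto
qed

lemma beta_weight_le_gamma_weight:
  assumes "0 < n" shows "beta_weight (real n) a n x \<le> gamma_weight a x"
proof (cases "0 < x \<and> x < real n")
  case True
  hence "x powr (a - 1) * (1 - x / real n) ^ n \<le> x powr (a - 1) * exp (- x)"
    using assms by (intro mult_left_mono exp_ge_one_minus_x_over_n_power_n) auto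
  thus ?thesis using True by (simp add: beta_weight_def gamma_weight_def)
qed (use gamma_weight_nonneg[of a x] in \<open>auto simp: beta_weight_def\<close>)

lemma beta_weight_tendsto_gamma_weight: "(\<lambda>n. beta_weight (real (Suc n)) a (Suc n) x) \<longlonglongrightarrow> gamma_weight a x"
proof (cases "0 < x")
  case True
  have "(\<lambda>n. (1 + (- x) / real n) ^ n) \<longlonglongrightarrow> exp (- x)" by (rule tendsto_exp_limit_sequentially)
  hence "(\<lambda>n. (1 + (- x) / real (Suc n)) ^ Suc n) \<longlonglongrightarrow> exp (- x)" by (rule LIMSEQ_Suc)
  hence "(\<lambda>n. x powr (a - 1) * (1 - x / real (Suc n)) ^ Suc n) \<longlonglongrightarrow> x powr (a - 1) * exp (- x)"
    by (intro tendsto_mult tendsto_const) simp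
  moreover have "\<forall>\<^sub>F n in sequentially. x powr (a - 1) * (1 - x / real (Suc n)) ^ Suc n = beta_weight (real (Suc n)) a (Suc n) x"
  proof -
    have "\<forall>\<^sub>F n in sequentially. x < real n"
      using filterlim_real_sequentially by (simp add: filterlim_at_top_dense)
    thus ?thesis by (rule eventually_mono) (use True in \<open>simp add: beta_weight_def\<close>)
  qed
  ultimately have "(\<lambda>n. beta_weight (real (Suc n)) a (Suc n) x) \<longlonglongrightarrow> x powr (a - 1) * exp (- x)"
    by (rule Lim_transform_eventually)
  thus ?thesis using True by (simp add: gamma_weight_def)
qed (simp add: beta_weight_def gamma_weight_def)

text \<open>With n for \<open>Suc n\<close>, the logarithm is squeezed by u / (1 + u/n) <= n ln (1 +
  u/n) <= u. The base has to move with the index because the compression factor does.\<close>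

lemma compound_interest_limit:
  fixes u :: "nat \<Rightarrow> real"
  assumes u: "u \<longlonglongrightarrow> y" and pos: "\<And>n. 0 < u n"
  shows "(\<lambda>n. (1 + u n / real (Suc n)) ^ Suc n) \<longlonglongrightarrow> exp y"
proof -
  define v where "v n = u n / real (Suc n)" for n
  have v: "0 < v n" for n using pos by (simp add: v_def)
  have v0: "v \<longlonglongrightarrow> 0"
    unfolding v_def using tendsto_mult[OF u LIMSEQ_inverse_real_of_nat] by (simp add: divide_inverse)
  have "(\<lambda>n. real (Suc n) * ln (1 + v n)) \<longlonglongrightarrow> y"
  proof (rule tendsto_sandwich)
    show "\<forall>\<^sub>F n in sequentially. u n / (1 + v n) \<le> real (Suc n) * ln (1 + v n)"
    proof (intro always_eventually allI)
      fix n
      have "ln (inverse (1 + v n)) \<le> inverse (1 + v n) - 1"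
        using v[of n] by (intro ln_le_minus_one) auto
      hence "1 - inverse (1 + v n) \<le> ln (1 + v n)" using v[of n] by (simp add: ln_inverse)
      also have "1 - inverse (1 + v n) = v n / (1 + v n)" using v[of n] by (simp add: field_simps)
      finally have "real (Suc n) * (v n / (1 + v n)) \<le> real (Suc n) * ln (1 + v n)" by (intro mult_left_mono) auto
      thus "u n / (1 + v n) \<le> real (Suc n) * ln (1 + v n)" by (simp add: v_def)
    qed
    show "\<forall>\<^sub>F n in sequentially. real (Suc n) * ln (1 + v n) \<le> u n"
    proof (intro always_eventually allI)
      fix n
      have "real (Suc n) * ln (1 + v n) \<le> real (Suc n) * v n"
        using v[of n] by (intro mult_left_mono ln_add_one_self_le_self) auto
      thus "real (Suc n) * ln (1 + v n) \<le> u n" by (simp add: v_def)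
    qed
    show "(\<lambda>n. u n / (1 + v n)) \<longlonglongrightarrow> y" using tendsto_divide[OF u tendsto_add[OF tendsto_const[of 1] v0]] by simp
  qed (rule u)
  hence "(\<lambda>n. exp (real (Suc n) * ln (1 + v n))) \<longlonglongrightarrow> exp y" by (rule tendsto_exp)
  moreover have "exp (real (Suc n) * ln (1 + v n)) = (1 + v n) ^ Suc n" for n
    using v[of n] by (subst exp_of_nat_mult) (simp add: add_pos_pos)
  ultimately show ?thesis by (simp add: v_def)
qed

lemma gamma_weight_mult_integrable:
  assumes "0 < a" and [measurable]: "f \<in> borel_measurable borel" and f: "\<And>x. \<bar>f x\<bar> \<le> B"
  shows "integrable lborel (\<lambda>x. gamma_weight a x * f x)"
proof (rule Bochner_Integration.integrable_bound[where f="\<lambda>x. gamma_weight a x * B"])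
  show "integrable lborel (\<lambda>x. gamma_weight a x * B)"
    using gamma_weight_integral[OF assms(1)] by (simp add: has_bochner_integral_iff)
  show "AE x in lborel. norm (gamma_weight a x * f x) \<le> norm (gamma_weight a x * B)"
  proof (rule AE_I2)
    fix x
    have "\<bar>f x\<bar> \<le> \<bar>B\<bar>" using f[of x] by linarith
    thus "norm (gamma_weight a x * f x) \<le> norm (gamma_weight a x * B)" by (simp add: abs_mult mult_left_mono)
  qed
qed simp

text \<open>\<open>lim\<close> asks for convergence along moving arguments, because the evaluation
  point t n depends on the index; the Gamma weight dominates throughout.\<close>

lemma beta_weight_integral_limit:
  fixes h :: "nat \<Rightarrow> real \<Rightarrow> real"
  assumes a: "0 < a" and [measurable]: "\<And>n. h n \<in> borel_measurable borel" "H \<in> borel_measurable borel"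
    and h: "\<And>n y. \<bar>h n y\<bar> \<le> 1"
    and lim: "\<And>u y. u \<longlonglongrightarrow> y \<Longrightarrow> (\<lambda>n. h n (u n)) \<longlonglongrightarrow> H y"
    and t: "t \<longlonglongrightarrow> \<tau>"
  shows "(\<lambda>n. \<integral>x. beta_weight (real (Suc n)) a (Suc n) x * h n (t n - s * ln x) \<partial>lborel) \<longlonglongrightarrow> (\<integral>x. gamma_weight a x * H (\<tau> - s * ln x) \<partial>lborel)"
proof (rule integral_dominated_convergence[where w="gamma_weight a"])
  show "integrable lborel (gamma_weight a)" using gamma_weight_integral[OF a] by (simp add: has_bochner_integral_iff)
  show "AE x in lborel. (\<lambda>n. beta_weight (real (Suc n)) a (Suc n) x * h n (t n - s * ln x)) \<longlonglongrightarrow> gamma_weight a x * H (\<tau> - s * ln x)"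
    by (intro AE_I2 tendsto_mult beta_weight_tendsto_gamma_weight lim tendsto_diff t tendsto_const)
  show "AE x in lborel. norm (beta_weight (real (Suc n)) a (Suc n) x * h n (t n - s * ln x)) \<le> gamma_weight a x" for n
  proof (rule AE_I2)
    fix x
    have "norm (beta_weight (real (Suc n)) a (Suc n) x * h n (t n - s * ln x)) \<le> gamma_weight a x * 1"
      unfolding norm_mult using beta_weight_le_gamma_weight[of "Suc n" a x] beta_weight_nonneg[of "real (Suc n)" a "Suc n" x] h[of n "t n - s * ln x"] gamma_weight_nonneg
      by (intro mult_mono) auto
    thus "norm (beta_weight (real (Suc n)) a (Suc n) x * h n (t n - s * ln x)) \<le> gamma_weight a x" by simp
  qed
qed measurable

text \<open>Gamma a times the Laplace transform of the power -s of a Gamma variable, at exp t. The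
  next function is minus its derivative in t, so their quotient is the limit of the functions q on
  the real axis.\<close>

definition laplace_at_exp :: "real \<Rightarrow> real \<Rightarrow> real \<Rightarrow> real" where
  "laplace_at_exp a s t = (\<integral>x. gamma_weight a x * exp (- exp (t - s * ln x)) \<partial>lborel)"

definition moment_at_exp :: "real \<Rightarrow> real \<Rightarrow> real \<Rightarrow> real" where
  "moment_at_exp a s t = (\<integral>x. gamma_weight a x * (exp (t - s * ln x) * exp (- exp (t - s * ln x))) \<partial>lborel)"

lemma mult_exp_neg_le_1: "0 \<le> u \<Longrightarrow> u * exp (- u) \<le> (1::real)"
proof -
  have "u \<le> exp u" using exp_ge_add_one_self[of u] by linarith
  thus ?thesis by (simp add: exp_minus field_simps)
qed

lemma laplace_at_exp_integrable: "0 < a \<Longrightarrow> integrable lborel (\<lambda>x. gamma_weight a x * exp (- exp (t - s * ln x)))"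
  by (rule gamma_weight_mult_integrable[where B=1]) auto

lemma moment_at_exp_integrable: "0 < a \<Longrightarrow> integrable lborel (\<lambda>x. gamma_weight a x * (exp (t - s * ln x) * exp (- exp (t - s * ln x))))"
  by (rule gamma_weight_mult_integrable[where B=1]) (auto simp: mult_exp_neg_le_1)

lemma laplace_at_exp_pos: "0 < a \<Longrightarrow> 0 < laplace_at_exp a s t"
  unfolding laplace_at_exp_def by (rule lborel_integral_pos[where a=0 and b=1, OF laplace_at_exp_integrable]) (auto simp: gamma_weight_nonneg gamma_weight_pos)

lemma moment_at_exp_pos: "0 < a \<Longrightarrow> 0 < moment_at_exp a s t"
  unfolding moment_at_exp_def by (rule lborel_integral_pos[where a=0 and b=1, OF moment_at_exp_integrable]) (auto simp: gamma_weight_nonneg gamma_weight_pos)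

lemma beta_mixture_converges:
  assumes a: "0 < a" and t: "t \<longlonglongrightarrow> \<tau>"
  shows "(\<lambda>n. Re (- beta_mixture' (real (Suc n)) (Suc n) s a (Suc n) (of_real (t n)) / beta_mixture (real (Suc n)) (Suc n) s a (Suc n) (of_real (t n))))
      \<longlonglongrightarrow> moment_at_exp a s \<tau> / laplace_at_exp a s \<tau>"
proof -
  define h1 where "h1 n y = inverse ((1 + exp y / real (Suc n)) ^ Suc n)" for n y
  define h2 where "h2 n y = exp y * inverse ((1 + exp y / real (Suc n)) ^ Suc (Suc n))" for n y
  have p: "1 \<le> 1 + exp y / real (Suc n)" for n y by simp
  have l1: "(\<lambda>n. h1 n (u n)) \<longlonglongrightarrow> exp (- exp y)" if "u \<longlonglongrightarrow> y" for u y
  proof -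
    have "(\<lambda>n. (1 + exp (u n) / real (Suc n)) ^ Suc n) \<longlonglongrightarrow> exp (exp y)"
      using that by (intro compound_interest_limit tendsto_exp) auto
    from tendsto_inverse[OF this] show ?thesis by (simp add: h1_def exp_minus del: power_Suc of_nat_Suc)
  qed
  have l2: "(\<lambda>n. h2 n (u n)) \<longlonglongrightarrow> exp y * exp (- exp y)" if "u \<longlonglongrightarrow> y" for u y
  proof -
    have "(\<lambda>n. exp (u n) * inverse (real (Suc n))) \<longlonglongrightarrow> exp y * 0"
      by (intro tendsto_mult tendsto_exp that LIMSEQ_inverse_real_of_nat)
    hence "(\<lambda>n. 1 + exp (u n) / real (Suc n)) \<longlonglongrightarrow> 1 + 0"
      by (intro tendsto_add tendsto_const) (simp add: divide_inverse)
    from tendsto_mult[OF tendsto_mult[OF tendsto_exp[OF that] tendsto_inverse[OF this]] l1[OF that]]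
    show ?thesis by (simp add: h1_def h2_def mult_ac)
  qed
  have h1: "\<bar>h1 n y\<bar> \<le> 1" for n y
    unfolding h1_def using one_le_power[OF p[of y n], of "Suc n"] by (simp add: inverse_le_1_iff del: power_Suc of_nat_Suc)
  have h2: "\<bar>h2 n y\<bar> \<le> 1" for n y
  proof -
    \<comment> \<open>The derivative kernel has exponent n + 2 over the scale n + 1, so Bernoulli's
      inequality bounds exp y by its denominator uniformly in n.\<close>
    have "exp y \<le> 1 + real (Suc (Suc n)) * (exp y / real (Suc n))"
      by (simp add: field_simps)
    also have "\<dots> \<le> (1 + exp y / real (Suc n)) ^ Suc (Suc n)"
      by (rule Bernoulli_inequality) (simp add: order_trans[of _ 0])
    finally have "exp y \<le> (1 + exp y / real (Suc n)) ^ Suc (Suc n)" .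
    moreover have "0 < (1 + exp y / real (Suc n)) ^ Suc (Suc n)" using p[of y n] by (intro zero_less_power) linarith
    ultimately show ?thesis unfolding h2_def by (simp add: abs_mult divide_inverse[symmetric] divide_le_eq_1_pos del: power_Suc of_nat_Suc)
  qed
  have m1 [measurable]: "h1 n \<in> borel_measurable borel" for n unfolding h1_def[abs_def] by measurable
  have m2 [measurable]: "h2 n \<in> borel_measurable borel" for n unfolding h2_def[abs_def] by measurable
  have "(\<lambda>n. \<integral>x. beta_weight (real (Suc n)) a (Suc n) x * h1 n (t n - s * ln x) \<partial>lborel) \<longlonglongrightarrow> laplace_at_exp a s \<tau>"
    unfolding laplace_at_exp_def by (rule beta_weight_integral_limit[OF a m1 _ h1 l1 t]) simp_all
  moreover have "(\<lambda>n. \<integral>x. beta_weight (real (Suc n)) a (Suc n) x * h2 n (t n - s * ln x) \<partial>lborel) \<longlonglongrightarrow> moment_at_exp a s \<tau>"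
    unfolding moment_at_exp_def by (rule beta_weight_integral_limit[OF a m2 _ h2 l2 t]) simp_all
  moreover have "beta_mixture (real (Suc n)) (Suc n) s a (Suc n) (of_real y) = of_real (\<integral>x. beta_weight (real (Suc n)) a (Suc n) x * h1 n (y - s * ln x) \<partial>lborel)" for n y
    unfolding beta_mixture_of_real h1_def ..
  moreover have "- beta_mixture' (real (Suc n)) (Suc n) s a (Suc n) (of_real y) = of_real (\<integral>x. beta_weight (real (Suc n)) a (Suc n) x * h2 n (y - s * ln x) \<partial>lborel)" for n y
    unfolding beta_mixture'_of_real h2_def by (simp only: mult_minus_left mult_minus_right Bochner_Integration.integral_minus of_real_minus minus_minus)
  ultimately show ?thesis
    using laplace_at_exp_pos[OF a, of s \<tau>] by (simp only: of_real_divide[symmetric] Re_complex_of_real) (rule tendsto_divide, auto)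
qed

section \<open>The logarithmic derivative at the two ends of the real axis\<close>

text \<open>Up to e the factor y is at most e; beyond e the condition 1 / e <= c gives y <= e exp (c
  (y - e)), and only exp (- c e) remains.\<close>

lemma tail_split:
  fixes y e c :: real
  assumes "0 < e" "1 / e \<le> c" "0 \<le> y"
  shows "y * exp (- (c * y)) \<le> e * exp (- (c * y)) + e * exp (- (c * e))"
proof (cases "y \<le> e")
  case True
  hence "y * exp (- (c * y)) \<le> e * exp (- (c * y))" by (intro mult_right_mono) auto
  moreover have "0 \<le> e * exp (- (c * e))" using assms by simp
  ultimately show ?thesis by linarith
next
  case False
  have "y / e = 1 + 1 / e * (y - e)" using assms by (simp add: field_simps)
  also have "\<dots> \<le> 1 + c * (y - e)" using assms False by (intro add_left_mono mult_right_mono) auto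
  also have "\<dots> \<le> exp (c * (y - e))" by (rule exp_ge_add_one_self)
  finally have "y \<le> e * exp (c * (y - e))" using assms by (simp add: field_simps)
  hence "y * exp (- (c * y)) \<le> e * exp (c * (y - e)) * exp (- (c * y))" by (intro mult_right_mono) auto
  also have "\<dots> = e * exp (- (c * e))" by (simp add: exp_add[symmetric] algebra_simps)
  finally show ?thesis using assms by (simp add: add_increasing)
qed

lemma exp_shift_at_bot: "((\<lambda>t. exp (- t - c)) \<longlongrightarrow> (0::real)) at_top"
  by (intro filterlim_compose[OF exp_at_bot]) real_asymp

lemma laplace_at_exp_at_bot:
  assumes a: "0 < a"
  shows "(laplace_at_exp a s \<longlongrightarrow> Gamma a) at_bot"
proof -
  have W: "integrable lborel (gamma_weight a)" "integral\<^sup>L lborel (gamma_weight a) = Gamma a"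
    using gamma_weight_integral[OF a] by (auto simp: has_bochner_integral_iff)
  have "((\<lambda>t. laplace_at_exp a s (- t)) \<longlongrightarrow> (\<integral>x. gamma_weight a x * exp (- 0) \<partial>lborel)) at_top"
    unfolding laplace_at_exp_def
  proof (rule integral_dominated_convergence_at_top[where w="gamma_weight a"])
    show "\<forall>\<^sub>F t in at_top. AE x in lborel. norm (gamma_weight a x * exp (- exp (- t - s * ln x))) \<le> gamma_weight a x"
      by (intro always_eventually allI AE_I2) (auto simp: gamma_weight_nonneg mult_left_le)
    show "AE x in lborel. ((\<lambda>t. gamma_weight a x * exp (- exp (- t - s * ln x))) \<longlongrightarrow> gamma_weight a x * exp (- 0)) at_top"
      by (intro AE_I2 tendsto_intros exp_shift_at_bot)
  qed (use W in auto)
  thus ?thesis using W by (simp add: filterlim_at_bot_mirror)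
qed

lemma ratio_at_bot:
  assumes a: "0 < a"
  shows "((\<lambda>t. moment_at_exp a s t / laplace_at_exp a s t) \<longlongrightarrow> 0) at_bot"
proof -
  have W: "integrable lborel (gamma_weight a)" using gamma_weight_integral[OF a] by (simp add: has_bochner_integral_iff)
  have "((\<lambda>t. moment_at_exp a s (- t)) \<longlongrightarrow> (\<integral>x. gamma_weight a x * (0 * exp (- 0)) \<partial>lborel)) at_top"
    unfolding moment_at_exp_def
  proof (rule integral_dominated_convergence_at_top[where w="gamma_weight a"])
    show "\<forall>\<^sub>F t in at_top. AE x in lborel. norm (gamma_weight a x * (exp (- t - s * ln x) * exp (- exp (- t - s * ln x)))) \<le> gamma_weight a x"
      by (intro always_eventually allI AE_I2) (auto simp: abs_mult gamma_weight_nonneg mult_left_le mult_exp_neg_le_1)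
    show "AE x in lborel. ((\<lambda>t. gamma_weight a x * (exp (- t - s * ln x) * exp (- exp (- t - s * ln x)))) \<longlongrightarrow> gamma_weight a x * (0 * exp (- 0))) at_top"
      by (intro AE_I2 tendsto_intros exp_shift_at_bot)
  qed (use W in auto)
  hence "(moment_at_exp a s \<longlongrightarrow> 0) at_bot" by (simp add: filterlim_at_bot_mirror)
  from tendsto_divide[OF this laplace_at_exp_at_bot[OF a]] show ?thesis using Gamma_real_pos[OF a] by simp
qed

text \<open>With Y = x^(-s) and z = exp t, the quotient times exp (- t) is the mean of Y under the
  law tilted by exp (- z Y). It tends to the infimum of the support of Y, which is 0 because a Gamma
  variable is unbounded. This is the absence of a drift.\<close>

lemma ratio_at_top:
  assumes a: "0 < a" and s: "0 < s"
  shows "((\<lambda>t. moment_at_exp a s t / laplace_at_exp a s t * exp (- t)) \<longlongrightarrow> 0) at_top"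
proof (rule tendstoI)
  fix e' :: real assume "0 < e'"
  define e where "e = e' / 2"
  have e: "0 < e" "e < e'" using \<open>0 < e'\<close> by (auto simp: e_def)
  \<comment> \<open>X = (e/2)^(-1/s): for x >= X one has x^(-s) <= e / 2, so the Laplace transform
    is at least c exp (- e z / 2) with z = exp t, which beats the tail term exp (- e z).\<close>
  define X where "X = exp (- ln (e / 2) / s)"
  have X: "0 < X" by (simp add: X_def)
  define c where "c = (\<integral>x. gamma_weight a x * indicator {X..} x \<partial>lborel)"
  have ci: "integrable lborel (\<lambda>x. gamma_weight a x * indicator {X..} x)"
    by (rule gamma_weight_mult_integrable[OF a, where B=1]) (auto simp: indicator_def)
  have c: "0 < c" unfolding c_def
    by (rule lborel_integral_pos[where a=X and b="X + 1", OF ci]) (use X in \<open>auto simp: gamma_weight_nonneg gamma_weight_pos\<close>)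
  have W: "integrable lborel (gamma_weight a)" "integral\<^sup>L lborel (gamma_weight a) = Gamma a" using gamma_weight_integral[OF a] by (auto simp: has_bochner_integral_iff)
  have main: "moment_at_exp a s t / laplace_at_exp a s t * exp (- t) \<le> e + e * exp (- (e / 2 * exp t)) * Gamma a / c" if t: "1 / e \<le> exp t" for t
  proof -
    have ex: "exp (t - s * ln x) = exp t * exp (- (s * ln x))" for x by (simp add: exp_add[symmetric])
    have "moment_at_exp a s t * exp (- t) = (\<integral>x. gamma_weight a x * (exp (t - s * ln x) * exp (- exp (t - s * ln x))) * exp (- t) \<partial>lborel)"
      by (simp add: moment_at_exp_def)
    also have "\<dots> \<le> (\<integral>x. e * (gamma_weight a x * exp (- exp (t - s * ln x))) + gamma_weight a x * (e * exp (- (exp t * e))) \<partial>lborel)"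
    proof (rule integral_mono)
      show "integrable lborel (\<lambda>x. gamma_weight a x * (exp (t - s * ln x) * exp (- exp (t - s * ln x))) * exp (- t))"
        using moment_at_exp_integrable[OF a, of t s] by simp
      show "integrable lborel (\<lambda>x. e * (gamma_weight a x * exp (- exp (t - s * ln x))) + gamma_weight a x * (e * exp (- (exp t * e))))"
        using laplace_at_exp_integrable[OF a, of t s] W by simp
      fix x
      have "exp (t - s * ln x) * exp (- t) = exp (- (s * ln x))" by (simp add: exp_add[symmetric])
      hence "gamma_weight a x * (exp (t - s * ln x) * exp (- exp (t - s * ln x))) * exp (- t) = gamma_weight a x * (exp (- (s * ln x)) * exp (- exp (t - s * ln x)))"
        by (metis mult.assoc mult.commute)
      also have "\<dots> \<le> gamma_weight a x * (e * exp (- exp (t - s * ln x)) + e * exp (- (exp t * e)))"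
        unfolding ex by (intro mult_left_mono tail_split gamma_weight_nonneg) (use e t in auto)
      finally show "gamma_weight a x * (exp (t - s * ln x) * exp (- exp (t - s * ln x))) * exp (- t)
          \<le> e * (gamma_weight a x * exp (- exp (t - s * ln x))) + gamma_weight a x * (e * exp (- (exp t * e)))"
        by (simp add: algebra_simps)
    qed
    also have "\<dots> = e * laplace_at_exp a s t + Gamma a * (e * exp (- (exp t * e)))"
      using laplace_at_exp_integrable[OF a, of t s] W by (simp add: laplace_at_exp_def)
    finally have 1: "moment_at_exp a s t * exp (- t) \<le> e * laplace_at_exp a s t + Gamma a * (e * exp (- (exp t * e)))" .
    have "c * exp (- (e / 2 * exp t)) = (\<integral>x. gamma_weight a x * indicator {X..} x * exp (- (e / 2 * exp t)) \<partial>lborel)"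
      by (simp add: c_def)
    also have "\<dots> \<le> laplace_at_exp a s t" unfolding laplace_at_exp_def
    proof (rule integral_mono)
      show "integrable lborel (\<lambda>x. gamma_weight a x * indicator {X..} x * exp (- (e / 2 * exp t)))" using ci by simp
      fix x
      show "gamma_weight a x * indicator {X..} x * exp (- (e / 2 * exp t)) \<le> gamma_weight a x * exp (- exp (t - s * ln x))"
      proof (cases "X \<le> x")
        case True
        have "ln X \<le> ln x" using True X by simp
        hence "- ln (e / 2) / s \<le> ln x" unfolding X_def ln_exp .
        hence "- (s * ln x) \<le> ln (e / 2)" using s by (simp add: field_simps)
        hence "exp (- (s * ln x)) \<le> exp (ln (e / 2))" by (simp only: exp_le_cancel_iff)
        hence "exp (- (s * ln x)) \<le> e / 2" using e by simp
        hence "exp (t - s * ln x) \<le> exp t * (e / 2)" unfolding ex by (intro mult_left_mono) auto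
        hence "exp (- (e / 2 * exp t)) \<le> exp (- exp (t - s * ln x))" by (simp add: mult.commute)
        thus ?thesis using True by (simp add: gamma_weight_nonneg mult_left_mono)
      qed (simp add: gamma_weight_nonneg)
    qed (rule laplace_at_exp_integrable[OF a])
    finally have 2: "c * exp (- (e / 2 * exp t)) \<le> laplace_at_exp a s t" .
    have "exp (- (exp t * e)) = exp (- (e / 2 * exp t)) * exp (- (e / 2 * exp t))"
      by (simp add: exp_add[symmetric])
    hence "Gamma a * (e * exp (- (exp t * e))) = (e * exp (- (e / 2 * exp t)) * Gamma a / c) * (c * exp (- (e / 2 * exp t)))"
      using c by simp
    also have "\<dots> \<le> (e * exp (- (e / 2 * exp t)) * Gamma a / c) * laplace_at_exp a s t"
      using 2 e c Gamma_real_pos[OF a] by (intro mult_left_mono) auto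
    finally have "moment_at_exp a s t * exp (- t) \<le> (e + e * exp (- (e / 2 * exp t)) * Gamma a / c) * laplace_at_exp a s t"
      using 1 by (simp only: distrib_right)
    thus ?thesis using laplace_at_exp_pos[OF a, of s t] by (simp add: pos_divide_le_eq)
  qed
  have "((\<lambda>t. e + e * exp (- (e / 2 * exp t)) * Gamma a / c) \<longlongrightarrow> e + e * 0 * Gamma a / c) at_top"
  proof -
    have "filterlim (\<lambda>t. - (e / 2 * exp t)) at_bot at_top"
      unfolding filterlim_uminus_at_top[symmetric] using e
      by (intro filterlim_tendsto_pos_mult_at_top[OF tendsto_const _ exp_at_top]) auto
    hence "((\<lambda>t. exp (- (e / 2 * exp t))) \<longlongrightarrow> 0) at_top" by (rule filterlim_compose[OF exp_at_bot])
    thus ?thesis using c by (intro tendsto_intros) auto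
  qed
  hence "\<forall>\<^sub>F t in at_top. e + e * exp (- (e / 2 * exp t)) * Gamma a / c < e'"
    by (rule order_tendstoD) (use e in simp)
  moreover have "\<forall>\<^sub>F t in at_top. 1 / e \<le> exp t"
    using exp_at_top unfolding filterlim_at_top by blast
  ultimately show "\<forall>\<^sub>F t in at_top. dist (moment_at_exp a s t / laplace_at_exp a s t * exp (- t)) 0 < e'"
  proof eventually_elim
    case (elim t)
    have "0 \<le> moment_at_exp a s t / laplace_at_exp a s t * exp (- t)" using moment_at_exp_pos[OF a, of s t] laplace_at_exp_pos[OF a, of s t] by simp
    thus ?case using main[OF elim(2)] elim(1) by (simp add: dist_real_def)
  qed
qed

lemma ratio_representation:
  assumes a: "0 < a" and s: "0 < s"
  shows "\<exists>M. real_distribution M \<and> (\<forall>l. moment_at_exp a s l / laplace_at_exp a s l = moment_at_exp a s 0 / laplace_at_exp a s 0 * (\<integral>x. exp l * (exp x + 1) / (exp x + exp l) \<partial>M))"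
proof -
  define Q where "Q l = moment_at_exp a s l / laplace_at_exp a s l" for l
  \<comment> \<open>Increases to 1; the summand 2 keeps the value at n = 0 positive.\<close>
  define \<kappa> where "\<kappa> n = 1 - 1 / (real n + 2)" for n
  have kap: "0 < \<kappa> n" "\<kappa> n < 1" for n by (auto simp: \<kappa>_def)
  have kl: "\<kappa> \<longlonglongrightarrow> 1" unfolding \<kappa>_def by real_asymp
  define q where "q n w = - beta_mixture' (real (Suc n)) (Suc n) s a (Suc n) w / beta_mixture (real (Suc n)) (Suc n) s a (Suc n) w" for n w
  define R where "R n l = Re (q n (of_real (\<kappa> n * l)))" for n l
  define g where "g n x = Im (q n (Complex (\<kappa> n * x) (\<kappa> n * pi))) / pi" for n x
  have rep: "has_bochner_integral lborel (\<lambda>x. g n x * (exp l / (exp x + exp l))) (R n l)" for n l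
    unfolding g_def R_def q_def
    by (rule beta_mixture_log_derivative_stieltjes(1)) (use a s kap in auto)
  have g0: "0 \<le> g n x" for n x
    unfolding g_def q_def by (intro divide_nonneg_pos beta_mixture_log_derivative_stieltjes(2)) (use a s kap in auto)
  \<comment> \<open>Measurability is recovered from the integrable representation at l = 0 by
    multiplying with exp x + 1, the inverse of the kernel.\<close>
  have gm: "g n \<in> borel_measurable borel" for n
  proof -
    have [measurable]: "(\<lambda>x. g n x * (exp 0 / (exp x + exp 0))) \<in> borel_measurable borel"
      using rep[of n 0] by (auto simp: has_bochner_integral_iff)
    have "(\<lambda>x. g n x * (exp 0 / (exp x + exp 0)) * (exp x + 1)) \<in> borel_measurable borel" by measurable
    moreover have "g n x * (exp 0 / (exp x + exp 0)) * (exp x + 1) = g n x" for x :: real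
    proof -
      have "exp x + 1 \<noteq> 0" using exp_gt_zero[of x] by linarith
      thus ?thesis by simp
    qed
    ultimately show ?thesis by simp
  qed
  have conv: "(\<lambda>n. R n l) \<longlonglongrightarrow> Q l" for l
    unfolding R_def q_def Q_def using tendsto_mult[OF kl tendsto_const[of l]]
    by (intro beta_mixture_converges[OF a]) simp
  have Q0: "0 < Q 0" unfolding Q_def using moment_at_exp_pos[OF a] laplace_at_exp_pos[OF a] by simp
  \<comment> \<open>Positivity of R n 0 follows from the positive limit only from some index on, so
    the shifted sequence is passed to \<open>stieltjes_limit\<close>.\<close>
  obtain n0 where n0: "\<And>n. n \<ge> n0 \<Longrightarrow> 0 < R n 0"
    using order_tendstoD(1)[OF conv Q0] by (auto simp: eventually_sequentially)
  show ?thesis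
  proof (rule stieltjes_limit[of "\<lambda>n. g (n + n0)" "\<lambda>n. R (n + n0)" Q])
    show "0 \<le> g (n + n0) x" "g (n + n0) \<in> borel_measurable borel" "0 < R (n + n0) 0" for n x
      using g0 gm n0 by auto
    show "has_bochner_integral lborel (\<lambda>x. g (n + n0) x * (exp l / (exp x + exp l))) (R (n + n0) l)" for n l
      by (rule rep)
    show "(\<lambda>n. R (n + n0) l) \<longlonglongrightarrow> Q l" for l by (rule LIMSEQ_ignore_initial_segment[OF conv])
    show "(Q \<longlongrightarrow> 0) at_bot" unfolding Q_def by (rule ratio_at_bot[OF a])
    show "((\<lambda>l. Q l * exp (- l)) \<longlongrightarrow> 0) at_top" unfolding Q_def by (rule ratio_at_top[OF a s])
    show ?thesis if "real_distribution M" "\<And>l. Q l = Q 0 * (\<integral>x. exp l * (exp x + 1) / (exp x + exp l) \<partial>M)" for M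
      using that unfolding Q_def by (intro exI[of _ M] conjI allI)
  qed (rule Q0)
qed

section \<open>The Levy density\<close>

text \<open>From (1 + d u / n)^n <= exp (d u). With u = exp x it bounds every derivative of the
  Laplace integrand uniformly in x, so no moments of M are needed.\<close>

lemma power_exp_neg_le:
  fixes u d :: real
  assumes "0 \<le> u" "0 < d"
  shows "u ^ n * exp (- (d * u)) \<le> (real n / d) ^ n"
proof (cases "n = 0")
  case False
  have "(d * u / real n) ^ n \<le> (1 + d * u / real n) ^ n" using assms by (intro power_mono) auto
  also have "\<dots> \<le> exp (d * u)"
    using assms False by (intro exp_ge_one_plus_x_over_n_power_n) (auto intro: order_trans[of _ 0])
  finally have "(d * u / real n) ^ n * exp (- (d * u)) \<le> exp (d * u) * exp (- (d * u))"
    by (rule mult_right_mono) simp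
  hence "(d * u / real n) ^ n * exp (- (d * u)) \<le> 1" by (simp only: exp_minus_inverse)
  hence "(real n / d) ^ n * ((d * u / real n) ^ n * exp (- (d * u))) \<le> (real n / d) ^ n * 1"
    using assms by (intro mult_left_mono) auto
  also have "(real n / d) ^ n * ((d * u / real n) ^ n * exp (- (d * u))) = u ^ n * exp (- (d * u))"
    using assms False by (simp add: power_mult_distrib[symmetric] flip: mult.assoc)
  finally show ?thesis by simp
qed (use assms in simp)

text \<open>In the variable $t = e^x$, the Thorin measure is a multiple of $(1 + t)\,M(dt)$.\<close>

definition weighted_laplace :: "real measure \<Rightarrow> nat \<Rightarrow> real \<Rightarrow> real" where
  "weighted_laplace M n y = (\<integral>x. (exp x + 1) * (- exp x) ^ n * exp (- (y * exp x)) \<partial>M)"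

context
  fixes M :: "real measure"
  assumes M: "real_distribution M"
begin

interpretation real_distribution M by (rule M)

lemma weighted_laplace_bound:
  assumes "0 < d" "d \<le> y"
  shows "\<bar>(exp x + 1) * (- exp x) ^ n * exp (- (y * exp x))\<bar> \<le> (real (Suc n) / d) ^ Suc n + (real n / d) ^ n"
proof -
  have "\<bar>(exp x + 1) * (- exp x) ^ n * exp (- (y * exp x))\<bar> = (exp x + 1) * exp x ^ n * exp (- (y * exp x))"
    by (simp add: abs_mult power_abs add_nonneg_nonneg)
  also have "\<dots> \<le> (exp x + 1) * exp x ^ n * exp (- (d * exp x))"
    using assms by (intro mult_left_mono mult_nonneg_nonneg add_nonneg_nonneg) auto
  also have "\<dots> = exp x ^ Suc n * exp (- (d * exp x)) + exp x ^ n * exp (- (d * exp x))"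
    by (simp add: algebra_simps)
  also have "\<dots> \<le> (real (Suc n) / d) ^ Suc n + (real n / d) ^ n"
    using assms by (intro add_mono power_exp_neg_le) auto
  finally show ?thesis .
qed

lemma weighted_laplace_integrable:
  assumes "0 < y"
  shows "integrable M (\<lambda>x. (exp x + 1) * (- exp x) ^ n * exp (- (y * exp x)))"
  using weighted_laplace_bound[OF assms order_refl] by (intro integrable_const_bound) auto

lemma DERIV_weighted_laplace:
  assumes "0 < y"
  shows "(weighted_laplace M n has_field_derivative weighted_laplace M (Suc n) y) (at y)"
proof -
  have "((\<lambda>y. \<integral>x. (exp x + 1) * (- exp x) ^ n * exp (- (y * exp x)) \<partial>M) has_field_derivative
     (\<integral>x. (exp x + 1) * (- exp x) ^ Suc n * exp (- (y * exp x)) \<partial>M)) (at y)"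
  proof (rule has_field_derivative_integral[where S="{y/2<..}"])
    show "integrable M (\<lambda>x. (exp x + 1) * (- exp x) ^ n * exp (- (z * exp x)))" if "z \<in> {y/2<..}" for z
      using that assms by (intro weighted_laplace_integrable) auto
    show "((\<lambda>z. (exp x + 1) * (- exp x) ^ n * exp (- (z * exp x))) has_field_derivative
        (exp x + 1) * (- exp x) ^ Suc n * exp (- (z * exp x))) (at z)" for z x
      by (auto intro!: derivative_eq_intros)
    show "norm ((exp x + 1) * (- exp x) ^ Suc n * exp (- (z * exp x)))
        \<le> (real (Suc (Suc n)) / (y/2)) ^ Suc (Suc n) + (real (Suc n) / (y/2)) ^ Suc n" if "z \<in> {y/2<..}" for z x
      unfolding real_norm_def using that assms by (intro weighted_laplace_bound) auto
  qed (use assms in auto)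
  thus ?thesis unfolding weighted_laplace_def[abs_def] .
qed

lemma weighted_laplace_sign:
  shows "0 \<le> (-1) ^ n * weighted_laplace M n y"
proof -
  have e: "(-1) ^ n * (- exp x) ^ n = exp x ^ n" for x :: real
    by (simp flip: power_mult_distrib)
  have "(-1) ^ n * ((exp x + 1) * (- exp x) ^ n * exp (- (y * exp x))) = (exp x + 1) * exp x ^ n * exp (- (y * exp x))" for x
    unfolding e[of x, symmetric] by (simp only: mult_ac)
  note eq = this
  have "(-1) ^ n * weighted_laplace M n y = (\<integral>x. (exp x + 1) * exp x ^ n * exp (- (y * exp x)) \<partial>M)"
    unfolding weighted_laplace_def by (subst integral_mult_right_zero[symmetric], subst eq) (rule refl)
  also have "\<dots> \<ge> 0" by (intro Bochner_Integration.integral_nonneg mult_nonneg_nonneg add_nonneg_nonneg) auto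
  finally show ?thesis .
qed

lemma completely_monotone_weighted_laplace:
  assumes c: "0 \<le> c"
  shows "completely_monotone (\<lambda>y. c * weighted_laplace M 0 y)"
proof -
  have d: "((\<lambda>y. c * weighted_laplace M n y) has_field_derivative c * weighted_laplace M (Suc n) y) (at y)" if "0 < y" for n y
    using DERIV_weighted_laplace[OF that] by (rule DERIV_cmult)
  \<comment> \<open>Claimed only for y > 0; since that half-line is open, the iterated derivatives
    can be compared through neighbourhoods.\<close>
  have eq: "(deriv ^^ n) (\<lambda>y. c * weighted_laplace M 0 y) y = c * weighted_laplace M n y" if "0 < y" for n y
    using that
  proof (induction n arbitrary: y)
    case (Suc n)
    have "\<forall>\<^sub>F z in nhds y. (deriv ^^ n) (\<lambda>y. c * weighted_laplace M 0 y) z = c * weighted_laplace M n z"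
      using eventually_nhds_in_open[of "{0<..}" y] Suc by (auto elim!: eventually_mono)
    hence "deriv ((deriv ^^ n) (\<lambda>y. c * weighted_laplace M 0 y)) y = deriv (\<lambda>y. c * weighted_laplace M n y) y"
      by (rule deriv_cong_ev) simp
    thus ?case using d[OF Suc.prems, of n] by (simp add: DERIV_imp_deriv)
  qed simp
  show ?thesis unfolding completely_monotone_def
  proof (intro allI impI conjI)
    fix n and y :: real assume y: "0 < y"
    have "\<forall>\<^sub>F z in nhds y. c * weighted_laplace M n z = (deriv ^^ n) (\<lambda>y. c * weighted_laplace M 0 y) z"
      using eventually_nhds_in_open[of "{0<..}" y] y eq by (auto elim!: eventually_mono)
    hence "((deriv ^^ n) (\<lambda>y. c * weighted_laplace M 0 y) has_field_derivative c * weighted_laplace M (Suc n) y) (at y)"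
      using d[OF y, of n] by (subst (asm) DERIV_cong_ev) auto
    thus "(deriv ^^ n) (\<lambda>y. c * weighted_laplace M 0 y) field_differentiable at y"
      unfolding field_differentiable_def by blast
    show "0 \<le> (-1) ^ n * (deriv ^^ n) (\<lambda>y. c * weighted_laplace M 0 y) y"
      using weighted_laplace_sign[of n y] c by (simp add: eq[OF y] mult.left_commute[of _ c])
  qed
qed

text \<open>The Stieltjes transform of (1 + t) M(dt), with t = exp x. In the variable z itself,
  minus the logarithmic derivative of the Laplace transform will be a multiple of it.\<close>

definition weighted_stieltjes :: "real \<Rightarrow> real" where
  "weighted_stieltjes l = (\<integral>x. (exp x + 1) / (exp x + l) \<partial>M)"

lemma stieltjes_kernel_bound:
  assumes "0 < d" "d \<le> (l::real)"
  shows "\<bar>(exp x + 1) / (exp x + l)\<bar> \<le> 1 + 1 / d"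
proof -
  have "exp x + 1 \<le> (1 + 1 / d) * (exp x + d)" using assms by (simp add: field_simps)
  also have "\<dots> \<le> (1 + 1 / d) * (exp x + l)" using assms by (intro mult_left_mono) auto
  finally have "exp x + 1 \<le> (1 + 1 / d) * (exp x + l)" .
  moreover have "0 < exp x + l" using assms by (simp add: add_pos_pos)
  ultimately show ?thesis by (simp add: abs_if add_nonneg_nonneg divide_le_eq less_le_not_le)
qed

lemma weighted_stieltjes_integrable:
  assumes "0 < l"
  shows "integrable M (\<lambda>x. (exp x + 1) / (exp x + l))"
  using stieltjes_kernel_bound[OF assms order_refl] by (intro integrable_const_bound) auto

lemma isCont_weighted_stieltjes:
  assumes l: "0 < l"
  shows "isCont weighted_stieltjes l"
proof -
  have "((\<lambda>l. \<integral>x. (exp x + 1) / (exp x + l) \<partial>M) has_field_derivative (\<integral>x. - ((exp x + 1) / (exp x + l) * (1 / (exp x + l))) \<partial>M)) (at l)"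
  proof (rule has_field_derivative_integral[where S="{l/2<..}"])
    show "integrable M (\<lambda>x. (exp x + 1) / (exp x + z))" if "z \<in> {l/2<..}" for z
      using that l by (intro weighted_stieltjes_integrable) auto
    show "((\<lambda>z. (exp x + 1) / (exp x + z)) has_field_derivative - ((exp x + 1) / (exp x + z) * (1 / (exp x + z)))) (at z)"
      if "z \<in> {l/2<..}" for z x
    proof -
      have "exp x + z \<noteq> 0" using that l exp_gt_zero[of x] by (auto simp del: exp_gt_zero)
      thus ?thesis by (auto intro!: derivative_eq_intros simp: divide_simps)
    qed
    show "norm (- ((exp x + 1) / (exp x + z) * (1 / (exp x + z)))) \<le> (1 + 1 / (l/2)) * (1 / (l/2))"
      if "z \<in> {l/2<..}" for z x
    proof -
      have z: "l / 2 \<le> z" "0 < l / 2" using that l by auto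
      have "l / 2 \<le> exp x + z" using z exp_gt_zero[of x] by linarith
      hence "1 / (exp x + z) \<le> 1 / (l / 2)" "0 \<le> 1 / (exp x + z)"
        using z(2) by (auto intro!: divide_left_mono mult_pos_pos simp only: zero_le_divide_1_iff)
      moreover have "\<bar>(exp x + 1) / (exp x + z)\<bar> \<le> 1 + 1 / (l/2)" by (rule stieltjes_kernel_bound[OF z(2,1)])
      ultimately show ?thesis
        using l unfolding real_norm_def abs_minus_cancel abs_mult by (intro mult_mono) auto
    qed
  qed (use l in auto)
  thus ?thesis unfolding weighted_stieltjes_def[abs_def] by (rule DERIV_isCont)
qed

lemma nn_integral_exp_decay:
  assumes "0 < (c::real)"
  shows "(\<integral>\<^sup>+y. ennreal (exp (- (c * y))) * indicator {0<..} y \<partial>lborel) = ennreal (1 / c)"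
proof -
  have "(\<integral>\<^sup>+y. ennreal (exp (- (c * y))) * indicator {0<..} y \<partial>lborel) = (\<integral>\<^sup>+y. ennreal (exp (- (c * y))) * indicator {0..} y \<partial>lborel)"
    by (rule nn_integral_cong_AE) (use AE_lborel_singleton[of 0] in \<open>auto elim!: eventually_mono simp: indicator_def\<close>)
  also have "\<dots> = ennreal (0 - (- exp (- (c * 0)) / c))"
  proof (rule nn_integral_FTC_atLeast)
    show "((\<lambda>y. - exp (- (c * y)) / c) has_real_derivative exp (- (c * y))) (at y)" for y
      using assms by (auto intro!: derivative_eq_intros)
    show "((\<lambda>y. - exp (- (c * y)) / c) \<longlongrightarrow> 0) at_top" using assms by real_asymp
  qed auto
  finally show ?thesis by simp
qed

lemma nn_integral_exp_interval:
  assumes "0 < y" "0 \<le> t"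
  shows "(\<integral>\<^sup>+l. ennreal (exp (- (l * y))) * indicator {0..t} l \<partial>lborel) = ennreal ((1 - exp (- (t * y))) / y)"
proof -
  have "(\<integral>\<^sup>+l. ennreal (exp (- (l * y))) * indicator {0..t} l \<partial>lborel) = ennreal (- exp (- (t * y)) / y - (- exp (- (0 * y)) / y))"
    by (rule nn_integral_FTC_Icc) (use assms in \<open>auto intro!: derivative_eq_intros\<close>)
  thus ?thesis using assms by (simp add: diff_divide_distrib)
qed

lemma weighted_laplace_measurable [measurable]: "weighted_laplace M n \<in> borel_measurable borel"
  unfolding weighted_laplace_def[abs_def] by measurable

lemma weighted_laplace_nonneg: "0 \<le> weighted_laplace M 0 y"
  using weighted_laplace_sign[of 0] by simp

text \<open>A Stieltjes transform is an iterated Laplace transform: Tonelli and 1 / (t + l) =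
  integral of exp (- (t + l) y) over y > 0.\<close>

lemma nn_integral_exp_weighted_laplace:
  assumes l: "0 < l"
  shows "(\<integral>\<^sup>+y. ennreal (exp (- (l * y)) * weighted_laplace M 0 y) * indicator {0<..} y \<partial>lborel) = ennreal (weighted_stieltjes l)"
proof -
  have "(\<integral>\<^sup>+y. ennreal (exp (- (l * y)) * weighted_laplace M 0 y) * indicator {0<..} y \<partial>lborel)
     = (\<integral>\<^sup>+y. (\<integral>\<^sup>+x. ennreal (exp x + 1) * (ennreal (exp (- ((exp x + l) * y))) * indicator {0<..} y) \<partial>M) \<partial>lborel)"
  proof (rule nn_integral_cong)
    fix y :: real
    show "ennreal (exp (- (l * y)) * weighted_laplace M 0 y) * indicator {0<..} y
      = (\<integral>\<^sup>+x. ennreal (exp x + 1) * (ennreal (exp (- ((exp x + l) * y))) * indicator {0<..} y) \<partial>M)"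
    proof (cases "0 < y")
      case True
      have i: "integrable M (\<lambda>x. exp (- (l * y)) * ((exp x + 1) * exp (- (y * exp x))))"
        using weighted_laplace_integrable[OF True, of 0] by simp
      have "exp (- (l * y)) * weighted_laplace M 0 y = (\<integral>x. exp (- (l * y)) * ((exp x + 1) * exp (- (y * exp x))) \<partial>M)"
        by (simp add: weighted_laplace_def)
      hence "ennreal (exp (- (l * y)) * weighted_laplace M 0 y) = (\<integral>\<^sup>+x. ennreal (exp (- (l * y)) * ((exp x + 1) * exp (- (y * exp x)))) \<partial>M)"
        by (subst nn_integral_eq_integral[OF i]) (auto intro!: AE_I2 mult_nonneg_nonneg add_nonneg_nonneg)
      also have "\<dots> = (\<integral>\<^sup>+x. ennreal (exp x + 1) * (ennreal (exp (- ((exp x + l) * y)))) \<partial>M)"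
      proof (rule nn_integral_cong)
        fix x :: real
        have "exp (- (l * y)) * ((exp x + 1) * exp (- (y * exp x))) = (exp x + 1) * exp (- ((exp x + l) * y))"
        proof -
          have "- ((exp x + l) * y) = - (l * y) + - (y * exp x)" by (simp add: algebra_simps)
          thus ?thesis by (simp only: exp_add mult_ac)
        qed
        note eq = this
        show "ennreal (exp (- (l * y)) * ((exp x + 1) * exp (- (y * exp x)))) = ennreal (exp x + 1) * (ennreal (exp (- ((exp x + l) * y))))"
          unfolding eq by (rule ennreal_mult) (auto intro: add_nonneg_nonneg)
      qed
      finally show ?thesis using True by simp
    qed simp
  qed
  also have "\<dots> = (\<integral>\<^sup>+x. (\<integral>\<^sup>+y. ennreal (exp x + 1) * (ennreal (exp (- ((exp x + l) * y))) * indicator {0<..} y) \<partial>lborel) \<partial>M)"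
  proof -
    interpret pair_sigma_finite M lborel ..
    show ?thesis by (rule Fubini') measurable
  qed
  also have "\<dots> = (\<integral>\<^sup>+x. ennreal ((exp x + 1) / (exp x + l)) \<partial>M)"
  proof (rule nn_integral_cong)
    fix x :: real
    have p: "0 < exp x + l" using l by (simp add: add_pos_pos)
    have "(\<integral>\<^sup>+y. ennreal (exp x + 1) * (ennreal (exp (- ((exp x + l) * y))) * indicator {0<..} y) \<partial>lborel)
      = ennreal (exp x + 1) * ennreal (1 / (exp x + l))"
      by (subst nn_integral_cmult) (auto simp: nn_integral_exp_decay[OF p])
    also have "\<dots> = ennreal ((exp x + 1) / (exp x + l))"
      using p by (subst ennreal_mult[symmetric]) (auto simp: add_nonneg_nonneg)
    finally show "(\<integral>\<^sup>+y. ennreal (exp x + 1) * (ennreal (exp (- ((exp x + l) * y))) * indicator {0<..} y) \<partial>lborel)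
      = ennreal ((exp x + 1) / (exp x + l))" .
  qed
  also have "\<dots> = ennreal (weighted_stieltjes l)"
    unfolding weighted_stieltjes_def using l
    by (intro nn_integral_eq_integral weighted_stieltjes_integrable) (auto intro!: AE_I2 divide_nonneg_pos add_nonneg_nonneg add_pos_pos)
  finally show ?thesis .
qed

text \<open>The previous identity integrated over 0 < l < t: integrating exp (- l y) in l produces
  (1 - exp (- t y)) / y, the Levy-Khintchine kernel. Nonnegative integrals avoid any prior
  integrability claim near y = 0.\<close>

lemma nn_integral_weighted_stieltjes:
  assumes t: "0 \<le> t"
  shows "(\<integral>\<^sup>+l. ennreal (weighted_stieltjes l) * indicator {0<..<t} l \<partial>lborel)
    = (\<integral>\<^sup>+y. ennreal ((1 - exp (- (t * y))) * (weighted_laplace M 0 y / y)) * indicator {0<..} y \<partial>lborel)"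
proof -
  have "(\<integral>\<^sup>+l. ennreal (weighted_stieltjes l) * indicator {0<..<t} l \<partial>lborel)
    = (\<integral>\<^sup>+l. (\<integral>\<^sup>+y. ennreal (weighted_laplace M 0 y) * indicator {0<..} y * (ennreal (exp (- (l * y))) * indicator {0..t} l) \<partial>lborel) \<partial>lborel)"
  proof (rule nn_integral_cong_AE)
    have "AE l in lborel. l \<noteq> 0 \<and> l \<noteq> t" using AE_lborel_singleton[of 0] AE_lborel_singleton[of t] by eventually_elim simp
    thus "AE l in lborel. ennreal (weighted_stieltjes l) * indicator {0<..<t} l
       = (\<integral>\<^sup>+y. ennreal (weighted_laplace M 0 y) * indicator {0<..} y * (ennreal (exp (- (l * y))) * indicator {0..t} l) \<partial>lborel)"
    proof eventually_elim
      case (elim l)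
      show ?case
      proof (cases "0 < l \<and> l < t")
        case True
        have "(\<integral>\<^sup>+y. ennreal (weighted_laplace M 0 y) * indicator {0<..} y * (ennreal (exp (- (l * y))) * indicator {0..t} l) \<partial>lborel)
          = (\<integral>\<^sup>+y. ennreal (exp (- (l * y)) * weighted_laplace M 0 y) * indicator {0<..} y \<partial>lborel)"
          using True by (intro nn_integral_cong) (simp add: ennreal_mult weighted_laplace_nonneg mult_ac)
        thus ?thesis using True nn_integral_exp_weighted_laplace[of l] by simp
      next
        case False
        hence "l \<notin> {0..t}" "l \<notin> {0<..<t}" using elim by auto
        thus ?thesis by simp
      qed
    qed
  qed
  also have "\<dots> = (\<integral>\<^sup>+y. (\<integral>\<^sup>+l. ennreal (weighted_laplace M 0 y) * indicator {0<..} y * (ennreal (exp (- (l * y))) * indicator {0..t} l) \<partial>lborel) \<partial>lborel)"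
    by (rule lborel_pair.Fubini') measurable
  also have "\<dots> = (\<integral>\<^sup>+y. ennreal ((1 - exp (- (t * y))) * (weighted_laplace M 0 y / y)) * indicator {0<..} y \<partial>lborel)"
  proof (rule nn_integral_cong)
    fix y :: real
    show "(\<integral>\<^sup>+l. ennreal (weighted_laplace M 0 y) * indicator {0<..} y * (ennreal (exp (- (l * y))) * indicator {0..t} l) \<partial>lborel)
      = ennreal ((1 - exp (- (t * y))) * (weighted_laplace M 0 y / y)) * indicator {0<..} y"
    proof (cases "0 < y")
      case True
      have "(\<integral>\<^sup>+l. ennreal (weighted_laplace M 0 y) * indicator {0<..} y * (ennreal (exp (- (l * y))) * indicator {0..t} l) \<partial>lborel)
         = ennreal (weighted_laplace M 0 y) * ennreal ((1 - exp (- (t * y))) / y)"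
        using True by (subst nn_integral_cmult) (auto simp: nn_integral_exp_interval[OF True t])
      also have "\<dots> = ennreal (weighted_laplace M 0 y * ((1 - exp (- (t * y))) / y))"
        using True t by (subst ennreal_mult) (auto simp: weighted_laplace_nonneg)
      finally show ?thesis using True by (simp add: mult_ac)
    qed simp
  qed
  finally show ?thesis .
qed

end

section \<open>The Laplace exponent\<close>

text \<open>The same transform in the Laplace variable itself, so that t = 0, which has no
  logarithm, is included.\<close>

definition laplace :: "real \<Rightarrow> real \<Rightarrow> real \<Rightarrow> real" where
  "laplace a s t = (\<integral>x. gamma_weight a x * exp (- t * x powr (- s)) \<partial>lborel)"

lemma laplace_eq_at_exp: "0 < t \<Longrightarrow> laplace a s t = laplace_at_exp a s (ln t)"
  unfolding laplace_def laplace_at_exp_def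
  by (intro Bochner_Integration.integral_cong refl) (auto simp: gamma_weight_def powr_def exp_diff exp_minus divide_inverse)

lemma laplace_0: "0 < a \<Longrightarrow> laplace a s 0 = Gamma a"
  using gamma_weight_integral[of a] by (simp add: laplace_def has_bochner_integral_iff)

lemma DERIV_laplace:
  assumes a: "0 < a" and t: "0 < t"
  shows "(laplace a s has_field_derivative - (moment_at_exp a s (ln t) / t)) (at t)"
proof -
  have "((\<lambda>t. \<integral>x. gamma_weight a x * exp (- t * x powr (- s)) \<partial>lborel) has_field_derivative
     (\<integral>x. gamma_weight a x * (- (x powr (- s)) * exp (- t * x powr (- s))) \<partial>lborel)) (at t)"
  proof (rule has_field_derivative_integral[where S="{t/2<..}" and g="\<lambda>x. gamma_weight a x * (2 / t)"])
    show "integrable lborel (\<lambda>x. gamma_weight a x * exp (- z * x powr (- s)))" if "z \<in> {t/2<..}" for z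
      using that t by (intro gamma_weight_mult_integrable[OF a, where B=1]) auto
    show "((\<lambda>z. gamma_weight a x * exp (- z * x powr (- s))) has_field_derivative
        gamma_weight a x * (- (x powr (- s)) * exp (- z * x powr (- s)))) (at z)" for z x
      by (auto intro!: derivative_eq_intros)
    show "norm (gamma_weight a x * (- (x powr (- s)) * exp (- z * x powr (- s)))) \<le> gamma_weight a x * (2 / t)" if "z \<in> {t/2<..}" for z x
    proof -
      \<comment> \<open>The factor y is absorbed by u exp (- u) <= 1 at u = t y / 2, which explains
        both the domain z > t / 2 and the constant 2 / t.\<close>
      define y where "y = x powr (- s)"
      have y: "0 \<le> y" by (simp add: y_def)
      have "(t / 2 * y) * exp (- (t / 2 * y)) \<le> 1" using y t by (intro mult_exp_neg_le_1) auto
      hence "y * exp (- (t / 2 * y)) \<le> 2 / t" using t by (simp add: field_simps)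
      moreover have "t / 2 * y \<le> z * y" using that y by (intro mult_right_mono) auto
      hence "y * exp (- z * y) \<le> y * exp (- (t / 2 * y))" using y by (intro mult_left_mono) auto
      ultimately have "y * exp (- z * y) \<le> 2 / t" by linarith
      from mult_left_mono[OF this gamma_weight_nonneg[of a x]] show ?thesis
        by (simp add: abs_mult gamma_weight_nonneg y_def)
    qed
    show "integrable lborel (\<lambda>x. gamma_weight a x * (2 / t))"
      using gamma_weight_integral[OF a] by (simp add: has_bochner_integral_iff)
  qed (use t in auto)
  moreover have "(\<integral>x. gamma_weight a x * (- (x powr (- s)) * exp (- t * x powr (- s))) \<partial>lborel) = - (moment_at_exp a s (ln t) / t)"
  proof -
    have "gamma_weight a x * (- (x powr (- s)) * exp (- t * x powr (- s))) = - (1 / t) * (gamma_weight a x * (exp (ln t - s * ln x) * exp (- exp (ln t - s * ln x))))" for x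
      using t by (auto simp: gamma_weight_def powr_def exp_diff exp_minus divide_inverse)
    note eq = this
    show ?thesis unfolding moment_at_exp_def by (subst eq, subst integral_mult_right_zero) simp
  qed
  ultimately show ?thesis unfolding laplace_def[abs_def] by simp
qed

text \<open>The exponent is the integral over (0, t) of its derivative, a multiple of the Stieltjes
  transform; finiteness comes from the limit at 0. Tonelli then moves the integral to the variable
  y, where finiteness becomes integrability.\<close>

lemma laplace_exponent:
  assumes a: "0 < a" and s: "0 < s"
  shows "\<exists>c M. 0 \<le> c \<and> real_distribution M \<and>
     (\<forall>t\<ge>0. has_bochner_integral lborel (\<lambda>y. indicator {0<..} y * ((1 - exp (- (t * y))) * (c * weighted_laplace M 0 y / y)))
        (- ln (laplace a s t / Gamma a)))"
proof -
  define c where "c = moment_at_exp a s 0 / laplace_at_exp a s 0"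
  have c: "0 < c" unfolding c_def using moment_at_exp_pos[OF a] laplace_at_exp_pos[OF a] by simp
  obtain M where M: "real_distribution M"
    and rep: "\<And>l. moment_at_exp a s l / laplace_at_exp a s l = c * (\<integral>x. exp l * (exp x + 1) / (exp x + exp l) \<partial>M)"
    using ratio_representation[OF a s] unfolding c_def by blast
  have rep': "moment_at_exp a s (ln t) / t / laplace_at_exp a s (ln t) = c * weighted_stieltjes M t" if "0 < t" for t
  proof -
    have "(\<integral>x. exp (ln t) * (exp x + 1) / (exp x + exp (ln t)) \<partial>M) = t * weighted_stieltjes M t"
      unfolding weighted_stieltjes_def[OF M] using that by (subst integral_mult_right_zero[symmetric]) simp
    hence "moment_at_exp a s (ln t) / laplace_at_exp a s (ln t) = c * (t * weighted_stieltjes M t)" using rep[of "ln t"] by simp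
    hence "moment_at_exp a s (ln t) / laplace_at_exp a s (ln t) / t = c * weighted_stieltjes M t" using that by simp
    thus ?thesis by (simp add: mult.commute)
  qed
  have st0: "0 \<le> weighted_stieltjes M l" if "0 < l" for l
    unfolding weighted_stieltjes_def[OF M] using that
    by (intro Bochner_Integration.integral_nonneg divide_nonneg_pos add_nonneg_nonneg add_pos_pos) auto
  have G: "0 < Gamma a" by (rule Gamma_real_pos[OF a])
  have "has_bochner_integral lborel (\<lambda>y. indicator {0<..} y * ((1 - exp (- (t * y))) * (c * weighted_laplace M 0 y / y)))
        (- ln (laplace a s t / Gamma a))" if t: "0 \<le> t" for t
  proof -
    have "(\<integral>\<^sup>+l. ennreal (c * weighted_stieltjes M l) * indicator {0<..<t} l \<partial>lborel) = ennreal (- ln (laplace a s t / Gamma a))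
       \<and> 0 \<le> - ln (laplace a s t / Gamma a)"
    proof (cases "t = 0")
      case True
      thus ?thesis using laplace_0[OF a, of s] G by simp
    next
      case False
      hence t: "0 < t" using t by simp
      define F where "F = (\<lambda>l. - ln (laplace_at_exp a s (ln l)))"
      have dF: "(F has_real_derivative c * weighted_stieltjes M l) (at l)" if l: "0 < l" for l
      proof -
        have "((\<lambda>l. - ln (laplace a s l)) has_real_derivative c * weighted_stieltjes M l) (at l)"
          unfolding rep'[OF l, symmetric] laplace_eq_at_exp[OF l, symmetric]
          using DERIV_laplace[OF a l, of s] laplace_at_exp_pos[OF a, of s "ln l"] laplace_eq_at_exp[OF l, of a s]
          by (auto intro!: derivative_eq_intros)
        moreover have "\<forall>\<^sub>F l in nhds l. - ln (laplace a s l) = F l"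
          using eventually_nhds_in_open[of "{0<..}" l] l by (auto elim!: eventually_mono simp: F_def laplace_eq_at_exp)
        ultimately show ?thesis by (subst (asm) DERIV_cong_ev) auto
      qed
      \<comment> \<open>\<open>F\<close> uses the unnormalised transform; subtracting this limit
        supplies the division by Gamma a.\<close>
      have lim0: "(F \<longlongrightarrow> - ln (Gamma a)) (at_right 0)"
        unfolding F_def using G by (intro tendsto_minus tendsto_ln filterlim_compose[OF laplace_at_exp_at_bot[OF a] ln_at_0]) auto
      have limt: "(F \<longlongrightarrow> F t) (at_left t)"
        using DERIV_isCont[OF dF[OF t]] by (simp add: isCont_def filterlim_at_split)
      note ftc = interval_integral_FTC_nonneg[of "ereal 0" "ereal t" F "\<lambda>l. c * weighted_stieltjes M l" "- ln (Gamma a)" "F t"]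
      have prem: "ereal 0 < ereal t" "\<And>x. ereal 0 < ereal x \<Longrightarrow> ereal x < ereal t \<Longrightarrow> (F has_real_derivative c * weighted_stieltjes M x) (at x)"
        "\<And>x. ereal 0 < ereal x \<Longrightarrow> ereal x < ereal t \<Longrightarrow> isCont (\<lambda>l. c * weighted_stieltjes M l) x"
        "AE x in lborel. ereal 0 < ereal x \<longrightarrow> ereal x < ereal t \<longrightarrow> 0 \<le> c * weighted_stieltjes M x"
        "((F \<circ> real_of_ereal) \<longlongrightarrow> - ln (Gamma a)) (at_right (ereal 0))" "((F \<circ> real_of_ereal) \<longlongrightarrow> F t) (at_left (ereal t))"
        using t dF isCont_weighted_stieltjes[OF M] st0 c lim0 limt
        by (auto simp: ereal_tendsto_simps intro!: AE_I2 continuous_intros mult_nonneg_nonneg)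
      have i: "set_integrable lborel {0<..<t} (\<lambda>l. c * weighted_stieltjes M l)" 
        using ftc(1)[OF prem] by simp
      have e: "(LBINT l:{0<..<t}. c * weighted_stieltjes M l) = F t - (- ln (Gamma a))"
        using ftc(2)[OF prem] t by (simp add: interval_lebesgue_integral_le_eq)
      have Fe: "F t - (- ln (Gamma a)) = - ln (laplace a s t / Gamma a)"
        using laplace_at_exp_pos[OF a, of s "ln t"] G by (simp add: F_def laplace_eq_at_exp[OF t] ln_div)
      have nn: "0 \<le> indicator {0<..<t} l * (c * weighted_stieltjes M l)" for l
        using st0[of l] c by (auto simp: indicator_def)
      have "(\<integral>\<^sup>+l. ennreal (c * weighted_stieltjes M l) * indicator {0<..<t} l \<partial>lborel)
        = (\<integral>\<^sup>+l. ennreal (indicator {0<..<t} l * (c * weighted_stieltjes M l)) \<partial>lborel)"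
        by (intro nn_integral_cong) (auto simp: indicator_def)
      also have "\<dots> = ennreal (\<integral>l. indicator {0<..<t} l * (c * weighted_stieltjes M l) \<partial>lborel)"
        using i nn by (intro nn_integral_eq_integral) (auto simp: set_integrable_def)
      also have "(\<integral>l. indicator {0<..<t} l * (c * weighted_stieltjes M l) \<partial>lborel) = - ln (laplace a s t / Gamma a)"
        using e unfolding set_lebesgue_integral_def real_scaleR_def Fe .
      moreover have "0 \<le> (\<integral>l. indicator {0<..<t} l * (c * weighted_stieltjes M l) \<partial>lborel)"
        using nn by (rule Bochner_Integration.integral_nonneg)
      ultimately show ?thesis by simp
    qed
    moreover have "(\<integral>\<^sup>+l. ennreal (c * weighted_stieltjes M l) * indicator {0<..<t} l \<partial>lborel)
       = (\<integral>\<^sup>+y. ennreal (indicator {0<..} y * ((1 - exp (- (t * y))) * (c * weighted_laplace M 0 y / y))) \<partial>lborel)"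
    proof -
      have meas: "(\<lambda>l. ennreal (weighted_stieltjes M l) * indicator {0<..<t} l) \<in> borel_measurable lborel"
      proof -
        interpret real_distribution M by (rule M)
        have [measurable]: "weighted_stieltjes M \<in> borel_measurable borel" unfolding weighted_stieltjes_def[OF M, abs_def] by measurable
        show ?thesis by measurable
      qed
      have [measurable]: "weighted_laplace M 0 \<in> borel_measurable borel" by (rule weighted_laplace_measurable[OF M])
      have "(\<integral>\<^sup>+l. ennreal (c * weighted_stieltjes M l) * indicator {0<..<t} l \<partial>lborel)
        = (\<integral>\<^sup>+l. ennreal c * (ennreal (weighted_stieltjes M l) * indicator {0<..<t} l) \<partial>lborel)"
        using st0 c by (intro nn_integral_cong) (auto simp: indicator_def ennreal_mult)
      also have "\<dots> = ennreal c * (\<integral>\<^sup>+l. ennreal (weighted_stieltjes M l) * indicator {0<..<t} l \<partial>lborel)"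
        by (rule nn_integral_cmult[OF meas])
      also have "\<dots> = ennreal c * (\<integral>\<^sup>+y. ennreal ((1 - exp (- (t * y))) * (weighted_laplace M 0 y / y)) * indicator {0<..} y \<partial>lborel)"
        by (simp add: nn_integral_weighted_stieltjes[OF M t])
      also have "\<dots> = (\<integral>\<^sup>+y. ennreal c * (ennreal ((1 - exp (- (t * y))) * (weighted_laplace M 0 y / y)) * indicator {0<..} y) \<partial>lborel)"
        by (rule nn_integral_cmult[symmetric]) measurable
      also have "\<dots> = (\<integral>\<^sup>+y. ennreal (indicator {0<..} y * ((1 - exp (- (t * y))) * (c * weighted_laplace M 0 y / y))) \<partial>lborel)"
      proof (rule nn_integral_cong)
        fix y :: real
        show "ennreal c * (ennreal ((1 - exp (- (t * y))) * (weighted_laplace M 0 y / y)) * indicator {0<..} y)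
          = ennreal (indicator {0<..} y * ((1 - exp (- (t * y))) * (c * weighted_laplace M 0 y / y)))"
        proof (cases "0 < y")
          case True
          have "0 \<le> (1 - exp (- (t * y))) * (weighted_laplace M 0 y / y)"
            using True t by (intro mult_nonneg_nonneg divide_nonneg_pos weighted_laplace_nonneg[OF M]) auto
          thus ?thesis using True c by (simp add: ennreal_mult[symmetric] mult_ac)
        qed simp
      qed
      finally show ?thesis .
    qed
    moreover have "0 \<le> indicator {0<..} y * ((1 - exp (- (t * y))) * (c * weighted_laplace M 0 y / y))" for y
    proof (cases "0 < y")
      case True
      thus ?thesis using t c weighted_laplace_nonneg[OF M, of y] by (auto intro!: mult_nonneg_nonneg divide_nonneg_pos)
    qed simp
    moreover have "(\<lambda>y. indicator {0<..} y * ((1 - exp (- (t * y))) * (c * weighted_laplace M 0 y / y))) \<in> borel_measurable lborel"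
    proof -
      have [measurable]: "weighted_laplace M 0 \<in> borel_measurable borel" by (rule weighted_laplace_measurable[OF M])
      show ?thesis by measurable
    qed
    ultimately show ?thesis by (intro has_bochner_integral_nn_integral) auto
  qed
  thus ?thesis using c M by (intro exI[of _ c] exI[of _ M]) auto
qed

lemma gamma_density_eq_gamma_weight: "gamma_density a x = gamma_weight a x / Gamma a"
  by (simp add: gamma_density_def gamma_weight_def)

text \<open>1 - exp (- x) >= x / (1 + x) >= min 1 x / 2. It reduces integrability of the Levy
  density to finiteness of the exponent at t = 1.\<close>

lemma min_one_le_exp: "0 < x \<Longrightarrow> min 1 x \<le> 2 * (1 - exp (- (x::real)))"
proof -
  assume x: "0 < x"
  have "1 + x \<le> exp x" by (rule exp_ge_add_one_self)
  hence "exp (- x) \<le> 1 / (1 + x)" using x by (simp add: exp_minus inverse_eq_divide frac_le)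
  hence "2 * (1 - 1 / (1 + x)) \<le> 2 * (1 - exp (- x))" by simp
  moreover have "min 1 x \<le> 2 * (1 - 1 / (1 + x))"
  proof (cases "x \<le> 1")
    case True
    have "x * (1 + x) \<le> x * 2" using True x by (intro mult_left_mono) auto
    thus ?thesis using True x by (simp add: field_simps)
  qed (use x in \<open>simp add: field_simps\<close>)
  ultimately show ?thesis by linarith
qed

theorem theorem4:
  fixes M :: "'a measure" and X :: "'a \<Rightarrow> real" and a s :: real
  assumes "prob_space M"
    and "a > 0" and "s > 0"
    and "distributed M lborel X (\<lambda>x. ennreal (gamma_density a x))"
  shows "generalized_gamma_convolution (distr M borel (\<lambda>\<omega>. X \<omega> powr (- s)))"
proof -
  interpret prob_space M by fact
  have Xm [measurable]: "X \<in> borel_measurable M" using distributed_measurable[OF assms(4)] by simp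
  have G: "0 < Gamma a" by (rule Gamma_real_pos[OF assms(2)])
  have g0: "0 \<le> gamma_density a x" for x using gamma_weight_nonneg[of a x] G by (simp add: gamma_density_eq_gamma_weight)
  have gm: "gamma_density a \<in> borel_measurable borel" unfolding gamma_density_eq_gamma_weight[abs_def] by measurable
  have Xpos: "AE \<omega> in M. 0 < X \<omega>"
  proof -
    have "AE x in density lborel (\<lambda>x. ennreal (gamma_density a x)). 0 < x"
      using gm by (subst AE_density) (auto intro!: AE_I2 simp: gamma_density_def indicator_def split: if_splits)
    hence "AE x in distr M lborel X. 0 < x"
      unfolding distributed_distr_eq_density[OF assms(4), symmetric] .
    thus ?thesis by (subst (asm) AE_distr_iff) auto
  qed
  have LT: "(\<integral>x. exp (- t * x) \<partial>distr M borel (\<lambda>\<omega>. X \<omega> powr (- s))) = laplace a s t / Gamma a" for t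
  proof -
    have "(\<integral>x. exp (- t * x) \<partial>distr M borel (\<lambda>\<omega>. X \<omega> powr (- s))) = (\<integral>\<omega>. exp (- t * X \<omega> powr (- s)) \<partial>M)"
      by (subst integral_distr) auto
    also have "\<dots> = (\<integral>x. gamma_density a x * exp (- t * x powr (- s)) \<partial>lborel)"
      using distributed_integral[OF assms(4), of "\<lambda>x. exp (- t * x powr (- s))"] g0 by simp
    also have "\<dots> = laplace a s t / Gamma a"
      unfolding laplace_def gamma_density_eq_gamma_weight by (subst integral_divide_zero[symmetric]) simp
    finally show ?thesis .
  qed
  obtain c N where c: "0 \<le> c" and N: "real_distribution N" and
    rep: "\<And>t. 0 \<le> t \<Longrightarrow> has_bochner_integral lborel (\<lambda>y. indicator {0<..} y * ((1 - exp (- (t * y))) * (c * weighted_laplace N 0 y / y)))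
        (- ln (laplace a s t / Gamma a))"
    using laplace_exponent[OF assms(2,3)] by blast
  have [measurable]: "weighted_laplace N 0 \<in> borel_measurable borel" by (rule weighted_laplace_measurable[OF N])
  show ?thesis unfolding generalized_gamma_convolution_def
  \<comment> \<open>The drift is 0: the whole exponent is already the integral in
    \<open>rep\<close>.\<close>
  proof (intro conjI exI[of _ 0] exI[of _ "\<lambda>y. c * weighted_laplace N 0 y"] allI impI)
    show "prob_space (distr M borel (\<lambda>\<omega>. X \<omega> powr (- s)))" by (rule prob_space_distr) measurable
    \<comment> \<open>\<open>powr\<close> returns 0 at base 0, so positivity of the power has to
      come from positivity of X.\<close>
    show "AE x in distr M borel (\<lambda>\<omega>. X \<omega> powr (- s)). 0 < x"
      by (subst AE_distr_iff) (use Xpos in \<open>auto elim!: eventually_mono\<close>)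
    show "completely_monotone (\<lambda>y. c * weighted_laplace N 0 y)" by (rule completely_monotone_weighted_laplace[OF N c])
    show "set_integrable lborel {0<..} (\<lambda>x. min 1 x * (c * weighted_laplace N 0 x / x))"
      unfolding set_integrable_def
    proof (rule Bochner_Integration.integrable_bound)
      show "integrable lborel (\<lambda>y. 2 * (indicator {0<..} y * ((1 - exp (- (1 * y))) * (c * weighted_laplace N 0 y / y))))"
        using has_bochner_integral_mult_right[OF rep[of 1]] by (auto simp only: has_bochner_integral_iff)
      show "AE x in lborel. norm (indicator {0<..} x *\<^sub>R (min 1 x * (c * weighted_laplace N 0 x / x)))
          \<le> norm (2 * (indicator {0<..} x * ((1 - exp (- (1 * x))) * (c * weighted_laplace N 0 x / x))))"
      proof (rule AE_I2)
        fix x :: real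
        show "norm (indicator {0<..} x *\<^sub>R (min 1 x * (c * weighted_laplace N 0 x / x)))
          \<le> norm (2 * (indicator {0<..} x * ((1 - exp (- (1 * x))) * (c * weighted_laplace N 0 x / x))))"
        proof (cases "0 < x")
          case True
          have k: "0 \<le> c * weighted_laplace N 0 x / x" using True c weighted_laplace_nonneg[OF N, of x] by simp
          have "min 1 x * (c * weighted_laplace N 0 x / x) \<le> 2 * ((1 - exp (- (1 * x))) * (c * weighted_laplace N 0 x / x))"
            unfolding mult_1_left mult.assoc[of 2, symmetric] by (rule mult_right_mono[OF min_one_le_exp[OF True] k])
          moreover have "0 \<le> min 1 x * (c * weighted_laplace N 0 x / x)" using True k by (intro mult_nonneg_nonneg) auto
          moreover have "indicator {0<..} x = (1::real)" using True by simp
          ultimately show ?thesis unfolding real_norm_def by (simp only: scaleR_one mult_1_left abs_of_nonneg)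
        qed simp
      qed
    qed measurable
    fix t :: real assume t: "0 \<le> t"
    show "- ln (\<integral>x. exp (- t * x) \<partial>distr M borel (\<lambda>\<omega>. X \<omega> powr (- s)))
      = 0 * t + (LBINT x:{0<..}. (1 - exp (- t * x)) * (c * weighted_laplace N 0 x / x))"
      unfolding LT using rep[OF t] by (simp add: has_bochner_integral_iff set_lebesgue_integral_def)
  qed simp_all
qed

end
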